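(* Let $G$ be a compact Lie group and let $S$ be a closed orientable surface of genus $g\ge 2$. Then the volume of the representation variety $\mathrm{Hom}(\pi_1(S),G)$ can be computed by the formula $$\sum_{\lambda\in\hat G}(\dim\lambda)^{\chi(S)}=|G|^{\chi(S)-1}\,|\mathrm{Hom}(\pi_1(S),G)|$$ if the sum on the left-hand side converges.
   Context: $\hat G$ is the (countable) set of isomorphism classes of complex irreducible representations of $G$; $\dim\lambda$ is the complex dimension of $\lambda$; $\chi(S)=2-2g$ is the Euler characteristic. Fix a (not necessarily normalized) bi-invariant Haar measure $dx$ on $G$ and put $|G|=\int_G dx$; powers of $G$ carry product measures. Volume of the representation variety: use the presentation $\pi_1(S)=\langle a_1,b_1,\dots,a_g,b_g\mid [a_1,b_1]\cdots[a_g,b_g]\rangle$, $[a,b]=aba^{-1}b^{-1}$, with presentation map $q_g:G^{2g}\to G$, $q_g(x_1,y_1,\dots,x_g,y_g)=[x_1,y_1]\cdots[x_g,y_g]$, so that $\mathrm{Hom}(\pi_1(S),G)=q_g^{-1}(1)$. The volume distribution $f_g$ is the distribution on $G$ (continuous linear functional on $C^\infty(G)$) given by the push-forward measure, $$\int_G f_g(w)h(w)\,dw=\int_{G^{2g}}h(q_g(x_1,y_1,\dots,x_g,y_g))\,dx_1dy_1\cdots dx_gdy_g,\qquad h\in C^\infty(G).$$ A distribution is called regular at $w$ if its restriction to some open neighborhood of $w$ is a $C^\infty$ function, so that its value at $w$ is well-defined. The volume is $|\mathrm{Hom}(\pi_1(S),G)|:=f_g(1)$, defined when $f_g$ is regular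 at $1$. *)

theory Defs
  imports "HOL-Analysis.Analysis" "HOL-Algebra.Group" "Jordan_Normal_Form.Matrix"
begin

section \<open>Smooth functions on open subsets of Euclidean n-space\<close>

text \<open>
  The model space is \<^const>\<open>Euclidean_space\<close>, whose points are the sequences vanishing from
  index \<open>n\<close> on; the case \<open>n = 0\<close> is needed for finite groups.  A function is of class
  \<open>C\<^sup>k\<close> if all iterated partial derivatives of order at most \<open>k\<close> exist and are continuous.
  The set \<open>V\<close> is meant to be open in \<^term>\<open>Euclidean_space n\<close>, so that
  \<open>x(i := t)\<close> remains in \<open>V\<close> for \<open>t\<close> near \<open>x i\<close>.
\<close>

primrec Ck_on :: "nat \<Rightarrow> nat \<Rightarrow> (nat \<Rightarrow> real) set \<Rightarrow> ((nat \<Rightarrow> real) \<Rightarrow> real) \<Rightarrow> bool" where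
  "Ck_on 0 n V f \<longleftrightarrow>
     continuous_map (subtopology (Euclidean_space n) V) euclideanreal f"
| "Ck_on (Suc k) n V f \<longleftrightarrow>
     continuous_map (subtopology (Euclidean_space n) V) euclideanreal f \<and>
     (\<forall>i<n. \<exists>f'. (\<forall>x\<in>V. ((\<lambda>t. f (x(i := t))) has_real_derivative f' x) (at (x i))) \<and>
                 Ck_on k n V f')"

definition Cinf_on :: "nat \<Rightarrow> (nat \<Rightarrow> real) set \<Rightarrow> ((nat \<Rightarrow> real) \<Rightarrow> real) \<Rightarrow> bool" where
  "Cinf_on n V f \<longleftrightarrow> (\<forall>k. Ck_on k n V f)"


section \<open>Smooth manifolds and maps\<close>

text \<open>
  A chart is a pair of its domain and its coordinate map.  An atlas need not be maximal: smooth
  functions and smooth maps depend only on the maximal atlas that it generates.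
\<close>

type_synonym 'a chart = "'a set \<times> ('a \<Rightarrow> nat \<Rightarrow> real)"

definition is_chart :: "nat \<Rightarrow> 'a topology \<Rightarrow> 'a chart \<Rightarrow> bool" where
  "is_chart n X c \<longleftrightarrow>
     openin X (fst c) \<and> openin (Euclidean_space n) (snd c ` fst c) \<and>
     homeomorphic_map (subtopology X (fst c))
       (subtopology (Euclidean_space n) (snd c ` fst c)) (snd c)"

definition chart_inv :: "'a chart \<Rightarrow> (nat \<Rightarrow> real) \<Rightarrow> 'a" where
  "chart_inv c = inv_into (fst c) (snd c)"

definition smooth_atlas :: "nat \<Rightarrow> 'a topology \<Rightarrow> 'a chart set \<Rightarrow> bool" where
  "smooth_atlas n X A \<longleftrightarrow>
     (\<forall>c\<in>A. is_chart n X c) \<and> (\<Union>c\<in>A. fst c) = topspace X \<and>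
     (\<forall>c\<in>A. \<forall>d\<in>A. \<forall>j<n. Cinf_on n (snd c ` (fst c \<inter> fst d)) (\<lambda>u. snd d (chart_inv c u) j))"

definition smooth_fun_on :: "nat \<Rightarrow> 'a chart set \<Rightarrow> 'a set \<Rightarrow> ('a \<Rightarrow> real) \<Rightarrow> bool" where
  "smooth_fun_on n A W f \<longleftrightarrow>
     (\<forall>c\<in>A. Cinf_on n (snd c ` (fst c \<inter> W)) (\<lambda>u. f (chart_inv c u)))"

definition smooth_map ::
  "nat \<Rightarrow> 'a topology \<Rightarrow> 'a chart set \<Rightarrow> nat \<Rightarrow> 'b topology \<Rightarrow> 'b chart set \<Rightarrow> ('a \<Rightarrow> 'b) \<Rightarrow> bool"
  where
  "smooth_map m X A n Y B f \<longleftrightarrow>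
     continuous_map X Y f \<and>
     (\<forall>c\<in>A. \<forall>d\<in>B. \<forall>j<n.
        Cinf_on m (snd c ` {x \<in> fst c. f x \<in> fst d}) (\<lambda>u. snd d (f (chart_inv c u)) j))"

text \<open>Product charts, with the identification of \<open>(u, v)\<close> with \<open>(u\<^sub>0,\<dots>,u\<^sub>m\<^sub>-\<^sub>1,v\<^sub>0,v\<^sub>1,\<dots>)\<close>.\<close>

definition product_atlas :: "nat \<Rightarrow> 'a chart set \<Rightarrow> 'b chart set \<Rightarrow> ('a \<times> 'b) chart set" where
  "product_atlas m A B =
     {(fst c \<times> fst d, \<lambda>(x, y) i. if i < m then snd c x i else snd d y (i - m)) | c d. c \<in> A \<and> d \<in> B}"


section \<open>Compact Lie groups and Haar measure\<close>

text \<open>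
  The topology of the group is the subspace topology that its carrier inherits from the ambient
  Hausdorff space \<open>'a\<close> (the carrier may be all of \<open>'a\<close>).
\<close>

abbreviation group_top :: "('a::t2_space, 'b) monoid_scheme \<Rightarrow> 'a topology" where
  "group_top G \<equiv> top_of_set (carrier G)"

locale lie_group = group G
  for G :: "('a::t2_space, 'b) monoid_scheme" (structure) +
  fixes n :: nat and A :: "'a chart set"
  assumes second_countable_group: "second_countable (group_top G)"
    and atlas: "smooth_atlas n (group_top G) A"
    and smooth_mult:
      "smooth_map (n + n) (prod_topology (group_top G) (group_top G)) (product_atlas n A A)
         n (group_top G) A (\<lambda>(x, y). x \<otimes> y)"
    and smooth_inv: "smooth_map n (group_top G) A n (group_top G) A (\<lambda>x. inv x)"

locale compact_lie_group = lie_group +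
  assumes compact_carrier: "compact (carrier G)"

text \<open>
  Regularity of the measure is automatic, since every finite Borel measure on a
  compact second countable Hausdorff space is regular.
\<close>

definition bi_invariant_haar :: "('a::t2_space, 'b) monoid_scheme \<Rightarrow> 'a measure \<Rightarrow> bool" where
  "bi_invariant_haar G \<mu> \<longleftrightarrow>
     space \<mu> = carrier G \<and> sets \<mu> = sets (restrict_space borel (carrier G)) \<and>
     (\<forall>K. compact K \<and> K \<subseteq> carrier G \<longrightarrow> emeasure \<mu> K < \<infinity>) \<and>
     emeasure \<mu> (carrier G) \<noteq> 0 \<and>
     (\<forall>x\<in>carrier G. \<forall>B\<in>sets \<mu>.
        emeasure \<mu> ((\<lambda>y. x \<otimes>\<^bsub>G\<^esub> y) ` B) = emeasure \<mu> B \<and>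
        emeasure \<mu> ((\<lambda>y. y \<otimes>\<^bsub>G\<^esub> x) ` B) = emeasure \<mu> B)"

definition haar_volume :: "('a::t2_space, 'b) monoid_scheme \<Rightarrow> 'a measure \<Rightarrow> real" where
  "haar_volume G \<mu> = measure \<mu> (carrier G)"


section \<open>Isomorphism classes of irreducible complex representations\<close>

text \<open>
  Every finite-dimensional complex representation is isomorphic to a matrix representation, so
  isomorphism classes are taken among continuous homomorphisms into invertible complex matrices
  of arbitrary size.  Two functions that agree on the carrier are isomorphic, hence the values
  outside the carrier do not affect the set of classes.
\<close>

definition matrix_rep ::
  "('a::t2_space, 'b) monoid_scheme \<Rightarrow> nat \<Rightarrow> ('a \<Rightarrow> complex mat) \<Rightarrow> bool" where
  "matrix_rep G d \<rho> \<longleftrightarrow>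
     (\<forall>x\<in>carrier G. \<rho> x \<in> carrier_mat d d) \<and>
     \<rho> \<one>\<^bsub>G\<^esub> = 1\<^sub>m d \<and>
     (\<forall>x\<in>carrier G. \<forall>y\<in>carrier G. \<rho> (x \<otimes>\<^bsub>G\<^esub> y) = \<rho> x * \<rho> y) \<and>
     (\<forall>i<d. \<forall>j<d. continuous_on (carrier G) (\<lambda>x. \<rho> x $$ (i, j)))"

definition vec_subspace :: "nat \<Rightarrow> complex Matrix.vec set \<Rightarrow> bool" where
  "vec_subspace d W \<longleftrightarrow>
     W \<subseteq> carrier_vec d \<and> 0\<^sub>v d \<in> W \<and>
     (\<forall>u\<in>W. \<forall>v\<in>W. u + v \<in> W) \<and> (\<forall>a. \<forall>u\<in>W. a \<cdot>\<^sub>v u \<in> W)"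

definition irreducible_rep ::
  "('a::t2_space, 'b) monoid_scheme \<Rightarrow> nat \<Rightarrow> ('a \<Rightarrow> complex mat) \<Rightarrow> bool" where
  "irreducible_rep G d \<rho> \<longleftrightarrow>
     matrix_rep G d \<rho> \<and> 0 < d \<and>
     (\<forall>W. vec_subspace d W \<and> (\<forall>x\<in>carrier G. \<forall>u\<in>W. \<rho> x *\<^sub>v u \<in> W) \<longrightarrow>
          W = {0\<^sub>v d} \<or> W = carrier_vec d)"

definition rep_dim :: "('a, 'b) monoid_scheme \<Rightarrow> ('a \<Rightarrow> complex mat) \<Rightarrow> nat" where
  "rep_dim G \<rho> = dim_row (\<rho> \<one>\<^bsub>G\<^esub>)"

definition rep_isomorphic ::
  "('a, 'b) monoid_scheme \<Rightarrow> ('a \<Rightarrow> complex mat) \<Rightarrow> ('a \<Rightarrow> complex mat) \<Rightarrow> bool" where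
  "rep_isomorphic G \<rho> \<sigma> \<longleftrightarrow>
     (\<exists>P \<in> carrier_mat (rep_dim G \<sigma>) (rep_dim G \<rho>).
        invertible_mat P \<and> (\<forall>x\<in>carrier G. P * \<rho> x = \<sigma> x * P))"

definition irreducible_reps ::
  "('a::t2_space, 'b) monoid_scheme \<Rightarrow> ('a \<Rightarrow> complex mat) set" where
  "irreducible_reps G = {\<rho>. \<exists>d. irreducible_rep G d \<rho>}"

definition irrep_classes ::
  "('a::t2_space, 'b) monoid_scheme \<Rightarrow> ('a \<Rightarrow> complex mat) set set" where
  "irrep_classes G =
     irreducible_reps G //
       {(\<rho>, \<sigma>). \<rho> \<in> irreducible_reps G \<and> \<sigma> \<in> irreducible_reps G \<and> rep_isomorphic G \<rho> \<sigma>}"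

text \<open>Isomorphic representations have equal dimension, so the image below is a singleton.\<close>

definition class_dim :: "('a, 'b) monoid_scheme \<Rightarrow> ('a \<Rightarrow> complex mat) set \<Rightarrow> nat" where
  "class_dim G l = the_elem (rep_dim G ` l)"


section \<open>The volume distribution\<close>

definition euler_char :: "nat \<Rightarrow> int" where
  "euler_char g = 2 - 2 * int g"

definition group_commutator :: "('a, 'b) monoid_scheme \<Rightarrow> 'a \<Rightarrow> 'a \<Rightarrow> 'a" where
  "group_commutator G x y = x \<otimes>\<^bsub>G\<^esub> y \<otimes>\<^bsub>G\<^esub> inv\<^bsub>G\<^esub> x \<otimes>\<^bsub>G\<^esub> inv\<^bsub>G\<^esub> y"

text \<open>
  The presentation map.  A point \<open>(x\<^sub>1, y\<^sub>1, \<dots>, x\<^sub>g, y\<^sub>g)\<close> is stored as a function \<open>z\<close>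
  on \<open>{..<2 * g}\<close> with \<open>z (2 * k)\<close> and \<open>z (2 * k + 1)\<close> the \<open>k\<close>-th pair, counting from 0.
\<close>

primrec presentation_map :: "('a, 'b) monoid_scheme \<Rightarrow> nat \<Rightarrow> (nat \<Rightarrow> 'a) \<Rightarrow> 'a" where
  "presentation_map G 0 z = \<one>\<^bsub>G\<^esub>"
| "presentation_map G (Suc k) z =
     presentation_map G k z \<otimes>\<^bsub>G\<^esub> group_commutator G (z (2 * k)) (z (2 * k + 1))"

definition volume_distribution ::
  "('a, 'b) monoid_scheme \<Rightarrow> 'a measure \<Rightarrow> nat \<Rightarrow> ('a \<Rightarrow> real) \<Rightarrow> real" where
  "volume_distribution G \<mu> g h =
     (\<integral>z. h (presentation_map G g z) \<partial>(PiM {..<2 * g} (\<lambda>_. \<mu>)))"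

text \<open>
  The restriction of the distribution \<open>D\<close> to the open set \<open>U\<close> is the function \<open>\<phi>\<close>: the two
  agree on all test functions supported in \<open>U\<close> (supports are compact, as the group is).
\<close>

definition restricts_to ::
  "('a::t2_space, 'b) monoid_scheme \<Rightarrow> nat \<Rightarrow> 'a chart set \<Rightarrow> 'a measure \<Rightarrow>
     (('a \<Rightarrow> real) \<Rightarrow> real) \<Rightarrow> 'a set \<Rightarrow> ('a \<Rightarrow> real) \<Rightarrow> bool" where
  "restricts_to G n A \<mu> D U \<phi> \<longleftrightarrow>
     (\<forall>h. smooth_fun_on n A (carrier G) h \<and>
          group_top G closure_of {x \<in> carrier G. h x \<noteq> 0} \<subseteq> U \<longrightarrow>
          D h = (\<integral>x. \<phi> x * h x \<partial>\<mu>))"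

definition regular_with_value ::
  "('a::t2_space, 'b) monoid_scheme \<Rightarrow> nat \<Rightarrow> 'a chart set \<Rightarrow> 'a measure \<Rightarrow>
     (('a \<Rightarrow> real) \<Rightarrow> real) \<Rightarrow> 'a \<Rightarrow> real \<Rightarrow> bool" where
  "regular_with_value G n A \<mu> D w v \<longleftrightarrow>
     (\<exists>U \<phi>. openin (group_top G) U \<and> w \<in> U \<and>
            smooth_fun_on n A U \<phi> \<and> restricts_to G n A \<mu> D U \<phi> \<and> \<phi> w = v)"

definition regular_at ::
  "('a::t2_space, 'b) monoid_scheme \<Rightarrow> nat \<Rightarrow> 'a chart set \<Rightarrow> 'a measure \<Rightarrow>
     (('a \<Rightarrow> real) \<Rightarrow> real) \<Rightarrow> 'a \<Rightarrow> bool" where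
  "regular_at G n A \<mu> D w \<longleftrightarrow> (\<exists>v. regular_with_value G n A \<mu> D w v)"

definition distribution_value ::
  "('a::t2_space, 'b) monoid_scheme \<Rightarrow> nat \<Rightarrow> 'a chart set \<Rightarrow> 'a measure \<Rightarrow>
     (('a \<Rightarrow> real) \<Rightarrow> real) \<Rightarrow> 'a \<Rightarrow> real" where
  "distribution_value G n A \<mu> D w = (THE v. regular_with_value G n A \<mu> D w v)"

definition rep_variety_volume ::
  "('a::t2_space, 'b) monoid_scheme \<Rightarrow> nat \<Rightarrow> 'a chart set \<Rightarrow> 'a measure \<Rightarrow> nat \<Rightarrow> real" where
  "rep_variety_volume G n A \<mu> g =
     distribution_value G n A \<mu> (volume_distribution G \<mu> g) \<one>\<^bsub>G\<^esub>"

end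

theory Submission
  imports Defs "Jordan_Normal_Form.Schur_Decomposition" "Jordan_Normal_Form.Spectral_Radius"
begin

text \<open>
  Put \<open>V = |G|\<close> and \<open>F x = \<Sum>\<^sub>\<lambda> (V / dim \<lambda>)\<^sup>2\<^sup>g\<^sup>-\<^sup>1 \<chi>\<^sub>\<lambda> (x\<^sup>-\<^sup>1)\<close>.  Since \<open>|\<chi>\<^sub>\<lambda>| \<le> dim \<lambda>\<close>, the series converges
  uniformly, \<open>F\<close> is continuous, and \<open>F 1\<close> is \<open>V\<^sup>2\<^sup>g\<^sup>-\<^sup>1\<close> times the given sum.  The push-forward of the product
  measure under the presentation map and the measure \<open>F dx\<close> have the same integrals against the
  coefficients of an irreducible \<open>\<rho>\<close>, namely the entries of \<open>(V / dim \<rho>)\<^sup>2\<^sup>g\<close> times the identity, by Schur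
  orthogonality.  By the Peter-Weyl theorem the two measures agree, so \<open>Re F\<close> represents the volume
  distribution on all of \<open>G\<close>.  A smooth representative near the identity has the same value
  there, as testing against bump functions shows.

  The part of the Peter-Weyl theorem that is needed follows without spectral theory: a nonzero
  continuous \<open>f\<close> orthogonal to all irreducible coefficients gives a nonzero hermitian convolution
  kernel \<open>k\<close> that annihilates every function spanned by such coefficients, whereas power iteration
  produces an eigenfunction of \<open>k * k\<close> with positive eigenvalue, whose finite-dimensional eigenspace
  contains an irreducible representation.
\<close>

section \<open>Haar integration on a compact second countable group\<close>

text \<open>The exponent comes from the handles. Schur orthogonality, applied twice, gives each
  commutator the average \<open>(V / dim \<rho>)^2\<close> times the identity, while a character of
  the series contributes one factor \<open>V / dim \<lambda>\<close> when it is paired with a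
  coefficient of its own class. Hence \<open>2g\<close> on the side of the push-forward and
  \<open>2g - 1\<close> in the coefficients of \<open>F\<close>.

  The series is controlled in the uniform norm only, so \<open>F\<close> is continuous but its
  derivatives are out of reach. Regularity at the identity therefore enters as a hypothesis of the
  first conclusion, and the comparison with a smooth representative has to work for a merely
  continuous density.

  Matrix representations need not be unitary. The value at \<open>inv x\<close> replaces complex
  conjugation throughout, and the bound on characters comes from compactness: the powers of a matrix
  with an eigenvalue outside the unit disc are unbounded.\<close>

lemma openin_prod_sets_pair_measure:
  assumes sc: "second_countable X" and W: "openin (prod_topology X X) W"
    and M: "\<And>U. openin X U \<Longrightarrow> U \<in> sets M" and N: "\<And>U. openin X U \<Longrightarrow> U \<in> sets N"
  shows "W \<in> sets (M \<Otimes>\<^sub>M N)"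
proof -
  obtain B where B: "countable B" "\<And>V. V \<in> B \<Longrightarrow> openin X V"
    "\<And>U x. openin X U \<Longrightarrow> x \<in> U \<Longrightarrow> \<exists>V\<in>B. x \<in> V \<and> V \<subseteq> U"
    using sc unfolding second_countable_def by metis
  \<comment> \<open>A general open set is an arbitrary union of rectangles; the countable basis
    reduces this to countably many.\<close>
  define P where "P = {p \<in> B \<times> B. fst p \<times> snd p \<subseteq> W}"
  have cP: "countable P"
    unfolding P_def by (rule countable_subset[of _ "B \<times> B"]) (use B(1) in auto)
  have W_eq: "W = (\<Union>p\<in>P. fst p \<times> snd p)"
  proof
    show "W \<subseteq> (\<Union>p\<in>P. fst p \<times> snd p)"
    proof
      fix z assume z: "z \<in> W"
      obtain x y where xy: "z = (x, y)" by (cases z)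
      obtain U V where UV: "openin X U" "openin X V" "x \<in> U" "y \<in> V" "U \<times> V \<subseteq> W"
      proof -
        have "\<forall>x y. (x, y) \<in> W \<longrightarrow> (\<exists>U V. openin X U \<and> openin X V \<and> x \<in> U \<and> y \<in> V \<and> U \<times> V \<subseteq> W)"
          using W by (simp only: openin_prod_topology_alt)
        then show thesis using z[unfolded xy] that by blast
      qed
      obtain U' V' where "U' \<in> B" "V' \<in> B" "x \<in> U'" "U' \<subseteq> U" "y \<in> V'" "V' \<subseteq> V"
        using B(3)[OF UV(1,3)] B(3)[OF UV(2,4)] by blast
      then show "z \<in> (\<Union>p\<in>P. fst p \<times> snd p)"
        using UV(5) xy by (intro UN_I[of "(U', V')"]) (auto simp: P_def)
    qed
  qed (auto simp: P_def)
  have "fst p \<times> snd p \<in> sets (M \<Otimes>\<^sub>M N)" if "p \<in> P" for p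
    using that B(2) M N by (auto simp: P_def)
  then show ?thesis
    unfolding W_eq using cP by (intro sets.countable_UN'') auto
qed

text \<open>The harmonic analysis depends on the topological group and its measure only; smoothness
  returns with the test functions near the identity.\<close>

locale haar_group = group G
  for G :: "('a::t2_space, 'b) monoid_scheme" (structure) +
  fixes \<mu> :: "'a measure"
  assumes compact_carrier: "compact (carrier G)"
    and second_countable_carrier: "second_countable (group_top G)"
    and continuous_mult: "continuous_on (carrier G \<times> carrier G) (\<lambda>z. fst z \<otimes> snd z)"
    and continuous_inv: "continuous_on (carrier G) (\<lambda>x. inv x)"
    and haar: "bi_invariant_haar G \<mu>"
begin

abbreviation vol :: real where "vol \<equiv> haar_volume G \<mu>"

abbreviation cts :: "('a \<Rightarrow> 'c::topological_space) \<Rightarrow> bool" where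
  "cts \<equiv> continuous_on (carrier G)"

abbreviation cts2 :: "('a \<times> 'a \<Rightarrow> 'c::topological_space) \<Rightarrow> bool" where
  "cts2 \<equiv> continuous_on (carrier G \<times> carrier G)"

text \<open>Covers both the Haar measure and the push-forward under the presentation map, which
  occur together in Fubini's theorem.\<close>

definition borel_finite :: "'a measure \<Rightarrow> bool" where
  "borel_finite M \<longleftrightarrow> finite_measure M \<and> sets M = sets (restrict_space borel (carrier G))"

lemma space_\<mu>: "space \<mu> = carrier G"
  and sets_\<mu>: "sets \<mu> = sets (restrict_space borel (carrier G))"
  using haar by (auto simp: bi_invariant_haar_def)

lemma finite_\<mu>: "finite_measure \<mu>"
proof (rule finite_measureI)
  have "emeasure \<mu> (carrier G) < \<infinity>"
    using haar compact_carrier by (auto simp: bi_invariant_haar_def)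
  then show "emeasure \<mu> (space \<mu>) \<noteq> \<infinity>"
    by (simp add: space_\<mu>)
qed

lemma borel_\<mu>: "borel_finite \<mu>"
  using finite_\<mu> sets_\<mu> by (simp add: borel_finite_def)

lemma borel_finiteD:
  assumes "borel_finite M"
  shows "finite_measure M" "sets M = sets \<mu>" "space M = carrier G"
  using assms sets_\<mu> space_\<mu> sets_eq_imp_space_eq[of M \<mu>] by (auto simp: borel_finite_def)

lemma vol_pos: "vol > 0"
proof -
  interpret finite_measure \<mu> by (rule finite_\<mu>)
  have "emeasure \<mu> (carrier G) \<noteq> 0"
    using haar by (auto simp: bi_invariant_haar_def)
  then show ?thesis
    by (simp add: haar_volume_def emeasure_eq_measure zero_less_measure_iff)
qed

lemma measure_space_\<mu>: "measure \<mu> (space \<mu>) = vol"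
  by (simp add: haar_volume_def space_\<mu>)

lemma openin_in_sets:
  assumes "borel_finite M" "openin (group_top G) U" shows "U \<in> sets M"
proof -
  obtain T where "open T" "U = carrier G \<inter> T"
    using assms(2) by (auto simp: openin_open)
  then show ?thesis
    using assms(1) by (auto simp: borel_finite_def sets_restrict_space)
qed

section \<open>Continuous functions: measurability, integrability and Fubini's theorem\<close>

lemma cts_compose:
  assumes "cts u" "continuous_on S f" "\<And>x. x \<in> S \<Longrightarrow> f x \<in> carrier G"
  shows "continuous_on S (\<lambda>x. u (f x))"
  by (rule continuous_on_compose2[OF assms(1,2)]) (use assms(3) in auto)

lemma cts_mult:
  assumes "continuous_on S f" "continuous_on S h"
    and "\<And>x. x \<in> S \<Longrightarrow> f x \<in> carrier G" "\<And>x. x \<in> S \<Longrightarrow> h x \<in> carrier G"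
  shows "continuous_on S (\<lambda>x. f x \<otimes> h x)"
  using continuous_on_compose2[OF continuous_mult continuous_on_Pair[OF assms(1,2)]] assms(3,4)
  by fastforce

lemma cts_inv:
  assumes "continuous_on S f" "\<And>x. x \<in> S \<Longrightarrow> f x \<in> carrier G"
  shows "continuous_on S (\<lambda>x. inv (f x))"
  by (rule cts_compose[OF continuous_inv assms])

lemma cts_fst: 
  "cts u \<Longrightarrow> cts2 (\<lambda>z. u (fst z))"
  by (rule cts_compose) (auto intro!: continuous_intros)

lemma cts_snd: 
  "cts u \<Longrightarrow> cts2 (\<lambda>z. u (snd z))"
  by (rule cts_compose) (auto intro!: continuous_intros)

lemmas cts_intros = cts_mult cts_inv
  cts_fst cts_snd continuous_on_cnj

lemma cts_bounded:
  fixes f :: "'a \<Rightarrow> 'c::real_normed_vector"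
  assumes "cts f"
  obtains B where "B > 0" "\<And>x. x \<in> carrier G \<Longrightarrow> norm (f x) \<le> B"
proof -
  have "bounded (f ` carrier G)"
    using assms compact_carrier compact_continuous_image compact_imp_bounded by blast
  then show ?thesis
    using that unfolding bounded_pos by blast
qed

lemma cts_measurable:
  fixes f :: "'a \<Rightarrow> 'c::topological_space"
  assumes "borel_finite M" "cts f"
  shows "f \<in> borel_measurable M"
  using borel_measurable_continuous_on_restrict[OF assms(2)] assms(1)
    measurable_cong_sets[of M "restrict_space borel (carrier G)" borel borel]
  by (auto simp: borel_finite_def)

lemma cts_integrable:
  fixes f :: "'a \<Rightarrow> 'c::{banach, second_countable_topology}"
  assumes "borel_finite M" "cts f"
  shows "integrable M f"
proof -
  interpret finite_measure M using borel_finiteD[OF assms(1)] by blast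
  obtain B where "\<And>x. x \<in> carrier G \<Longrightarrow> norm (f x) \<le> B"
    using cts_bounded[OF assms(2)] by metis
  then show ?thesis
    by (intro integrable_const_bound[of _ B] cts_measurable assms AE_I2)
       (auto simp: borel_finiteD(3)[OF assms(1)])
qed

lemma pair_cts_measurable:
  fixes f :: "'a \<times> 'a \<Rightarrow> 'c::topological_space"
  assumes "borel_finite M" "borel_finite N" "cts2 f"
  shows "f \<in> borel_measurable (M \<Otimes>\<^sub>M N)"
proof (rule borel_measurableI)
  fix S :: "'c set" assume S: "open S"
  have "openin (top_of_set (carrier G \<times> carrier G)) (carrier G \<times> carrier G \<inter> f -` S)"
    using assms(3) S by (rule continuous_openin_preimage_gen)
  then have "openin (prod_topology (group_top G) (group_top G)) (carrier G \<times> carrier G \<inter> f -` S)"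
    by (simp add: prod_topology_subtopology_eu)
  then have "carrier G \<times> carrier G \<inter> f -` S \<in> sets (M \<Otimes>\<^sub>M N)"
    using openin_in_sets assms(1,2) by (blast intro: openin_prod_sets_pair_measure[OF second_countable_carrier])
  then show "f -` S \<inter> space (M \<Otimes>\<^sub>M N) \<in> sets (M \<Otimes>\<^sub>M N)"
    by (simp add: space_pair_measure borel_finiteD(3)[OF assms(1)] borel_finiteD(3)[OF assms(2)] Int_commute)
qed

lemma pair_cts_integrable:
  fixes f :: "'a \<times> 'a \<Rightarrow> 'c::{banach, second_countable_topology}"
  assumes "borel_finite M" "borel_finite N" "cts2 f"
  shows "integrable (M \<Otimes>\<^sub>M N) f"
proof -
  interpret M: finite_measure M using borel_finiteD[OF assms(1)] by blast
  interpret N: finite_measure N using borel_finiteD[OF assms(2)] by blast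
  interpret finite_measure "M \<Otimes>\<^sub>M N" by (rule finite_measure_pair_measure) unfold_locales
  have "bounded (f ` (carrier G \<times> carrier G))"
    using assms compact_carrier compact_continuous_image compact_imp_bounded compact_Times by blast
  then obtain B where "\<And>x. x \<in> carrier G \<times> carrier G \<Longrightarrow> norm (f x) \<le> B"
    unfolding bounded_iff by blast
  then show ?thesis
    by (intro integrable_const_bound[of _ B] pair_cts_measurable assms AE_I2)
       (auto simp: space_pair_measure borel_finiteD(3)[OF assms(1)] borel_finiteD(3)[OF assms(2)])
qed

lemma Fubini_cts:
  fixes f :: "'a \<Rightarrow> 'a \<Rightarrow> 'c::{banach, second_countable_topology}"
  assumes "borel_finite M" "borel_finite N" "cts2 (\<lambda>z. f (fst z) (snd z))"
  shows "(\<integral>x. (\<integral>y. f x y \<partial>N) \<partial>M) = (\<integral>y. (\<integral>x. f x y \<partial>M) \<partial>N)"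
proof -
  interpret M: finite_measure M using borel_finiteD[OF assms(1)] by blast
  interpret N: finite_measure N using borel_finiteD[OF assms(2)] by blast
  interpret pair_sigma_finite M N by unfold_locales
  have "integrable (M \<Otimes>\<^sub>M N) (\<lambda>(x, y). f x y)"
    using pair_cts_integrable[OF assms] by (simp add: case_prod_unfold)
  then show ?thesis by (rule Fubini_integral[symmetric])
qed

lemma norm_integral_bound:
  fixes f :: "'a \<Rightarrow> 'c::{banach, second_countable_topology}"
  assumes "borel_finite M" "\<And>x. x \<in> carrier G \<Longrightarrow> norm (f x) \<le> B" "B \<ge> 0"
  shows "norm (\<integral>x. f x \<partial>M) \<le> B * measure M (space M)"
proof (cases "integrable M f")
  case True
  interpret finite_measure M using borel_finiteD[OF assms(1)] by blast
  have "norm (\<integral>x. f x \<partial>M) \<le> (\<integral>x. norm (f x) \<partial>M)" by (rule integral_norm_bound)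
  also have "\<dots> \<le> (\<integral>x. B \<partial>M)"
    using True assms(2) borel_finiteD(3)[OF assms(1)] by (intro integral_mono) auto
  finally show ?thesis by (simp add: mult.commute)
qed (use assms in \<open>simp add: not_integrable_integral_eq\<close>)

text \<open>Compactness of the carrier makes \<open>f x' t\<close> close to \<open>f x t\<close>
  uniformly in \<open>t\<close> once \<open>x'\<close> is near \<open>x\<close>; the finite mass of
  \<open>M\<close> turns this into closeness of the integrals.\<close>

lemma cts_parametric_integral:
  fixes f :: "'a \<Rightarrow> 'a \<Rightarrow> 'c::{banach, second_countable_topology}"
  assumes M: "borel_finite M" and f: "cts2 (\<lambda>z. f (fst z) (snd z))"
  shows "cts (\<lambda>x. \<integral>y. f x y \<partial>M)"
  unfolding continuous_on_topological
proof (intro ballI allI impI)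
  interpret finite_measure M using borel_finiteD[OF M] by blast
  fix x B assume x: "x \<in> carrier G" and B: "open B" "(\<integral>y. f x y \<partial>M) \<in> B"
  obtain e where e: "e > 0" "\<And>w. dist w (\<integral>y. f x y \<partial>M) < e \<Longrightarrow> w \<in> B"
    using B unfolding open_dist by blast
  define m where "m = measure M (space M)"
  have m: "m \<ge> 0" by (simp add: m_def)
  \<comment> \<open>Adding \<open>1\<close> covers measures of mass zero and makes
    \<open>d * m\<close> strictly smaller than \<open>e\<close>.\<close>
  define d where "d = e / (m + 1)"
  have d: "d > 0" using e(1) m by (simp add: d_def)
  obtain X where X: "x \<in> X" "open X"
      "\<And>x' t. x' \<in> X \<inter> carrier G \<Longrightarrow> t \<in> carrier G \<Longrightarrow> dist (f x' t) (f x t) \<le> d"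
    using continuous_on_prod_compactE[OF f compact_carrier x d] by (metis fst_conv snd_conv)
  have int: "integrable M (f y)" if "y \<in> carrier G" for y
    using continuous_on_compose2[OF f continuous_on_Pair[OF continuous_on_const[of _ y] continuous_on_id]] that
    by (intro cts_integrable M) fastforce
  have "(\<integral>y. f x' y \<partial>M) \<in> B" if x': "x' \<in> carrier G" "x' \<in> X" for x'
  proof (rule e(2))
    have "dist (\<integral>y. f x' y \<partial>M) (\<integral>y. f x y \<partial>M) = norm (\<integral>y. f x' y - f x y \<partial>M)"
      using int x x' by (simp add: dist_norm)
    also have "\<dots> \<le> d * m"
      unfolding m_def using X(3) x' d by (intro norm_integral_bound[OF M]) (auto simp: dist_norm)
    also have "\<dots> < e"
      using e(1) m by (simp add: d_def field_simps)
    finally show "dist (\<integral>y. f x' y \<partial>M) (\<integral>y. f x y \<partial>M) < e" .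
  qed
  then show "\<exists>A. open A \<and> x \<in> A \<and> (\<forall>y\<in>carrier G. y \<in> A \<longrightarrow> (\<integral>ya. f y ya \<partial>M) \<in> B)"
    using X by blast
qed

section \<open>Invariance and strict positivity of the Haar integral\<close>

lemma integral_measure_preserving:
  fixes f :: "'a \<Rightarrow> 'c::{banach, second_countable_topology}"
  assumes f: "cts f" and T: "cts T"
    and S: "\<And>y. y \<in> carrier G \<Longrightarrow> S y \<in> carrier G \<and> T (S y) = y"
    and T': "\<And>y. y \<in> carrier G \<Longrightarrow> T y \<in> carrier G \<and> S (T y) = y"
    and inv: "\<And>B. B \<in> sets \<mu> \<Longrightarrow> emeasure \<mu> (S ` B) = emeasure \<mu> B"
  shows "(\<integral>y. f (T y) \<partial>\<mu>) = (\<integral>y. f y \<partial>\<mu>)"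
proof -
  have m: "T \<in> \<mu> \<rightarrow>\<^sub>M \<mu>"
    unfolding measurable_cong_sets[OF refl sets_\<mu>]
    using cts_measurable[OF borel_\<mu> T] T'
    by (intro measurable_restrict_space2) (auto simp: space_\<mu>)
  have "distr \<mu> \<mu> T = \<mu>"
  proof (rule measure_eqI)
    fix B assume "B \<in> sets (distr \<mu> \<mu> T)"
    then have B: "B \<in> sets \<mu>" by simp
    \<comment> \<open>\<open>bi_invariant_haar\<close> speaks of images of measurable sets,
      \<open>distr\<close> of preimages; the inverse map \<open>S\<close> converts one into the
      other.\<close>
    have "T -` B \<inter> space \<mu> = S ` B"
    proof (intro equalityI subsetI)
      fix y assume y: "y \<in> T -` B \<inter> space \<mu>"
      then have "y = S (T y)" using T' by (simp add: space_\<mu>)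
      then show "y \<in> S ` B" using y by blast
    qed (use S sets.sets_into_space[OF B] in \<open>auto simp: space_\<mu> subset_iff\<close>)
    then show "emeasure (distr \<mu> \<mu> T) B = emeasure \<mu> B"
      using inv[OF B] B m by (simp add: emeasure_distr)
  qed simp
  then have "(\<integral>y. f y \<partial>\<mu>) = (\<integral>y. f y \<partial>distr \<mu> \<mu> T)" by simp
  also have "\<dots> = (\<integral>y. f (T y) \<partial>\<mu>)"
    by (rule integral_distr[OF m cts_measurable[OF borel_\<mu> f]])
  finally show ?thesis by simp
qed

lemma integral_right_translate:
  fixes f :: "'a \<Rightarrow> 'c::{banach, second_countable_topology}"
  assumes a: "a \<in> carrier G" and f: "cts f"
  shows "(\<integral>y. f (y \<otimes> a) \<partial>\<mu>) = (\<integral>y. f y \<partial>\<mu>)"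
proof (rule integral_measure_preserving[OF f, where S = "\<lambda>y. y \<otimes> inv a"])
  show "cts (\<lambda>y. y \<otimes> a)"
    using a by (intro cts_intros continuous_intros) auto
qed (use a haar in \<open>auto simp: m_assoc bi_invariant_haar_def\<close>)

lemma integral_left_translate:
  fixes f :: "'a \<Rightarrow> 'c::{banach, second_countable_topology}"
  assumes a: "a \<in> carrier G" and f: "cts f"
  shows "(\<integral>y. f (a \<otimes> y) \<partial>\<mu>) = (\<integral>y. f y \<partial>\<mu>)"
proof (rule integral_measure_preserving[OF f, where S = "\<lambda>y. inv a \<otimes> y"])
  show "cts (\<lambda>y. a \<otimes> y)"
    using a by (intro cts_intros continuous_intros) auto
qed (use a haar in \<open>auto simp: m_assoc[symmetric] bi_invariant_haar_def\<close>)

text \<open>Finitely many translates of \<open>U\<close> cover the compact carrier and all have the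
  measure of \<open>U\<close>, so a null set \<open>U\<close> would make the whole group
  null.\<close>

lemma emeasure_open_pos:
  assumes U: "openin (group_top G) U" "U \<noteq> {}"
  shows "emeasure \<mu> U \<noteq> 0"
proof
  assume 0: "emeasure \<mu> U = 0"
  obtain u where u: "u \<in> U" using U by blast
  have UG: "U \<subseteq> carrier G" using openin_imp_subset[OF U(1)] .
  have Um: "U \<in> sets \<mu>" by (rule openin_in_sets[OF borel_\<mu> U(1)])
  define T where "T x = (\<lambda>y. x \<otimes> y) ` U" for x
  have eT: "T x \<in> sets \<mu>" "emeasure \<mu> (T x) = 0" "openin (group_top G) (T x)" if x: "x \<in> carrier G" for x
  proof -
    have "cts (\<lambda>y. inv x \<otimes> y)"
      using x by (intro cts_intros continuous_intros) auto
    then have "openin (group_top G) (carrier G \<inter> (\<lambda>y. inv x \<otimes> y) -` U)"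
      by (rule continuous_openin_preimage[OF _ _ U(1)]) (use x in auto)
    also have "carrier G \<inter> (\<lambda>y. inv x \<otimes> y) -` U = T x"
    proof (intro equalityI subsetI)
      fix y assume y: "y \<in> carrier G \<inter> (\<lambda>y. inv x \<otimes> y) -` U"
      then have "y = x \<otimes> (inv x \<otimes> y)" using x by (simp add: m_assoc[symmetric])
      then show "y \<in> T x" using y by (auto simp: T_def)
    qed (use x UG in \<open>auto simp: T_def m_assoc[symmetric] subset_iff\<close>)
    finally show op: "openin (group_top G) (T x)" .
    show "T x \<in> sets \<mu>" by (rule openin_in_sets[OF borel_\<mu> op])
    show "emeasure \<mu> (T x) = 0" using haar x Um 0 by (simp add: bi_invariant_haar_def T_def)
  qed
  have cov: "carrier G \<subseteq> (\<Union>x\<in>carrier G. T x)"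
  proof
    fix y assume y: "y \<in> carrier G"
    then have "y = (y \<otimes> inv u) \<otimes> u" "y \<otimes> inv u \<in> carrier G" using u UG by (auto simp: m_assoc)
    then show "y \<in> (\<Union>x\<in>carrier G. T x)" using u unfolding T_def by blast
  qed
  have "compactin (group_top G) (carrier G)"
    using compact_carrier by (simp add: compactin_subtopology)
  then obtain F where F: "finite F" "F \<subseteq> T ` carrier G" "carrier G \<subseteq> \<Union>F"
    using cov eT(3) unfolding compactin_def by (metis (no_types, lifting) image_iff)
  have "emeasure \<mu> (carrier G) \<le> emeasure \<mu> (\<Union>F)"
    using F eT(1) by (intro emeasure_mono sets.finite_Union) auto
  also have "\<dots> \<le> (\<Sum>B\<in>F. emeasure \<mu> B)"
    using emeasure_subadditive_finite[of F "\<lambda>B. B" \<mu>] F eT(1) by auto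
  also have "\<dots> = 0"
    using F eT(2) by (intro sum.neutral) auto
  finally show False
    using haar by (auto simp: bi_invariant_haar_def)
qed

text \<open>A positive value at \<open>x\<close> persists on a nonempty open set, which has positive
  measure.\<close>

lemma cts_integral_eq_0D:
  fixes f :: "'a \<Rightarrow> real"
  assumes f: "cts f" and nn: "\<And>x. x \<in> carrier G \<Longrightarrow> f x \<ge> 0"
    and 0: "(\<integral>x. f x \<partial>\<mu>) = 0" and x: "x \<in> carrier G"
  shows "f x = 0"
proof (rule ccontr)
  assume fx: "f x \<noteq> 0"
  define U where "U = carrier G \<inter> f -` {0<..}"
  have op: "openin (group_top G) U"
    unfolding U_def using f by (intro continuous_openin_preimage_gen) auto
  have "x \<in> U" using fx nn[OF x] x by (simp add: U_def)
  then have "emeasure \<mu> U \<noteq> 0" using emeasure_open_pos[OF op] by blast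
  moreover have "AE x in \<mu>. 0 \<le> f x"
    using nn by (intro AE_I2) (simp add: space_\<mu>)
  then have "AE x in \<mu>. f x = 0"
    using integral_nonneg_eq_0_iff_AE[OF cts_integrable[OF borel_\<mu> f]] 0 by simp
  then have "emeasure \<mu> {x \<in> space \<mu>. f x \<noteq> 0} = 0"
    by (subst (asm) AE_iff_measurable[OF _ refl]) (use cts_measurable[OF borel_\<mu> f] in measurable)
  moreover have "{x \<in> space \<mu>. f x \<noteq> 0} = U"
    using nn by (force simp: U_def space_\<mu>)
  ultimately show False by simp
qed

end

section \<open>Convolution and power iteration\<close>

text \<open>\<open>a n\<close> will be the squared norm of an iterate of an operator. Log-convexity
  makes the ratios of successive terms increase, submultiplicativity bounds them, and
  \<open>L\<close> is their limit. A second use of submultiplicativity keeps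
  \<open>a n / L ^ n\<close> above \<open>L / V\<close>, which excludes the limit zero.\<close>

lemma log_convex_submultiplicative_asymptotics:
  fixes a :: "nat \<Rightarrow> real"
  assumes pos: "\<And>n. a n > 0" and V: "V > 0"
    and log_convex: "\<And>n. (a (Suc n))\<^sup>2 \<le> a n * a (Suc (Suc n))"
    and submult: "\<And>m n. a (Suc (m + n)) \<le> V * a m * a n"
  obtains L b where "L > 0" "b > 0" "(\<lambda>n. a n / L ^ n) \<longlonglongrightarrow> b"
proof -
  define r where "r n = a (Suc n) / a n" for n
  have a_Suc: "a (Suc n) = r n * a n" for n
    using pos[of n] by (simp add: r_def)
  have r_pos: "r n > 0" for n
    using pos by (simp add: r_def)
  have "incseq r"
  proof (rule incseq_SucI)
    fix n
    show "r n \<le> r (Suc n)"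
      unfolding r_def using log_convex[of n] pos by (simp add: divide_simps power2_eq_square mult.commute)
  qed
  moreover have r_bound: "r n \<le> V * a 0" for n
    using submult[of 0 n] pos[of n] by (simp add: r_def divide_simps)
  ultimately obtain L where L: "r \<longlonglongrightarrow> L" "\<And>n. r n \<le> L"
    using incseq_convergent[of r "V * a 0"] by blast
  have Lpos: "L > 0" using r_pos[of 0] L(2)[of 0] by linarith
  have a_ge: "a n * r n ^ m \<le> a (m + n)" for m n
  proof (induction m)
    case (Suc m)
    have "a n * r n ^ Suc m = r n * (a n * r n ^ m)" by simp
    also have "\<dots> \<le> r (m + n) * a (m + n)"
      using Suc incseqD[OF \<open>incseq r\<close>, of n "m + n"] r_pos[of n] pos[of n] by (intro mult_mono) (auto intro: less_imp_le)
    finally show ?case by (simp add: a_Suc)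
  qed simp
  \<comment> \<open>Increasing ratios give \<open>a (Suc m + n) >= a n * r n ^ Suc m\<close>,
    submultiplicativity gives \<open>a (Suc m + n) <= V * a m * a n\<close>; the factor
    \<open>a n\<close> cancels and \<open>n\<close> tends to infinity.\<close>
  have "L ^ Suc m \<le> V * a m" for m
  proof (rule LIMSEQ_le_const2)
    show "(\<lambda>n. r n ^ Suc m) \<longlonglongrightarrow> L ^ Suc m" by (intro tendsto_intros L)
    have "r n ^ Suc m \<le> V * a m" for n
    proof -
      have "a n * r n ^ Suc m \<le> a n * (V * a m)"
        using a_ge[of n "Suc m"] submult[of m n] by (simp add: algebra_simps)
      then show ?thesis using pos[of n] by (simp only: mult_le_cancel_left_pos)
    qed
    then show "\<exists>N. \<forall>n\<ge>N. r n ^ Suc m \<le> V * a m" by blast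
  qed
  then have lower: "L / V \<le> a m / L ^ m" for m
    using Lpos V by (simp add: divide_simps mult.commute)
  have "decseq (\<lambda>n. a n / L ^ n)"
  proof (rule decseq_SucI)
    fix n
    have "a (Suc n) \<le> L * a n" unfolding a_Suc using L(2)[of n] pos[of n] by simp
    then show "a (Suc n) / L ^ Suc n \<le> a n / L ^ n"
      using Lpos by (simp add: divide_simps mult.commute)
  qed
  then obtain b where b: "(\<lambda>n. a n / L ^ n) \<longlonglongrightarrow> b"
    using decseq_convergent[of "\<lambda>n. a n / L ^ n" "L / V"] lower by blast
  have "L / V \<le> b"
    using LIMSEQ_le_const[OF b] lower by blast
  then have "b > 0" using Lpos V by (smt (verit) divide_pos_pos)
  then show thesis using that Lpos b by blast
qed

context haar_group
begin

lemmas integral_sum' = Bochner_Integration.integral_sum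
  and integral_cong' = Bochner_Integration.integral_cong
  and integral_diff' = Bochner_Integration.integral_diff
  and integral_add' = Bochner_Integration.integral_add
  and integral_cnj' = Bochner_Integration.integral_cnj

section \<open>Square norms, convolution operators and their adjoints\<close>

definition sqnorm :: "('a \<Rightarrow> complex) \<Rightarrow> real" where
  "sqnorm u = (\<integral>x. (cmod (u x))\<^sup>2 \<partial>\<mu>)"

text \<open>\<open>conv u\<close> is the integral operator with kernel
  \<open>u (x \<otimes> inv y)\<close>, the form that commutes with right translations.\<close>

definition conv :: "('a \<Rightarrow> complex) \<Rightarrow> ('a \<Rightarrow> complex) \<Rightarrow> 'a \<Rightarrow> complex" where
  "conv u v x = (\<integral>y. u (x \<otimes> inv y) * v y \<partial>\<mu>)"

text \<open>This is the convolution kernel of the adjoint operator: exchanging \<open>x\<close> and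
  \<open>y\<close> in \<open>x \<otimes> inv y\<close> inverts the argument of
  \<open>u\<close>.\<close>

definition adj :: "('a \<Rightarrow> complex) \<Rightarrow> 'a \<Rightarrow> complex" where
  "adj u x = cnj (u (inv x))"

definition hermitian :: "('a \<Rightarrow> complex) \<Rightarrow> bool" where
  "hermitian u \<longleftrightarrow> (\<forall>x\<in>carrier G. adj u x = u x)"

lemma integral_cong_carrier:
  "(\<And>x. x \<in> carrier G \<Longrightarrow> f x = h x) \<Longrightarrow> (\<integral>x. f x \<partial>\<mu>) = (\<integral>x. h x \<partial>\<mu>)"
  by (rule integral_cong') (auto simp: space_\<mu>)

lemma integrable_cts:
  fixes f :: "'a \<Rightarrow> 'c::{banach, second_countable_topology}"
  shows "cts f \<Longrightarrow> integrable \<mu> f"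
  by (rule cts_integrable[OF borel_\<mu>])

lemma sqnorm_nonneg: "sqnorm u \<ge> 0"
  by (simp add: sqnorm_def)

lemma sqnorm_eq_0D:
  assumes "cts u" "sqnorm u = 0" "x \<in> carrier G" shows "u x = 0"
  using cts_integral_eq_0D[of "\<lambda>x. (cmod (u x))\<^sup>2" x] assms
    continuous_on_power[OF continuous_on_norm[OF assms(1)], of 2]
  by (simp add: sqnorm_def)

lemma of_real_sqnorm: "of_real (sqnorm u) = (\<integral>x. u x * cnj (u x) \<partial>\<mu>)"
  by (simp only: sqnorm_def integral_complex_of_real[symmetric] complex_norm_square)

lemma Cauchy_Schwarz_real:
  fixes f h :: "'a \<Rightarrow> real"
  assumes f: "cts f" and h: "cts h"
  shows "(\<integral>x. f x * h x \<partial>\<mu>)\<^sup>2 \<le> (\<integral>x. (f x)\<^sup>2 \<partial>\<mu>) * (\<integral>x. (h x)\<^sup>2 \<partial>\<mu>)"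
proof (cases "(\<integral>x. (h x)\<^sup>2 \<partial>\<mu>) = 0")
  case True
  have "(h x)\<^sup>2 = 0" if "x \<in> carrier G" for x
    by (rule cts_integral_eq_0D[OF _ _ True that]) (auto intro!: continuous_intros h)
  then have "(\<integral>x. f x * h x \<partial>\<mu>) = (\<integral>x. 0 \<partial>\<mu>)"
    by (intro integral_cong_carrier) auto
  then show ?thesis by (simp add: True)
next
  case False
  define A B P where "A = (\<integral>x. (f x)\<^sup>2 \<partial>\<mu>)" and "B = (\<integral>x. (h x)\<^sup>2 \<partial>\<mu>)" and "P = (\<integral>x. f x * h x \<partial>\<mu>)"
  have B: "B > 0" using False by (simp add: B_def order_less_le)
  have ints: "integrable \<mu> (\<lambda>x. (f x)\<^sup>2)" "integrable \<mu> (\<lambda>x. (h x)\<^sup>2)" "integrable \<mu> (\<lambda>x. f x * h x)"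
    by (intro integrable_cts continuous_intros f h)+
  \<comment> \<open>\<open>P / B\<close> is the coefficient of the orthogonal projection of
    \<open>f\<close> onto \<open>h\<close>.\<close>
  have "0 \<le> (\<integral>x. (f x - P / B * h x)\<^sup>2 \<partial>\<mu>)" by simp
  also have "\<dots> = (\<integral>x. (f x)\<^sup>2 - 2 * (P / B) * (f x * h x) + (P / B)\<^sup>2 * (h x)\<^sup>2 \<partial>\<mu>)"
    by (intro integral_cong') (auto simp: power2_eq_square algebra_simps)
  also have "\<dots> = A - 2 * (P / B) * P + (P / B)\<^sup>2 * B"
    using ints by (simp add: A_def B_def P_def)
  also have "\<dots> = A - P\<^sup>2 / B"
    using B by (simp add: field_simps power2_eq_square)
  finally show ?thesis
    using B by (simp add: A_def[symmetric] B_def[symmetric] P_def[symmetric] field_simps)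
qed

lemma Cauchy_Schwarz_cts:
  assumes "cts u" "cts v"
  shows "(cmod (\<integral>x. u x * v x \<partial>\<mu>))\<^sup>2 \<le> sqnorm u * sqnorm v"
proof -
  have "cmod (\<integral>x. u x * v x \<partial>\<mu>) \<le> (\<integral>x. cmod (u x) * cmod (v x) \<partial>\<mu>)"
    using integral_norm_bound[of \<mu> "\<lambda>x. u x * v x"] by (simp add: norm_mult)
  then have "(cmod (\<integral>x. u x * v x \<partial>\<mu>))\<^sup>2 \<le> (\<integral>x. cmod (u x) * cmod (v x) \<partial>\<mu>)\<^sup>2"
    by (intro power_mono) auto
  also have "\<dots> \<le> sqnorm u * sqnorm v"
    unfolding sqnorm_def by (intro Cauchy_Schwarz_real continuous_intros assms)
  finally show ?thesis .
qed

lemma cts_quotient: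
  assumes "cts u" shows "cts2 (\<lambda>z. u (fst z \<otimes> inv (snd z)))"
  by (rule cts_compose[OF assms])
     (auto intro!: cts_mult cts_inv continuous_intros)

lemma cts_translate:
  assumes "cts u" "x \<in> carrier G"
  shows "cts (\<lambda>y. u (x \<otimes> inv y))" "cts (\<lambda>y. u (y \<otimes> x))" "cts (\<lambda>y. u (x \<otimes> y))"
  by (rule cts_compose[OF assms(1)];
      use assms(2) in \<open>auto intro!: cts_mult cts_inv continuous_intros\<close>)+

lemma cts_inverse_arg: "cts u \<Longrightarrow> cts (\<lambda>y. u (inv y))"
  by (rule cts_compose) (auto intro!: cts_inv continuous_intros)

lemma cts_adj: "cts u \<Longrightarrow> cts (adj u)"
  unfolding adj_def by (intro continuous_on_cnj cts_inverse_arg)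

lemma adj_adj: "x \<in> carrier G \<Longrightarrow> adj (adj u) x = u x"
  by (simp add: adj_def)

lemma cts_conv: "cts u \<Longrightarrow> cts v \<Longrightarrow> cts (conv u v)"
  unfolding conv_def
  by (intro cts_parametric_integral borel_\<mu> continuous_intros cts_quotient cts_snd)

lemma conv_cong:
  assumes "\<And>y. y \<in> carrier G \<Longrightarrow> u y = u' y" "\<And>y. y \<in> carrier G \<Longrightarrow> v y = v' y" "x \<in> carrier G"
  shows "conv u v x = conv u' v' x"
  unfolding conv_def using assms by (intro integral_cong_carrier) auto

lemma conv_assoc:
  assumes u: "cts u" and v: "cts v" and w: "cts w" and x: "x \<in> carrier G"
  shows "conv (conv u v) w x = conv u (conv v w) x"
proof -
  have c1: "cts2 (\<lambda>z. u (x \<otimes> inv (snd z)) * (v (snd z \<otimes> inv (fst z)) * w (fst z)))"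
    by (intro continuous_intros cts_fst cts_snd w
          cts_translate(1)[OF u x] cts_compose[OF v] cts_mult cts_inv) auto
  have "conv (conv u v) w x = (\<integral>y. (\<integral>z. u (x \<otimes> inv z) * (v (z \<otimes> inv y) * w y) \<partial>\<mu>) \<partial>\<mu>)"
    unfolding conv_def
  proof (rule integral_cong_carrier)
    fix y assume y: "y \<in> carrier G"
    \<comment> \<open>The shift of \<open>z\<close> to \<open>z \<otimes> y\<close> moves the
      dependence on \<open>y\<close> from the factor \<open>u\<close> to the factor
      \<open>v\<close>; after that the two integrations can be exchanged.\<close>
    have "cts (\<lambda>z. u (x \<otimes> inv z) * v (z \<otimes> inv y))"
      using x y by (intro continuous_intros cts_translate u v) auto
    then have "(\<integral>z. u (x \<otimes> inv (z \<otimes> y)) * v (z \<otimes> y \<otimes> inv y) \<partial>\<mu>) = (\<integral>z. u (x \<otimes> inv z) * v (z \<otimes> inv y) \<partial>\<mu>)"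
      using integral_right_translate[OF y, of "\<lambda>z. u (x \<otimes> inv z) * v (z \<otimes> inv y)"] by simp
    moreover have "(\<integral>z. u (x \<otimes> inv y \<otimes> inv z) * v z \<partial>\<mu>) = (\<integral>z. u (x \<otimes> inv (z \<otimes> y)) * v (z \<otimes> y \<otimes> inv y) \<partial>\<mu>)"
      by (intro integral_cong_carrier) (use x y in \<open>simp add: inv_mult_group m_assoc\<close>)
    ultimately show "(\<integral>z. u (x \<otimes> inv y \<otimes> inv z) * v z \<partial>\<mu>) * w y = (\<integral>z. u (x \<otimes> inv z) * (v (z \<otimes> inv y) * w y) \<partial>\<mu>)"
      by (simp flip: mult.assoc)
  qed
  also have "\<dots> = (\<integral>z. (\<integral>y. u (x \<otimes> inv z) * (v (z \<otimes> inv y) * w y) \<partial>\<mu>) \<partial>\<mu>)"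
    by (rule Fubini_cts[OF borel_\<mu> borel_\<mu>]) (use c1 in simp)
  also have "\<dots> = conv u (conv v w) x"
    by (simp add: conv_def)
  finally show ?thesis .
qed

lemma adj_conv:
  assumes u: "cts u" and v: "cts v" and x: "x \<in> carrier G"
  shows "adj (conv u v) x = conv (adj v) (adj u) x"
proof -
  have c: "cts (\<lambda>y. cnj (v (y \<otimes> inv x)) * cnj (u (inv y)))"
    using x by (intro continuous_intros continuous_on_cnj cts_translate cts_inverse_arg u v) auto
  have "adj (conv u v) x = (\<integral>y. cnj (u (inv x \<otimes> inv y)) * cnj (v y) \<partial>\<mu>)"
    unfolding adj_def conv_def by (simp only: integral_cnj'[symmetric] complex_cnj_mult)
  also have "\<dots> = (\<integral>y. cnj (v (y \<otimes> x \<otimes> inv x)) * cnj (u (inv (y \<otimes> x))) \<partial>\<mu>)"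
    by (intro integral_cong_carrier) (use x in \<open>simp add: inv_mult_group m_assoc\<close>)
  also have "\<dots> = (\<integral>y. cnj (v (y \<otimes> inv x)) * cnj (u (inv y)) \<partial>\<mu>)"
    by (rule integral_right_translate[OF x c])
  also have "\<dots> = conv (adj v) (adj u) x"
    unfolding conv_def adj_def by (intro integral_cong_carrier) (use x in \<open>simp add: inv_mult_group\<close>)
  finally show ?thesis .
qed

text \<open>Hermitian symmetry makes the values of \<open>u\<close> at
  \<open>x \<otimes> inv y\<close> and at \<open>y \<otimes> inv x\<close> equal in modulus, and the
  latter is a right translate of \<open>u\<close>.\<close>

lemma sqnorm_quotient:
  assumes "cts u" "hermitian u" and x: "x \<in> carrier G"
  shows "sqnorm (\<lambda>y. u (x \<otimes> inv y)) = sqnorm u"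
proof -
  have "sqnorm (\<lambda>y. u (x \<otimes> inv y)) = sqnorm (\<lambda>y. u (y \<otimes> inv x))"
    unfolding sqnorm_def
  proof (rule integral_cong_carrier)
    fix y assume y: "y \<in> carrier G"
    have "cnj (u (inv (y \<otimes> inv x))) = u (y \<otimes> inv x)"
      using assms(2) x y by (auto simp: hermitian_def adj_def)
    then have "u (y \<otimes> inv x) = cnj (u (x \<otimes> inv y))"
      using x y by (simp add: inv_mult_group)
    then show "(cmod (u (x \<otimes> inv y)))\<^sup>2 = (cmod (u (y \<otimes> inv x)))\<^sup>2" by simp
  qed
  also have "\<dots> = sqnorm u"
    unfolding sqnorm_def
    by (rule integral_right_translate[of "inv x" "\<lambda>y. (cmod (u y))\<^sup>2"]) (use x in \<open>auto intro!: continuous_intros assms\<close>)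
  finally show ?thesis .
qed

text \<open>Square norms control a convolution pointwise. One extra application of the operator thus
  turns convergence in the mean into uniform convergence.\<close>

lemma conv_bound:
  assumes "cts u" "cts v" "hermitian u" "x \<in> carrier G"
  shows "(cmod (conv u v x))\<^sup>2 \<le> sqnorm u * sqnorm v"
  unfolding conv_def
  using Cauchy_Schwarz_cts[OF cts_translate(1)[OF assms(1,4)] assms(2)] sqnorm_quotient[OF assms(1,3,4)]
  by simp

lemma sqnorm_le:
  assumes "cts u" "\<And>x. x \<in> carrier G \<Longrightarrow> (cmod (u x))\<^sup>2 \<le> B"
  shows "sqnorm u \<le> B * vol"
proof -
  interpret finite_measure \<mu> by (rule finite_\<mu>)
  have "sqnorm u \<le> (\<integral>x. B \<partial>\<mu>)"
    unfolding sqnorm_def using assms by (intro integral_mono integrable_cts continuous_intros) (auto simp: space_\<mu>)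
  then show ?thesis by (simp add: measure_space_\<mu> mult.commute)
qed


lemma tendsto_integral_uniform_limit:
  fixes u w :: "'a \<Rightarrow> complex"
  assumes lim: "uniform_limit (carrier G) f u F" and F: "F \<noteq> bot"
    and f: "\<And>n. cts (f n)" and w: "cts w"
  shows "((\<lambda>n. \<integral>x. f n x * w x \<partial>\<mu>) \<longlongrightarrow> (\<integral>x. u x * w x \<partial>\<mu>)) F"
proof (rule tendstoI)
  fix e :: real assume e: "e > 0"
  have u: "cts u" by (rule uniform_limit_theorem[OF _ lim F]) (simp add: f)
  obtain B where B: "B > 0" "\<And>x. x \<in> carrier G \<Longrightarrow> cmod (w x) \<le> B"
    using cts_bounded[OF w] by metis
  define d where "d = e / (2 * B * vol)"
  have d: "d > 0" using e B vol_pos by (simp add: d_def)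
  show "\<forall>\<^sub>F n in F. dist (\<integral>x. f n x * w x \<partial>\<mu>) (\<integral>x. u x * w x \<partial>\<mu>) < e"
    using uniform_limitD[OF lim d]
  proof eventually_elim
    case (elim n)
    have "(\<integral>x. f n x * w x \<partial>\<mu>) - (\<integral>x. u x * w x \<partial>\<mu>) = (\<integral>x. (f n x - u x) * w x \<partial>\<mu>)"
      unfolding left_diff_distrib
      by (intro integral_diff'[symmetric] integrable_cts continuous_intros f u w)
    also have "norm \<dots> \<le> (d * B) * measure \<mu> (space \<mu>)"
    proof (rule norm_integral_bound[OF borel_\<mu>])
      fix x assume x: "x \<in> carrier G"
      have "cmod (f n x - u x) \<le> d" using elim x by (auto simp: dist_norm intro: less_imp_le)
      then show "norm ((f n x - u x) * w x) \<le> d * B"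
        unfolding norm_mult using B(2)[OF x] d by (intro mult_mono) auto
    qed (use B d in simp)
    also have "\<dots> < e"
      using B(1) vol_pos e by (simp add: measure_space_\<mu> d_def)
    finally show ?case by (simp add: dist_norm)
  qed
qed

text \<open>Index \<open>n\<close> means \<open>n + 1\<close> factors, since convolution need not
  have a unit among the continuous functions; hence the \<open>Suc (m + n)\<close> in the rules
  below.\<close>

primrec conv_power :: "('a \<Rightarrow> complex) \<Rightarrow> nat \<Rightarrow> 'a \<Rightarrow> complex" where
  "conv_power k 0 = k"
| "conv_power k (Suc n) = conv k (conv_power k n)"

lemma cts_conv_power: "cts k \<Longrightarrow> cts (conv_power k n)"
  by (induction n) (auto intro: cts_conv)

lemma conv_power_add:
  assumes k: "cts k" and x: "x \<in> carrier G"
  shows "conv (conv_power k m) (conv_power k n) x = conv_power k (Suc (m + n)) x"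
  using x
proof (induction m arbitrary: x)
  case (Suc m)
  have "conv (conv_power k (Suc m)) (conv_power k n) x = conv k (conv (conv_power k m) (conv_power k n)) x"
    using conv_assoc[OF k cts_conv_power[OF k] cts_conv_power[OF k] Suc.prems] by simp
  also have "\<dots> = conv k (conv_power k (Suc (m + n))) x"
    using Suc by (intro conv_cong) auto
  finally show ?case by simp
qed simp

lemma hermitian_conv_power:
  assumes k: "cts k" "hermitian k"
  shows "hermitian (conv_power k n)"
proof (induction n)
  case (Suc n)
  have "adj (conv_power k (Suc n)) x = conv_power k (Suc n) x" if x: "x \<in> carrier G" for x
  proof -
    have "adj (conv_power k (Suc n)) x = conv (adj (conv_power k n)) (adj k) x"
      using adj_conv[OF k(1) cts_conv_power[OF k(1)] x] by simp
    also have "\<dots> = conv (conv_power k n) (conv_power k 0) x"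
      using Suc k(2) x by (intro conv_cong) (auto simp: hermitian_def)
    also have "\<dots> = conv_power k (Suc n) x"
      using conv_power_add[OF k(1) x, of n 0] by simp
    finally show ?thesis .
  qed
  then show ?case by (simp add: hermitian_def)
qed (use k in simp)

text \<open>Hermitian symmetry turns the conjugate into a value at \<open>inv y\<close>, so the
  inner product is a convolution at the identity. It depends on \<open>m + n\<close> alone, which
  produces both the log-convexity and the Cauchy estimate of the power iteration.\<close>

lemma integral_conv_power:
  assumes k: "cts k" "hermitian k"
  shows "(\<integral>x. conv_power k m x * cnj (conv_power k n x) \<partial>\<mu>) = conv_power k (Suc (m + n)) \<one>"
proof -
  have "conv_power k (Suc (n + m)) \<one> = conv (conv_power k n) (conv_power k m) \<one>"
    by (simp only: conv_power_add[OF k(1) one_closed])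
  also have "\<dots> = (\<integral>x. conv_power k m x * cnj (conv_power k n x) \<partial>\<mu>)"
    unfolding conv_def
  proof (rule integral_cong_carrier)
    fix y assume y: "y \<in> carrier G"
    have "cnj (conv_power k n (inv (inv y))) = conv_power k n (inv y)"
      using hermitian_conv_power[OF k, of n] inv_closed[OF y] unfolding hermitian_def adj_def by metis
    then show "conv_power k n (\<one> \<otimes> inv y) * conv_power k m y = conv_power k m y * cnj (conv_power k n y)"
      using y by simp
  qed
  finally show ?thesis by (simp add: add.commute)
qed

text \<open>
  Power iteration: the convolution powers of a hermitian kernel, normalised by the limit of the
  ratios of their square norms, converge to an eigenfunction of \<open>k * k\<close>.  The limit is nonzero
  because the square norms are submultiplicative up to the constant \<^term>\<open>vol\<close>.
\<close>

lemma eigenfunction_exists: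
  assumes k: "cts k" "hermitian k" and nz: "x0 \<in> carrier G" "k x0 \<noteq> 0"
  obtains L p where "L > 0" "cts p" "\<exists>x\<in>carrier G. p x \<noteq> 0"
    "\<And>x. x \<in> carrier G \<Longrightarrow> conv (conv k k) p x = of_real L * p x"
proof -
  define P where "P = conv_power k"
  have cP: "cts (P n)" for n unfolding P_def by (rule cts_conv_power[OF k(1)])
  have hP: "hermitian (P n)" for n unfolding P_def by (rule hermitian_conv_power[OF k])
  have P1: "P 1 = conv k k" by (simp add: P_def)
  define a where "a n = sqnorm (P n)" for n
  have ip: "(\<integral>x. P m x * cnj (P n x) \<partial>\<mu>) = P (Suc (m + n)) \<one>" for m n
    unfolding P_def by (rule integral_conv_power[OF k])
  have a_eq: "of_real (a n) = P (Suc (n + n)) \<one>" for n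
    unfolding a_def of_real_sqnorm ip ..
  have ip_even: "(\<integral>x. P m x * cnj (P n x) \<partial>\<mu>) = of_real (a l)" if "m + n = 2 * l" for m n l
    unfolding ip a_eq using that by (simp add: mult_2)
  \<comment> \<open>Cauchy-Schwarz for the iterates \<open>n\<close> and \<open>n + 2\<close>, whose
    inner product is the squared norm of the iterate \<open>n + 1\<close>.\<close>
  have log_convex: "(a (Suc n))\<^sup>2 \<le> a n * a (Suc (Suc n))" for n
  proof -
    have "sqnorm (\<lambda>x. cnj (P (Suc (Suc n)) x)) = a (Suc (Suc n))"
      by (simp add: sqnorm_def a_def)
    then show ?thesis
      using Cauchy_Schwarz_cts[OF cP[of n] continuous_on_cnj[OF cP[of "Suc (Suc n)"]]]
      by (simp add: ip_even[of n "Suc (Suc n)" "Suc n"] a_def)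
  qed
  \<comment> \<open>The iterate \<open>Suc (m + n)\<close> is the convolution of those at
    \<open>m\<close> and \<open>n\<close>; integrating its pointwise bound over the group gives the
    factor \<open>vol\<close>.\<close>
  have submult: "a (Suc (m + n)) \<le> vol * a m * a n" for m n
  proof -
    have "(cmod (P (Suc (m + n)) x))\<^sup>2 \<le> a m * a n" if "x \<in> carrier G" for x
      using conv_bound[OF cP cP hP that] conv_power_add[OF k(1) that] by (simp add: a_def P_def)
    then show ?thesis
      using sqnorm_le[OF cP, of "Suc (m + n)" "a m * a n"] by (simp add: a_def mult_ac)
  qed
  have pos_if: "a n > 0" if "x \<in> carrier G" "P n x \<noteq> 0" for n x
    using sqnorm_eq_0D[OF cP] that sqnorm_nonneg[of "P n"] by (force simp: a_def order_less_le)
  have a0: "a 0 > 0" using pos_if[of x0 0] nz by (simp add: P_def)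
  \<comment> \<open>\<open>P 1\<close> has the value \<open>a 0\<close> at the identity. Once
    \<open>a 0\<close> and \<open>a 1\<close> are positive, log-convexity rules out a later
    zero.\<close>
  have "P 1 \<one> \<noteq> 0" using a_eq[of 0] a0 by (metis One_nat_def add_0 of_real_eq_0_iff order_less_irrefl)
  then have a1: "a 1 > 0" using pos_if one_closed by blast
  have a_pos: "a n > 0" for n
  proof (cases n)
    case (Suc m)
    have "a (Suc m) > 0"
    proof (induction m)
      case (Suc m)
      have "0 < (a (Suc m))\<^sup>2" using Suc by simp
      also have "\<dots> \<le> a m * a (Suc (Suc m))" by (rule log_convex)
      finally show ?case using sqnorm_nonneg[of "P m"] by (simp add: a_def zero_less_mult_iff)
    qed (use a1 in simp)
    then show ?thesis using Suc by simp
  qed (use a0 in simp)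
  obtain L b where L: "L > 0" and b: "b > 0" and lim: "(\<lambda>n. a n / L ^ n) \<longlonglongrightarrow> b"
    using log_convex_submultiplicative_asymptotics[OF a_pos vol_pos log_convex submult] by blast
  define c where "c n = a n / L ^ n" for n
  \<comment> \<open>Only even indices occur: \<open>k * k\<close> raises the index by two, and
    \<open>L\<close>, a limit of ratios of squared norms, is scaled for the square of the operator.
    Squaring also removes the alternation of sign that negative eigenvalues of \<open>k\<close>
    could cause.\<close>
  define q where "q n x = P (2 * n) x / of_real (L ^ n)" for n x
  have cq: "cts (q n)" for n
    unfolding q_def using L by (intro continuous_intros cP) auto
  have sq: "sqnorm (q n) = c (2 * n)" for n
    using L by (simp add: sqnorm_def q_def c_def a_def norm_divide power_divide norm_power
        flip: power_mult mult.commute[of 2 n])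
  \<comment> \<open>As \<open>c\<close> tends to \<open>b\<close>, the right-hand side tends to
    zero, so the \<open>q n\<close> form a Cauchy sequence in the mean.\<close>
  have sq_diff: "sqnorm (\<lambda>x. q n x - q m x) = c (2 * n) - 2 * c (n + m) + c (2 * m)" for n m
  proof -
    have i: "integrable \<mu> (\<lambda>x. q i x * cnj (q j x))" for i j
      by (intro integrable_cts continuous_intros continuous_on_cnj cq)
    have v: "(\<integral>x. q i x * cnj (q j x) \<partial>\<mu>) = of_real (c (i + j))" for i j
    proof -
      have "(\<integral>x. q i x * cnj (q j x) \<partial>\<mu>) = (\<integral>x. (P (2 * i) x * cnj (P (2 * j) x)) / of_real (L ^ (i + j)) \<partial>\<mu>)"
        by (simp add: q_def power_add)
      also have "\<dots> = of_real (a (i + j)) / of_real (L ^ (i + j))"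
        by (simp add: ip_even[of "2 * i" "2 * j" "i + j"])
      finally show ?thesis by (simp add: c_def)
    qed
    have "of_real (sqnorm (\<lambda>x. q n x - q m x)) = (\<integral>x. q n x * cnj (q n x) - q n x * cnj (q m x) - q m x * cnj (q n x) + q m x * cnj (q m x) \<partial>\<mu>)"
      unfolding of_real_sqnorm by (intro integral_cong') (auto simp: algebra_simps)
    also have "\<dots> = of_real (c (n + n) - c (n + m) - c (m + n) + c (m + m))"
      using i by (simp add: v)
    finally have "sqnorm (\<lambda>x. q n x - q m x) = c (n + n) - c (n + m) - c (m + n) + c (m + m)"
      by (simp only: of_real_eq_iff)
    then show ?thesis unfolding mult_2 add.commute[of m n] by linarith
  qed
  have Lq: "conv (P 1) (q n) x = of_real L * q (Suc n) x" if x: "x \<in> carrier G" for n x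
  proof -
    have "conv (P 1) (q n) x = conv (P 1) (P (2 * n)) x / of_real (L ^ n)"
      by (simp add: conv_def q_def)
    also have "conv (P 1) (P (2 * n)) x = P (2 * Suc n) x"
      using conv_power_add[OF k(1) x, of 1 "2 * n"] by (simp add: P_def)
    finally show ?thesis using L by (simp add: q_def[of "Suc n"])
  qed
  \<comment> \<open>Convolution with \<open>P 1\<close> maps \<open>q n\<close> to \<open>L\<close>
    times its successor, so \<open>conv_bound\<close> upgrades the estimate in the mean to a uniform
    one.\<close>
  have bound: "L * cmod (q (Suc n) x - q (Suc m) x) \<le> sqrt (a 1 * (c (2 * n) - 2 * c (n + m) + c (2 * m)))"
    if x: "x \<in> carrier G" for n m x
  proof (rule real_le_rsqrt)
    have "conv (P 1) (\<lambda>y. q n y - q m y) x = conv (P 1) (q n) x - conv (P 1) (q m) x"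
      unfolding conv_def right_diff_distrib
      by (intro integral_diff' integrable_cts continuous_intros cts_translate cP cq x)
    then have "of_real L * (q (Suc n) x - q (Suc m) x) = conv (P 1) (\<lambda>y. q n y - q m y) x"
      by (simp add: Lq[OF x] right_diff_distrib del: One_nat_def)
    then have "L * cmod (q (Suc n) x - q (Suc m) x) = cmod (conv (P 1) (\<lambda>y. q n y - q m y) x)"
      using L by (metis abs_of_pos norm_mult norm_of_real)
    then show "(L * cmod (q (Suc n) x - q (Suc m) x))\<^sup>2 \<le> a 1 * (c (2 * n) - 2 * c (n + m) + c (2 * m))"
      using conv_bound[OF cP[of 1] continuous_on_diff[OF cq[of n] cq[of m]] hP x] by (simp add: sq_diff a_def)
  qed
  have clim: "c \<longlonglongrightarrow> b" using lim by (simp add: c_def[abs_def])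
  have "uniformly_Cauchy_on (carrier G) (\<lambda>n. q (Suc n))"
  proof (rule uniformly_Cauchy_onI)
    fix e :: real assume e: "e > 0"
    \<comment> \<open>The three values of \<open>c\<close> enter with weights 1, 2 and 1, so
      deviations below \<open>d\<close> add up to less than \<open>4 * d\<close>, and
      \<open>a 1 * (4 * d)\<close> equals \<open>(L * e)^2\<close>.\<close>
    define d where "d = (L * e)\<^sup>2 / (4 * a 1)"
    have d: "d > 0" using L e a1 by (simp add: d_def)
    obtain N where N: "\<And>n. n \<ge> N \<Longrightarrow> \<bar>c n - b\<bar> < d"
      using clim d unfolding LIMSEQ_def dist_real_def by meson
    have "dist (q (Suc m) x) (q (Suc n) x) < e" if "x \<in> carrier G" "m \<ge> N" "n \<ge> N" for m n x
    proof -
      have "c (2 * m) - 2 * c (m + n) + c (2 * n) < 4 * d"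
        using N[of "2 * m"] N[of "m + n"] N[of "2 * n"] that by linarith
      then have "a 1 * (c (2 * m) - 2 * c (m + n) + c (2 * n)) < a 1 * (4 * d)"
        using a1 by (intro mult_strict_left_mono)
      also have "\<dots> = (L * e)\<^sup>2" using a1 by (simp add: d_def)
      finally have "sqrt (a 1 * (c (2 * m) - 2 * c (m + n) + c (2 * n))) < L * e"
        using L e by (intro real_less_lsqrt) auto
      then have "L * cmod (q (Suc m) x - q (Suc n) x) < L * e"
        using bound[OF that(1), of m n] by linarith
      then show ?thesis using L by (simp add: dist_norm)
    qed
    then show "\<exists>M. \<forall>x\<in>carrier G. \<forall>m\<ge>M. \<forall>n\<ge>M. dist (q (Suc m) x) (q (Suc n) x) < e" by blast
  qed
  then obtain p where p: "uniform_limit (carrier G) (\<lambda>n. q (Suc n)) p sequentially"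
    using Cauchy_uniformly_convergent uniformly_convergent_on_def by blast
  have cp: "cts p"
    by (rule uniform_limit_theorem[OF _ p]) (auto intro!: always_eventually cq)
  have ptw: "(\<lambda>n. q (Suc n) x) \<longlonglongrightarrow> p x" if "x \<in> carrier G" for x
    using tendsto_uniform_limitI[OF p that] .
  show thesis
  proof (rule that[OF L cp])
    show "\<exists>x\<in>carrier G. p x \<noteq> 0"
    proof (rule ccontr)
      assume "\<not> (\<exists>x\<in>carrier G. p x \<noteq> 0)"
      then have p0: "p x = 0" if "x \<in> carrier G" for x using that by blast
      \<comment> \<open>If \<open>p\<close> vanished, the squared norms \<open>c (2 * Suc n)\<close>
        would eventually be at most \<open>e^2 * vol = b / 2\<close>, although they tend to
        \<open>b > 0\<close>.\<close>
      define e where "e = sqrt (b / (2 * vol))"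
      have e: "e > 0" "e\<^sup>2 * vol = b / 2" using b vol_pos by (auto simp: e_def)
      have "\<forall>\<^sub>F n in sequentially. c (2 * Suc n) \<le> b / 2"
        using uniform_limitD[OF p e(1)]
      proof eventually_elim
        case (elim n)
        have "(cmod (q (Suc n) x))\<^sup>2 \<le> e\<^sup>2" if "x \<in> carrier G" for x
          using elim that by (intro power_mono) (auto simp: p0 intro: less_imp_le)
        then show ?case using sqnorm_le[OF cq, of "Suc n" "e\<^sup>2"] e(2) by (simp add: sq)
      qed
      moreover have "(\<lambda>n. c (2 * Suc n)) \<longlonglongrightarrow> b"
        using LIMSEQ_subseq_LIMSEQ[OF clim, of "\<lambda>n. 2 * Suc n"] by (simp add: o_def strict_mono_def)
      ultimately have "b \<le> b / 2"
        by (intro tendsto_upperbound[of _ b sequentially]) auto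
      then show False using b by simp
    qed
    fix x assume x: "x \<in> carrier G"
    have "(\<lambda>n. conv (P 1) (q (Suc n)) x) \<longlonglongrightarrow> of_real L * p x"
      unfolding Lq[OF x] using ptw[OF x] by (intro tendsto_intros LIMSEQ_Suc[of "\<lambda>n. q (Suc n) x"])
    moreover have "(\<lambda>n. conv (P 1) (q (Suc n)) x) \<longlonglongrightarrow> conv (P 1) p x"
      using tendsto_integral_uniform_limit[OF p _ cq cts_translate(1)[OF cP x]]
      by (simp add: conv_def mult.commute)
    ultimately show "conv (conv k k) p x = of_real L * p x"
      using LIMSEQ_unique P1 by metis
  qed
qed

end

section \<open>The Peter-Weyl theorem\<close>

context haar_group
begin

definition inner_prod :: "('a \<Rightarrow> complex) \<Rightarrow> ('a \<Rightarrow> complex) \<Rightarrow> complex" where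
  "inner_prod u v = (\<integral>x. u x * cnj (v x) \<partial>\<mu>)"

definition orthonormal :: "(nat \<Rightarrow> 'a \<Rightarrow> complex) \<Rightarrow> nat \<Rightarrow> bool" where
  "orthonormal e d \<longleftrightarrow> (\<forall>i<d. cts (e i)) \<and>
     (\<forall>i<d. \<forall>j<d. inner_prod (e i) (e j) = (if i = j then 1 else 0))"

lemma inner_prod_self: "inner_prod u u = of_real (sqnorm u)"
  by (simp add: inner_prod_def of_real_sqnorm)

lemma inner_prod_commute: "inner_prod v u = cnj (inner_prod u v)"
  unfolding inner_prod_def integral_cnj'[symmetric] by (simp add: mult.commute)

lemma inner_prod_cong:
  "(\<And>x. x \<in> carrier G \<Longrightarrow> u x = u' x) \<Longrightarrow> (\<And>x. x \<in> carrier G \<Longrightarrow> v x = v' x) \<Longrightarrow> inner_prod u v = inner_prod u' v'"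
  unfolding inner_prod_def by (intro integral_cong_carrier) auto

lemma integrable_inner: "cts u \<Longrightarrow> cts v \<Longrightarrow> integrable \<mu> (\<lambda>x. u x * cnj (v x))"
  by (intro integrable_cts continuous_intros continuous_on_cnj)

lemma inner_prod_diff_left:
  assumes "cts u" "cts v" "cts w"
  shows "inner_prod (\<lambda>x. u x - v x) w = inner_prod u w - inner_prod v w"
  unfolding inner_prod_def left_diff_distrib
  by (intro integral_diff' integrable_inner assms)

lemma inner_prod_mult_left: "inner_prod (\<lambda>x. a * u x) w = a * inner_prod u w"
  unfolding inner_prod_def by (simp add: mult.assoc)

lemma inner_prod_sum_left:
  assumes "\<And>i. i < (d::nat) \<Longrightarrow> cts (e i)" "cts w"
  shows "inner_prod (\<lambda>x. \<Sum>i<d. c i * e i x) w = (\<Sum>i<d. c i * inner_prod (e i) w)"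
proof -
  have "inner_prod (\<lambda>x. \<Sum>i<d. c i * e i x) w = (\<integral>x. (\<Sum>i<d. c i * (e i x * cnj (w x))) \<partial>\<mu>)"
    by (simp add: inner_prod_def sum_distrib_right mult.assoc)
  also have "\<dots> = (\<Sum>i<d. (\<integral>x. c i * (e i x * cnj (w x)) \<partial>\<mu>))"
    using assms by (intro integral_sum' integrable_mult_right integrable_inner) auto
  finally show ?thesis by (simp add: inner_prod_def)
qed

lemma cts_combination:
  fixes e :: "nat \<Rightarrow> 'a \<Rightarrow> complex"
  shows "(\<And>i. i < (d::nat) \<Longrightarrow> cts (e i)) \<Longrightarrow> cts (\<lambda>x. \<Sum>i<d. c i * e i x)"
  by (intro continuous_intros) auto

lemma inner_prod_combination:
  assumes "orthonormal e d" "j < d"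
  shows "inner_prod (\<lambda>x. \<Sum>i<d. c i * e i x) (e j) = c j"
proof -
  have "inner_prod (\<lambda>x. \<Sum>i<d. c i * e i x) (e j) = (\<Sum>i<d. c i * inner_prod (e i) (e j))"
    using assms by (intro inner_prod_sum_left) (auto simp: orthonormal_def)
  also have "\<dots> = (\<Sum>i<d. if i = j then c i else 0)"
    using assms by (intro sum.cong) (auto simp: orthonormal_def)
  finally have "inner_prod (\<lambda>x. \<Sum>i<d. c i * e i x) (e j) = (\<Sum>i<d. if i = j then c i else 0)" .
  then show ?thesis using assms(2) by simp
qed

lemma orthonormal_residual:
  assumes e: "orthonormal e d" and u: "cts u"
  defines "r \<equiv> \<lambda>x. u x - (\<Sum>i<d. inner_prod u (e i) * e i x)"
  shows "cts r" "\<And>j. j < d \<Longrightarrow> inner_prod r (e j) = 0"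
    and "sqnorm r = sqnorm u - (\<Sum>i<d. (cmod (inner_prod u (e i)))\<^sup>2)"
proof -
  have ce: "cts (e i)" if "i < d" for i using e that by (auto simp: orthonormal_def)
  have cs: "cts (\<lambda>x. \<Sum>i<d. inner_prod u (e i) * e i x)" by (rule cts_combination) (rule ce)
  show cr: "cts r" unfolding r_def by (intro continuous_on_diff u cs)
  show 0: "inner_prod r (e j) = 0" if "j < d" for j
    unfolding r_def using inner_prod_diff_left[OF u cs ce[OF that]] inner_prod_combination[OF e that] by simp
  have "inner_prod r r = inner_prod u r - inner_prod (\<lambda>x. \<Sum>i<d. inner_prod u (e i) * e i x) r"
    using inner_prod_diff_left[OF u cs cr] by (simp add: r_def)
  also have "inner_prod (\<lambda>x. \<Sum>i<d. inner_prod u (e i) * e i x) r = (\<Sum>i<d. inner_prod u (e i) * cnj (inner_prod r (e i)))"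
    by (subst inner_prod_sum_left[OF ce cr]) (auto simp: inner_prod_commute[of _ r])
  also have "\<dots> = 0" using 0 by simp
  also have "inner_prod u r = cnj (inner_prod r u)" by (rule inner_prod_commute)
  also have "inner_prod r u = inner_prod u u - (\<Sum>i<d. inner_prod u (e i) * inner_prod (e i) u)"
    using inner_prod_diff_left[OF u cs u] inner_prod_sum_left[OF ce u] by (simp add: r_def)
  also have "\<dots> = of_real (sqnorm u - (\<Sum>i<d. (cmod (inner_prod u (e i)))\<^sup>2))"
    by (simp only: inner_prod_self inner_prod_commute[of _ u] complex_norm_square of_real_diff of_real_sum)
  finally show "sqnorm r = sqnorm u - (\<Sum>i<d. (cmod (inner_prod u (e i)))\<^sup>2)"
    by (simp only: inner_prod_self complex_cnj_complex_of_real diff_zero of_real_eq_iff)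
qed

lemma Bessel_inequality:
  assumes "orthonormal e d" "cts u"
  shows "(\<Sum>i<d. (cmod (inner_prod u (e i)))\<^sup>2) \<le> sqnorm u"
  using orthonormal_residual(3)[OF assms] sqnorm_nonneg[of "\<lambda>x. u x - (\<Sum>i<d. inner_prod u (e i) * e i x)"]
  by simp

section \<open>Invariant spaces of functions and irreducible representations\<close>

definition shift_invariant :: "('a \<Rightarrow> complex) set \<Rightarrow> bool" where
  "shift_invariant S \<longleftrightarrow> (\<forall>u\<in>S. cts u) \<and> (\<lambda>x. 0) \<in> S \<and>
     (\<forall>u\<in>S. \<forall>v\<in>S. (\<lambda>x. u x + v x) \<in> S) \<and> (\<forall>a. \<forall>u\<in>S. (\<lambda>x. a * u x) \<in> S) \<and>
     (\<forall>y\<in>carrier G. \<forall>u\<in>S. (\<lambda>x. u (x \<otimes> y)) \<in> S)"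

text \<open>The greatest such \<open>d\<close> serves as the dimension of \<open>S\<close>. Inner
  products see only the carrier, so functions that differ outside it are not counted
  separately.\<close>

definition has_orthonormal :: "('a \<Rightarrow> complex) set \<Rightarrow> nat \<Rightarrow> bool" where
  "has_orthonormal S d \<longleftrightarrow> (\<exists>e. orthonormal e d \<and> (\<forall>i<d. e i \<in> S))"

definition nonzero_space :: "('a \<Rightarrow> complex) set \<Rightarrow> bool" where
  "nonzero_space S \<longleftrightarrow> (\<exists>u\<in>S. \<exists>x\<in>carrier G. u x \<noteq> 0)"

lemma nonzero_spaceI: "u \<in> S \<Longrightarrow> x \<in> carrier G \<Longrightarrow> u x \<noteq> 0 \<Longrightarrow> nonzero_space S"
  by (auto simp: nonzero_space_def)

lemma invariant_combination:
  assumes "shift_invariant S" "\<And>i. i < (d::nat) \<Longrightarrow> e i \<in> S"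
  shows "(\<lambda>x. \<Sum>i<d. c i * e i x) \<in> S"
  using assms(2)
proof (induction d)
  case 0
  then show ?case using assms(1) by (simp add: shift_invariant_def)
next
  case (Suc d)
  then have "(\<lambda>x. \<Sum>i<d. c i * e i x) \<in> S" "(\<lambda>x. c d * e d x) \<in> S"
    using assms(1) by (auto simp: shift_invariant_def)
  then show ?case using assms(1) by (auto simp: shift_invariant_def)
qed

text \<open>Otherwise the residual of \<open>u\<close> is nonzero, and its normalisation would
  extend the family to \<open>Suc d\<close> members.\<close>

lemma maximal_orthonormal_spans:
  assumes S: "shift_invariant S" and e: "orthonormal e d" "\<And>i. i < d \<Longrightarrow> e i \<in> S"
    and max: "\<not> has_orthonormal S (Suc d)" and u: "u \<in> S" and x: "x \<in> carrier G"
  shows "u x = (\<Sum>i<d. inner_prod u (e i) * e i x)"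
proof (rule ccontr)
  assume neq: "u x \<noteq> (\<Sum>i<d. inner_prod u (e i) * e i x)"
  define r where "r = (\<lambda>x. u x - (\<Sum>i<d. inner_prod u (e i) * e i x))"
  have cu: "cts u" using S u by (auto simp: shift_invariant_def)
  note res = orthonormal_residual[OF e(1) cu, folded r_def]
  define s where "s = (\<lambda>x. \<Sum>i<d. inner_prod u (e i) * e i x)"
  have "s \<in> S" unfolding s_def by (rule invariant_combination[OF S e(2)])
  then have "(\<lambda>x. - 1 * s x) \<in> S" using S unfolding shift_invariant_def by blast
  then have "(\<lambda>x. u x + - 1 * s x) \<in> S" using S u unfolding shift_invariant_def by fast
  then have rS: "r \<in> S" by (simp add: r_def s_def)
  have "sqnorm r \<noteq> 0" using sqnorm_eq_0D[OF res(1) _ x] neq by (auto simp: r_def)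
  then have pos: "sqnorm r > 0" using sqnorm_nonneg[of r] by simp
  define a :: complex where "a = of_real (1 / sqrt (sqnorm r))"
  define w where "w = (\<lambda>x. a * r x)"
  have cw: "cts w" unfolding w_def by (intro continuous_intros res(1))
  have we: "inner_prod w (e j) = 0" "inner_prod (e j) w = 0" if "j < d" for j
    using res(2)[OF that] inner_prod_commute[of "e j" w] by (simp_all add: w_def inner_prod_mult_left)
  have ar: "inner_prod r w = cnj a * inner_prod r r"
    by (subst inner_prod_commute, unfold w_def inner_prod_mult_left)
       (simp add: inner_prod_self)
  have "inner_prod w w = a * (cnj a * inner_prod r r)"
    unfolding ar[symmetric] by (simp add: w_def inner_prod_mult_left)
  also have "\<dots> = of_real ((1 / sqrt (sqnorm r)) * ((1 / sqrt (sqnorm r)) * sqnorm r))"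
    by (simp only: a_def inner_prod_self complex_cnj_complex_of_real of_real_mult)
  also have "(1 / sqrt (sqnorm r)) * ((1 / sqrt (sqnorm r)) * sqnorm r) = 1"
    using pos by (simp add: field_simps)
  finally have ww: "inner_prod w w = 1" by simp
  have "orthonormal (e(d := w)) (Suc d)"
    using e(1) cw we ww by (auto simp: orthonormal_def less_Suc_eq)
  moreover have "w \<in> S" using S rS by (auto simp: shift_invariant_def w_def)
  ultimately have "has_orthonormal S (Suc d)"
    using e(2) unfolding has_orthonormal_def by (intro exI[of _ "e(d := w)"]) (auto simp: less_Suc_eq)
  then show False using max by simp
qed

text \<open>
  Among the nonzero invariant subspaces of \<open>E\<close>, one of least dimension carries an irreducible
  representation; \<open>\<rho> y\<close> is the matrix of the right translation by \<open>y\<close> in the basis \<open>e\<close>.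
\<close>

lemma irreducible_subrepresentation:
  assumes E: "shift_invariant E" "nonzero_space E"
    and bounded: "\<And>d. has_orthonormal E d \<Longrightarrow> d \<le> N"
  obtains d \<rho> e where "irreducible_rep G d \<rho>" "orthonormal e d" "\<And>i. i < d \<Longrightarrow> e i \<in> E"
    "\<And>j x y. \<lbrakk>j < d; x \<in> carrier G; y \<in> carrier G\<rbrakk> \<Longrightarrow> e j (x \<otimes> y) = (\<Sum>i<d. \<rho> y $$ (i, j) * e i x)"
proof -
  define dim where "dim S = (GREATEST d. has_orthonormal S d)" for S
  have sub_bound: "d \<le> N" if "S \<subseteq> E" "has_orthonormal S d" for S d
    using bounded that unfolding has_orthonormal_def by blast
  have h0: "has_orthonormal S 0" for S
    by (auto simp: has_orthonormal_def orthonormal_def)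
  have dim: "has_orthonormal S (dim S)" if "S \<subseteq> E" for S
    unfolding dim_def by (rule GreatestI_nat[where P = "has_orthonormal S" and k = 0 and b = N, OF h0]) (use sub_bound that in blast)
  have dim_max: "d \<le> dim S" if "S \<subseteq> E" "has_orthonormal S d" for S d
    unfolding dim_def by (rule Greatest_le_nat[where b = N]) (use sub_bound that in blast)+
  define Q where "Q S \<longleftrightarrow> S \<subseteq> E \<and> shift_invariant S \<and> nonzero_space S" for S
  have "Q E" using E by (simp add: Q_def)
  then obtain S where QS: "Q S" and min: "\<And>T. Q T \<Longrightarrow> dim S \<le> dim T"
    using ex_has_least_nat[of Q E dim] by blast
  have S: "S \<subseteq> E" "shift_invariant S" "nonzero_space S" using QS by (auto simp: Q_def)
  define d where "d = dim S"
  obtain e where e: "orthonormal e d" "\<And>i. i < d \<Longrightarrow> e i \<in> S"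
    using dim[OF S(1)] unfolding d_def has_orthonormal_def by blast
  have max: "\<not> has_orthonormal S (Suc d)"
    using dim_max[OF S(1), of "Suc d"] by (auto simp: d_def)
  note spans = maximal_orthonormal_spans[OF S(2) _ _ max]
  have ce: "cts (e i)" if "i < d" for i using e(1) that by (auto simp: orthonormal_def)
  define R where "R y j i = inner_prod (\<lambda>x. e j (x \<otimes> y)) (e i)" for y j i
  have tr: "e j (x \<otimes> y) = (\<Sum>i<d. R y j i * e i x)" if "j < d" "x \<in> carrier G" "y \<in> carrier G" for j x y
  proof -
    have "(\<lambda>x. e j (x \<otimes> y)) \<in> S" using S(2) e(2) that by (auto simp: shift_invariant_def)
    then show ?thesis using spans[OF e] that(2) by (simp add: R_def)
  qed
  \<comment> \<open>Columns hold the coefficients of the translated basis functions. Translation by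
    \<open>x \<otimes> y\<close> is translation by \<open>y\<close> followed by translation by
    \<open>x\<close>, which makes \<open>\<rho>\<close> multiplicative in this order.\<close>
  define \<rho> where "\<rho> y = Matrix.mat d d (\<lambda>(i, j). R y j i)" for y
  have \<rho>: "\<rho> y $$ (i, j) = R y j i" if "i < d" "j < d" for y i j using that by (simp add: \<rho>_def)
  have \<rho>c: "\<rho> y \<in> carrier_mat d d" for y by (simp add: \<rho>_def)
  have rep: "matrix_rep G d \<rho>"
    unfolding matrix_rep_def
  proof (intro conjI ballI allI impI)
    show "\<rho> \<one> = 1\<^sub>m d"
    proof (rule eq_matI)
      fix i j assume ij: "i < dim_row (1\<^sub>m d)" "j < dim_col (1\<^sub>m d)"
      have "R \<one> j i = inner_prod (e j) (e i)" unfolding R_def by (rule inner_prod_cong) auto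
      then show "\<rho> \<one> $$ (i, j) = 1\<^sub>m d $$ (i, j)"
        using ij e(1) by (auto simp: \<rho> orthonormal_def)
    qed (simp_all add: \<rho>_def)
    fix x y assume x: "x \<in> carrier G" and y: "y \<in> carrier G"
    show "\<rho> (x \<otimes> y) = \<rho> x * \<rho> y"
    proof (rule eq_matI)
      fix i j assume "i < dim_row (\<rho> x * \<rho> y)" "j < dim_col (\<rho> x * \<rho> y)"
      then have ij: "i < d" "j < d" by (auto simp: \<rho>_def)
      have "R (x \<otimes> y) j i = inner_prod (\<lambda>z. \<Sum>l<d. R y j l * e l (z \<otimes> x)) (e i)"
        unfolding R_def[of "x \<otimes> y"]
      proof (rule inner_prod_cong)
        fix z assume z: "z \<in> carrier G"
        show "e j (z \<otimes> (x \<otimes> y)) = (\<Sum>l<d. R y j l * e l (z \<otimes> x))"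
          using tr[OF ij(2), of "z \<otimes> x" y] x y z by (simp add: m_assoc)
      qed simp
      also have "\<dots> = (\<Sum>l<d. R y j l * R x l i)"
        unfolding R_def[of x]
        by (intro inner_prod_sum_left[where e = "\<lambda>l z. e l (z \<otimes> x)"] cts_translate ce x ij)
      finally show "\<rho> (x \<otimes> y) $$ (i, j) = (\<rho> x * \<rho> y) $$ (i, j)"
        using ij \<rho>c[of x] \<rho>c[of y]
        by (simp add: \<rho> times_mat_def scalar_prod_def lessThan_atLeast0 mult.commute)
    qed (simp_all add: \<rho>_def)
  next
    fix i j assume ij: "i < d" "j < d"
    have "cts (\<lambda>y. \<integral>x. e j (x \<otimes> y) * cnj (e i x) \<partial>\<mu>)"
    proof (rule cts_parametric_integral[OF borel_\<mu>])
      show "cts2 (\<lambda>z. e j (snd z \<otimes> fst z) * cnj (e i (snd z)))"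
        by (intro continuous_intros continuous_on_cnj cts_snd cts_compose[OF ce]
            cts_mult ij) auto
    qed
    then show "cts (\<lambda>y. \<rho> y $$ (i, j))"
      using ij by (simp add: \<rho> R_def inner_prod_def)
  qed (auto simp: \<rho>_def)
  have "d \<noteq> 0"
  proof
    assume "d = 0"
    then have "u x = 0" if "u \<in> S" "x \<in> carrier G" for u x using spans[OF e that] by simp
    then show False using S(3) by (auto simp: nonzero_space_def)
  qed
  have irr: "W = {0\<^sub>v d} \<or> W = carrier_vec d"
    if W: "vec_subspace d W" and inv: "\<And>y c. y \<in> carrier G \<Longrightarrow> c \<in> W \<Longrightarrow> \<rho> y *\<^sub>v c \<in> W" for W
  proof (cases "W = {0\<^sub>v d}")
    case False
    \<comment> \<open>The functions in \<open>S\<close> whose coordinates form a vector of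
      \<open>W\<close>. They are again an invariant subspace, which minimality of \<open>S\<close>
      will force to have full dimension.\<close>
    define T where "T = {u \<in> S. \<exists>c\<in>W. \<forall>x\<in>carrier G. u x = (\<Sum>i<d. vec_index c i * e i x)}"
    have Wc: "W \<subseteq> carrier_vec d" "0\<^sub>v d \<in> W" "\<And>u v. u \<in> W \<Longrightarrow> v \<in> W \<Longrightarrow> u + v \<in> W" "\<And>a u. u \<in> W \<Longrightarrow> a \<cdot>\<^sub>v u \<in> W"
      using W by (auto simp: vec_subspace_def)
    have TI: "u \<in> T" if "u \<in> S" "c \<in> W" "\<And>x. x \<in> carrier G \<Longrightarrow> u x = (\<Sum>i<d. vec_index c i * e i x)" for u c
      using that by (auto simp: T_def)
    have TD: "u \<in> S" if "u \<in> T" for u using that by (simp add: T_def)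
    have Tinv: "shift_invariant T"
      unfolding shift_invariant_def
    proof (intro conjI ballI allI)
      show "cts u" if "u \<in> T" for u using that S(2) by (auto simp: T_def shift_invariant_def)
      show "(\<lambda>x. 0) \<in> T"
        using S(2) Wc(2) by (auto simp: T_def shift_invariant_def intro!: bexI[of _ "0\<^sub>v d"])
      show "(\<lambda>x. u x + v x) \<in> T" if uv: "u \<in> T" "v \<in> T" for u v
      proof -
        obtain b c where bc: "b \<in> W" "c \<in> W" "\<forall>x\<in>carrier G. u x = (\<Sum>i<d. vec_index b i * e i x)"
            "\<forall>x\<in>carrier G. v x = (\<Sum>i<d. vec_index c i * e i x)"
          using uv unfolding T_def by blast
        have [simp]: "dim_vec b = d" "dim_vec c = d" using bc(1,2) Wc(1) by auto
        show ?thesis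
        proof (rule TI[OF _ Wc(3)[OF bc(1,2)]])
          show "(\<lambda>x. u x + v x) \<in> S"
            using S(2) TD[OF uv(1)] TD[OF uv(2)] unfolding shift_invariant_def by blast
          fix x assume "x \<in> carrier G"
          then show "u x + v x = (\<Sum>i<d. vec_index (b + c) i * e i x)"
            using bc(3,4) by (simp add: distrib_right sum.distrib)
        qed
      qed
      show "(\<lambda>x. a * u x) \<in> T" if u: "u \<in> T" for a u
      proof -
        obtain c where c: "c \<in> W" "\<forall>x\<in>carrier G. u x = (\<Sum>i<d. vec_index c i * e i x)"
          using u unfolding T_def by blast
        have [simp]: "dim_vec c = d" using c(1) Wc(1) by auto
        show ?thesis
        proof (rule TI[OF _ Wc(4)[OF c(1)]])
          show "(\<lambda>x. a * u x) \<in> S"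
            using S(2) TD[OF u] unfolding shift_invariant_def by blast
          fix x assume "x \<in> carrier G"
          then show "a * u x = (\<Sum>i<d. vec_index (a \<cdot>\<^sub>v c) i * e i x)"
            using c(2) by (simp add: sum_distrib_left mult.assoc)
        qed
      qed
      show "(\<lambda>x. u (x \<otimes> y)) \<in> T" if y: "y \<in> carrier G" and u: "u \<in> T" for y u
      proof -
        obtain c where c: "c \<in> W" "\<forall>x\<in>carrier G. u x = (\<Sum>i<d. vec_index c i * e i x)"
          using u unfolding T_def by blast
        have cd: "c \<in> carrier_vec d" using c Wc(1) by auto
        have uy: "u (x \<otimes> y) = (\<Sum>i<d. vec_index (\<rho> y *\<^sub>v c) i * e i x)" if x: "x \<in> carrier G" for x
        proof -
          have "u (x \<otimes> y) = (\<Sum>j<d. vec_index c j * e j (x \<otimes> y))"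
            using c(2) x y by simp
          also have "\<dots> = (\<Sum>j<d. vec_index c j * (\<Sum>i<d. R y j i * e i x))"
            by (rule sum.cong) (simp_all add: tr x y)
          also have "\<dots> = (\<Sum>i<d. \<Sum>j<d. vec_index c j * (R y j i * e i x))"
            unfolding sum_distrib_left by (rule sum.swap)
          also have "\<dots> = (\<Sum>i<d. vec_index (\<rho> y *\<^sub>v c) i * e i x)"
          proof (rule sum.cong[OF refl])
            fix i assume "i \<in> {..<d}"
            then have i: "i < d" by simp
            have "vec_index (\<rho> y *\<^sub>v c) i = (\<Sum>j<d. R y j i * vec_index c j)"
              using cd \<rho>c[of y] i by (simp add: scalar_prod_def lessThan_atLeast0 \<rho>)
            then show "(\<Sum>j<d. vec_index c j * (R y j i * e i x)) = vec_index (\<rho> y *\<^sub>v c) i * e i x"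
              by (simp only: sum_distrib_right) (rule sum.cong, simp_all add: mult_ac)
          qed
          finally show ?thesis .
        qed
        show ?thesis
        proof (rule TI[OF _ inv[OF y c(1)] uy])
          show "(\<lambda>x. u (x \<otimes> y)) \<in> S"
            using S(2) TD[OF u] y unfolding shift_invariant_def by blast
        qed
      qed
    qed
    have combS: "(\<lambda>x. \<Sum>i<d. vec_index c i * e i x) \<in> S" for c
      by (rule invariant_combination[OF S(2) e(2)])
    obtain c where c: "c \<in> W" "c \<noteq> 0\<^sub>v d" using False Wc(2) by blast
    then have cd: "c \<in> carrier_vec d" using Wc(1) by auto
    have "\<exists>i<d. vec_index c i \<noteq> 0"
    proof (rule ccontr)
      assume "\<not> (\<exists>i<d. vec_index c i \<noteq> 0)"
      then have "c = 0\<^sub>v d" using cd by (intro eq_vecI) auto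
      then show False using c(2) by simp
    qed
    then obtain i where i: "i < d" "vec_index c i \<noteq> 0" by blast
    have nz: "\<exists>x\<in>carrier G. (\<Sum>i<d. vec_index c i * e i x) \<noteq> 0"
    proof (rule ccontr)
      assume "\<not> ?thesis"
      then have "inner_prod (\<lambda>x. \<Sum>i<d. vec_index c i * e i x) (e i) = inner_prod (\<lambda>x. 0) (e i)"
        by (intro inner_prod_cong) auto
      then show False using inner_prod_combination[OF e(1) i(1), of "vec_index c"] i(2) by (simp add: inner_prod_def)
    qed
    have "(\<lambda>x. \<Sum>i<d. vec_index c i * e i x) \<in> T"
      by (rule TI[OF combS c(1)]) simp
    moreover obtain x where x: "x \<in> carrier G" "(\<Sum>i<d. vec_index c i * e i x) \<noteq> 0"
      using nz by (elim bexE)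
    ultimately have nzT: "nonzero_space T" by (rule nonzero_spaceI)
    have TE: "T \<subseteq> E" using S(1) by (auto simp: T_def)
    \<comment> \<open>By minimality \<open>T\<close> holds \<open>d\<close> orthonormal functions;
      as \<open>S\<close> has no larger orthonormal family, they span \<open>S\<close> on the
      carrier.\<close>
    have "d \<le> dim T" unfolding d_def by (rule min) (use Tinv nzT TE in \<open>simp add: Q_def\<close>)
    moreover obtain f0 where "orthonormal f0 (dim T)" "\<And>i. i < dim T \<Longrightarrow> f0 i \<in> T"
      using dim[OF TE] unfolding has_orthonormal_def by blast
    ultimately have "orthonormal f0 d" "\<And>i. i < d \<Longrightarrow> f0 i \<in> T"
      by (simp_all add: orthonormal_def)
    then obtain f where f: "orthonormal f d" "\<And>i. i < d \<Longrightarrow> f i \<in> T"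
      by (rule that)
    have "v \<in> W" if v: "v \<in> carrier_vec d" for v
    proof -
      define u where "u = (\<lambda>x. \<Sum>i<d. vec_index v i * e i x)"
      \<comment> \<open>\<open>u\<close> and \<open>u'\<close> agree only on the carrier. Membership
        in \<open>T\<close> is obtained for \<open>u'\<close>, which is literally a combination of
        members of \<open>T\<close>.\<close>
      define u' where "u' = (\<lambda>x. \<Sum>i<d. inner_prod u (f i) * f i x)"
      have uS: "u \<in> S" unfolding u_def by (rule combS)
      have uu: "u x = u' x" if "x \<in> carrier G" for x
        unfolding u'_def by (rule spans[OF f(1) TD[OF f(2)] uS that])
      have "u' \<in> T" unfolding u'_def by (rule invariant_combination[OF Tinv f(2)])
      then obtain c where c: "c \<in> W" "\<And>x. x \<in> carrier G \<Longrightarrow> u' x = (\<Sum>i<d. vec_index c i * e i x)"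
        unfolding T_def by blast
      have "vec_index v i = vec_index c i" if "i < d" for i
      proof -
        have "vec_index v i = inner_prod u (e i)"
          unfolding u_def using inner_prod_combination[OF e(1) that, of "vec_index v"] by simp
        also have "\<dots> = inner_prod (\<lambda>x. \<Sum>i<d. vec_index c i * e i x) (e i)"
          by (rule inner_prod_cong) (auto simp: uu c(2))
        also have "\<dots> = vec_index c i" by (rule inner_prod_combination[OF e(1) that])
        finally show ?thesis .
      qed
      then have "v = c" using v c(1) Wc(1) by (intro eq_vecI) auto
      then show ?thesis using c(1) by simp
    qed
    then show ?thesis using Wc(1) by blast
  qed simp
  show thesis
  proof (rule that[of d \<rho> e])
    show "irreducible_rep G d \<rho>"
      unfolding irreducible_rep_def using rep \<open>d \<noteq> 0\<close> by (intro conjI allI impI irr) auto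
    show "e j (x \<otimes> y) = (\<Sum>i<d. \<rho> y $$ (i, j) * e i x)" if "j < d" "x \<in> carrier G" "y \<in> carrier G" for j x y
      using tr[OF that] that(1) by (simp add: \<rho>)
  qed (use e S(1) in auto)
qed

section \<open>Eigenspaces of convolution operators and separation by irreducible
  coefficients\<close>

definition eigenspace :: "('a \<Rightarrow> complex) \<Rightarrow> complex \<Rightarrow> ('a \<Rightarrow> complex) set" where
  "eigenspace k a = {u. cts u \<and> (\<forall>x\<in>carrier G. conv k u x = a * u x)}"

text \<open>Substituting \<open>z \<otimes> y\<close> for \<open>z\<close> cancels \<open>y\<close>
  in the kernel, as \<open>x \<otimes> y \<otimes> inv (z \<otimes> y) = x \<otimes> inv
  z\<close>.\<close>

lemma conv_right_translate:
  assumes k: "cts k" and u: "cts u" and x: "x \<in> carrier G" and y: "y \<in> carrier G"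
  shows "conv k (\<lambda>z. u (z \<otimes> y)) x = conv k u (x \<otimes> y)"
proof -
  have "conv k u (x \<otimes> y) = (\<integral>z. k (x \<otimes> y \<otimes> inv (z \<otimes> y)) * u (z \<otimes> y) \<partial>\<mu>)"
    unfolding conv_def using x y
    by (intro integral_right_translate[symmetric] continuous_intros cts_translate k u) auto
  also have "\<dots> = conv k (\<lambda>z. u (z \<otimes> y)) x"
    unfolding conv_def
  proof (rule integral_cong_carrier)
    fix z assume z: "z \<in> carrier G"
    have "x \<otimes> y \<otimes> inv (z \<otimes> y) = x \<otimes> (y \<otimes> inv y) \<otimes> inv z"
      using x y z by (simp only: inv_mult_group m_assoc m_closed inv_closed)
    then show "k (x \<otimes> y \<otimes> inv (z \<otimes> y)) * u (z \<otimes> y) = k (x \<otimes> inv z) * u (z \<otimes> y)"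
      using x y by simp
  qed
  finally show ?thesis by simp
qed

lemma shift_invariant_eigenspace:
  assumes k: "cts k" shows "shift_invariant (eigenspace k a)"
  unfolding shift_invariant_def
proof (intro conjI ballI allI)
  show "(\<lambda>x. 0) \<in> eigenspace k a" by (auto simp: eigenspace_def conv_def)
  show "cts u" if "u \<in> eigenspace k a" for u using that by (simp add: eigenspace_def)
  show "(\<lambda>x. u x + v x) \<in> eigenspace k a" if uv: "u \<in> eigenspace k a" "v \<in> eigenspace k a" for u v
  proof -
    have c: "cts u" "cts v" using uv by (auto simp: eigenspace_def)
    have "conv k (\<lambda>x. u x + v x) x = conv k u x + conv k v x" if "x \<in> carrier G" for x
      unfolding conv_def distrib_left
      by (intro integral_add' integrable_cts continuous_intros cts_translate k c that)
    then show ?thesis using uv c by (auto simp: eigenspace_def distrib_left intro!: continuous_intros)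
  qed
  show "(\<lambda>x. b * u x) \<in> eigenspace k a" if u: "u \<in> eigenspace k a" for b u
  proof -
    have "conv k (\<lambda>x. b * u x) x = b * conv k u x" for x
      unfolding conv_def by (simp add: mult.left_commute)
    then show ?thesis using u by (auto simp: eigenspace_def intro!: continuous_intros)
  qed
  show "(\<lambda>x. u (x \<otimes> y)) \<in> eigenspace k a" if y: "y \<in> carrier G" and u: "u \<in> eigenspace k a" for y u
    using u y conv_right_translate[OF k _ _ y, of u] cts_translate(2)[OF _ y, of u]
    by (auto simp: eigenspace_def)
qed

text \<open>The Hilbert-Schmidt bound on multiplicities. At each \<open>x\<close>, Bessel's
  inequality for the kernel as a function of \<open>y\<close> bounds the sum of the squares of
  \<open>cmod (a * e i x)\<close> by \<open>sqnorm k\<close>; integrating over \<open>x\<close>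
  bounds \<open>d * (cmod a)^2\<close> by \<open>sqnorm k * vol\<close>.\<close>

lemma orthonormal_eigenspace_bound:
  assumes k: "cts k" "hermitian k" and a: "a \<noteq> 0" and d: "has_orthonormal (eigenspace k a) d"
  shows "d \<le> nat \<lceil>sqnorm k * vol / (cmod a)\<^sup>2\<rceil>"
proof -
  obtain e where e: "orthonormal e d" "\<And>i. i < d \<Longrightarrow> e i \<in> eigenspace k a"
    using d unfolding has_orthonormal_def by blast
  have ce: "cts (e i)" if "i < d" for i using e(1) that by (auto simp: orthonormal_def)
  have pt: "(\<Sum>i<d. (cmod a)\<^sup>2 * (cmod (e i x))\<^sup>2) \<le> sqnorm k" if x: "x \<in> carrier G" for x
  proof -
    define w where "w = (\<lambda>y. cnj (k (x \<otimes> inv y)))"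
    have cw: "cts w" unfolding w_def by (intro continuous_on_cnj cts_translate k x)
    have "(\<Sum>i<d. (cmod a)\<^sup>2 * (cmod (e i x))\<^sup>2) = (\<Sum>i<d. (cmod (inner_prod w (e i)))\<^sup>2)"
    proof (rule sum.cong)
      fix i assume "i \<in> {..<d}"
      then have "a * e i x = conv k (e i) x" using e(2)[of i] x by (auto simp: eigenspace_def)
      also have "\<dots> = cnj (inner_prod w (e i))"
        unfolding inner_prod_def integral_cnj'[symmetric] by (simp add: conv_def w_def)
      finally have eq: "cmod (a * e i x) = cmod (inner_prod w (e i))" by simp
      show "(cmod a)\<^sup>2 * (cmod (e i x))\<^sup>2 = (cmod (inner_prod w (e i)))\<^sup>2"
        by (simp add: norm_mult power_mult_distrib flip: eq)
    qed simp
    also have "\<dots> \<le> sqnorm w" by (rule Bessel_inequality[OF e(1) cw])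
    also have "sqnorm w = sqnorm k"
      using sqnorm_quotient[OF k x] by (simp add: sqnorm_def w_def)
    finally show ?thesis .
  qed
  have one: "sqnorm (e i) = 1" if "i < d" for i
  proof -
    have "complex_of_real (sqnorm (e i)) = 1" using e(1) that by (simp add: inner_prod_self[symmetric] orthonormal_def)
    then show ?thesis by simp
  qed
  interpret finite_measure \<mu> by (rule finite_\<mu>)
  have ci: "cts (\<lambda>x. (cmod a)\<^sup>2 * (cmod (e i x))\<^sup>2)" if "i < d" for i
    by (intro continuous_intros ce that)
  have "(\<Sum>i<d. (cmod a)\<^sup>2 * sqnorm (e i)) = (\<integral>x. (\<Sum>i<d. (cmod a)\<^sup>2 * (cmod (e i x))\<^sup>2) \<partial>\<mu>)"
    using integrable_cts[OF ci] by (subst integral_sum') (auto simp: sqnorm_def)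
  also have "\<dots> \<le> (\<integral>x. sqnorm k \<partial>\<mu>)"
    using pt integrable_cts[OF ci] by (intro integral_mono) (auto simp: space_\<mu>)
  finally have "real d * (cmod a)\<^sup>2 \<le> sqnorm k * vol"
    by (simp add: one measure_space_\<mu> mult.commute)
  then have "real d \<le> sqnorm k * vol / (cmod a)\<^sup>2" using a by (simp add: field_simps)
  then show ?thesis by linarith
qed

theorem continuous_orthogonal_to_irreducibles_eq_0:
  assumes f: "cts f"
    and orth: "\<And>d \<rho> i j. irreducible_rep G d \<rho> \<Longrightarrow> i < d \<Longrightarrow> j < d \<Longrightarrow> (\<integral>x. f x * \<rho> x $$ (i, j) \<partial>\<mu>) = 0"
    and x0: "x0 \<in> carrier G"
  shows "f x0 = 0"
proof (rule ccontr)
  assume nz: "f x0 \<noteq> 0"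
  \<comment> \<open>\<open>conv\<close> evaluates its first factor at
    \<open>x \<otimes> inv y\<close>; with the inverse built into \<open>F\<close>, convolving with
    \<open>e 0\<close> at the identity pairs \<open>f\<close> directly with
    \<open>e 0\<close>.\<close>
  define F where "F = (\<lambda>x. f (inv x))"
  have cF: "cts F" unfolding F_def by (rule cts_inverse_arg[OF f])
  \<comment> \<open>As the kernel of an adjoint times its operator, \<open>k\<close> takes the value
    \<open>sqnorm F\<close> at the identity, which is nonzero, and it annihilates whatever
    \<open>F\<close> annihilates.\<close>
  define k where "k = conv (adj F) F"
  have ck: "cts k" unfolding k_def by (intro cts_conv cts_adj cF)
  have hk: "hermitian k"
    unfolding hermitian_def
  proof
    fix x assume x: "x \<in> carrier G"
    have "adj k x = conv (adj F) (adj (adj F)) x"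
      unfolding k_def by (rule adj_conv[OF cts_adj[OF cF] cF x])
    also have "\<dots> = k x"
      unfolding k_def by (rule conv_cong[OF refl adj_adj x])
    finally show "adj k x = k x" .
  qed
  have "k \<one> = (\<integral>y. F y * cnj (F y) \<partial>\<mu>)"
    unfolding k_def conv_def by (rule integral_cong_carrier) (simp add: adj_def mult.commute)
  then have "k \<one> = of_real (sqnorm F)" by (simp add: of_real_sqnorm)
  moreover have "sqnorm F \<noteq> 0"
    using sqnorm_eq_0D[OF cF, of "inv x0"] nz x0 by (auto simp: F_def)
  ultimately have "k \<one> \<noteq> 0" by simp
  then obtain L p where L: "L > 0" and p: "cts p" "\<exists>x\<in>carrier G. p x \<noteq> 0"
      "\<And>x. x \<in> carrier G \<Longrightarrow> conv (conv k k) p x = of_real L * p x"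
    using eigenfunction_exists[OF ck hk one_closed] by blast
  define K where "K = conv k k"
  have cK: "cts K" unfolding K_def by (rule cts_conv[OF ck ck])
  have hK: "hermitian K" using hermitian_conv_power[OF ck hk, of 1] by (simp add: K_def)
  define E where "E = eigenspace K (of_real L)"
  have nzE: "nonzero_space E"
    using p unfolding E_def nonzero_space_def eigenspace_def K_def by blast
  have invE: "shift_invariant E" unfolding E_def by (rule shift_invariant_eigenspace[OF cK])
  have bdE: "d \<le> nat \<lceil>sqnorm K * vol / (cmod (of_real L))\<^sup>2\<rceil>" if "has_orthonormal E d" for d
    using orthonormal_eigenspace_bound[OF cK hK _ that[unfolded E_def]] L by simp
  obtain d \<rho> e where irr: "irreducible_rep G d \<rho>" and e: "orthonormal e d" "\<And>i. i < d \<Longrightarrow> e i \<in> E"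
    and tr: "\<And>j x y. \<lbrakk>j < d; x \<in> carrier G; y \<in> carrier G\<rbrakk> \<Longrightarrow> e j (x \<otimes> y) = (\<Sum>i<d. \<rho> y $$ (i, j) * e i x)"
    using irreducible_subrepresentation[OF invE nzE bdE] by blast
  have d: "0 < d" and rep: "matrix_rep G d \<rho>" using irr by (auto simp: irreducible_rep_def)
  have ce: "cts (e i)" if "i < d" for i using e(1) that by (auto simp: orthonormal_def)
  have c\<rho>: "cts (\<lambda>x. \<rho> x $$ (i, j))" if "i < d" "j < d" for i j
    using rep that by (auto simp: matrix_rep_def)
  \<comment> \<open>Expanding \<open>e i (\<one> \<otimes> y)\<close> exhibits \<open>e i\<close> as
    a combination of entries of \<open>\<rho>\<close>, to which \<open>f\<close> is
    orthogonal.\<close>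
  have fe: "(\<integral>y. f y * e i y \<partial>\<mu>) = 0" if i: "i < d" for i
  proof -
    have "(\<integral>y. f y * e i y \<partial>\<mu>) = (\<integral>y. (\<Sum>l<d. e l \<one> * (f y * \<rho> y $$ (l, i))) \<partial>\<mu>)"
      using tr[OF i one_closed] by (intro integral_cong_carrier) (simp add: sum_distrib_left mult_ac)
    also have "\<dots> = (\<Sum>l<d. (\<integral>y. e l \<one> * (f y * \<rho> y $$ (l, i)) \<partial>\<mu>))"
      by (intro integral_sum' integrable_cts continuous_intros f c\<rho> i) auto
    also have "\<dots> = 0" using orth[OF irr _ i] by simp
    finally show ?thesis .
  qed
  have Fe: "conv F (e 0) x = 0" if x: "x \<in> carrier G" for x
  proof -
    have "conv F (e 0) x = (\<integral>y. F (x \<otimes> inv (y \<otimes> x)) * e 0 (y \<otimes> x) \<partial>\<mu>)"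
      unfolding conv_def
      by (intro integral_right_translate[symmetric] continuous_intros cts_translate cF ce x d)
    also have "\<dots> = (\<integral>y. (\<Sum>i<d. \<rho> x $$ (i, 0) * (f y * e i y)) \<partial>\<mu>)"
    proof (rule integral_cong_carrier)
      fix y assume y: "y \<in> carrier G"
      have "x \<otimes> inv (y \<otimes> x) = inv y" using x y by (simp add: inv_mult_group m_assoc[symmetric])
      then show "F (x \<otimes> inv (y \<otimes> x)) * e 0 (y \<otimes> x) = (\<Sum>i<d. \<rho> x $$ (i, 0) * (f y * e i y))"
        using tr[OF d y x] y by (simp add: F_def sum_distrib_left mult_ac)
    qed
    also have "\<dots> = (\<Sum>i<d. (\<integral>y. \<rho> x $$ (i, 0) * (f y * e i y) \<partial>\<mu>))"
      by (intro integral_sum' integrable_cts continuous_intros f ce) auto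
    also have "\<dots> = 0" using fe by simp
    finally show ?thesis .
  qed
  have ke: "conv k (e 0) x = 0" if x: "x \<in> carrier G" for x
  proof -
    have "conv k (e 0) x = conv (adj F) (conv F (e 0)) x"
      unfolding k_def by (rule conv_assoc[OF cts_adj[OF cF] cF ce[OF d] x])
    also have "\<dots> = conv (adj F) (\<lambda>x. 0) x" using Fe x by (intro conv_cong) auto
    finally show ?thesis by (simp add: conv_def)
  qed
  have "e 0 x = 0" if x: "x \<in> carrier G" for x
  proof -
    have "of_real L * e 0 x = conv K (e 0) x" using e(2)[OF d] x by (auto simp: E_def eigenspace_def)
    also have "\<dots> = conv k (conv k (e 0)) x" unfolding K_def by (rule conv_assoc[OF ck ck ce[OF d] x])
    also have "\<dots> = conv k (\<lambda>x. 0) x" using ke x by (intro conv_cong) auto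
    finally show ?thesis using L by (simp add: conv_def)
  qed
  \<comment> \<open>\<open>e 0\<close> has norm one, yet the eigenvalue equation has just forced it
    to vanish on the carrier.\<close>
  then have "inner_prod (e 0) (e 0) = inner_prod (\<lambda>x. 0) (\<lambda>x. 0)" by (intro inner_prod_cong) auto
  then show False using e(1) d by (simp add: orthonormal_def inner_prod_def)
qed

end

section \<open>Schur orthogonality and characters\<close>

definition character :: "('a, 'b) monoid_scheme \<Rightarrow> ('a \<Rightarrow> complex mat) \<Rightarrow> 'a \<Rightarrow> complex" where
  "character G \<rho> x = (\<Sum>i<rep_dim G \<rho>. \<rho> x $$ (i, i))"

lemma index_mat_mult_sum:
  assumes "A \<in> carrier_mat m n" "B \<in> carrier_mat n k" "i < m" "j < k"
  shows "(A * B) $$ (i, j) = (\<Sum>l<n. A $$ (i, l) * B $$ (l, j))"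
  using assms by (simp add: scalar_prod_def lessThan_atLeast0)

lemma index_mult_mat_vec_sum:
  assumes "A \<in> carrier_mat m n" "v \<in> carrier_vec n" "i < m"
  shows "vec_index (A *\<^sub>v v) i = (\<Sum>l<n. A $$ (i, l) * vec_index v l)"
  using assms by (simp add: scalar_prod_def lessThan_atLeast0)

text \<open>Stated for rectangular factors because Schur's lemma applies it before the two
  dimensions are known to agree.\<close>

lemma diag_sum_commute:
  fixes A B :: "'c::comm_semiring_0 mat"
  assumes "A \<in> carrier_mat m n" "B \<in> carrier_mat n m"
  shows "(\<Sum>i<m. (A * B) $$ (i, i)) = (\<Sum>j<n. (B * A) $$ (j, j))"
proof -
  have "(\<Sum>i<m. (A * B) $$ (i, i)) = (\<Sum>i<m. \<Sum>j<n. A $$ (i, j) * B $$ (j, i))"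
    by (rule sum.cong) (simp_all add: index_mat_mult_sum[OF assms] del: index_mult_mat)
  also have "\<dots> = (\<Sum>j<n. \<Sum>i<m. B $$ (j, i) * A $$ (i, j))"
    by (subst sum.swap) (simp add: mult.commute)
  also have "\<dots> = (\<Sum>j<n. (B * A) $$ (j, j))"
    by (rule sum.cong) (simp_all add: index_mat_mult_sum[OF assms(2,1)] del: index_mult_mat)
  finally show ?thesis .
qed

lemma matrix_repD:
  assumes "matrix_rep G d \<rho>" "x \<in> carrier G"
  shows "\<rho> x \<in> carrier_mat d d" "dim_row (\<rho> x) = d" "dim_col (\<rho> x) = d"
  using assms unfolding matrix_rep_def by auto

lemma matrix_rep_mult:
  assumes "matrix_rep G d \<rho>" "x \<in> carrier G" "y \<in> carrier G"
  shows "\<rho> (x \<otimes>\<^bsub>G\<^esub> y) = \<rho> x * \<rho> y"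
  using assms unfolding matrix_rep_def by blast

lemma matrix_rep_one: "matrix_rep G d \<rho> \<Longrightarrow> \<rho> \<one>\<^bsub>G\<^esub> = 1\<^sub>m d"
  unfolding matrix_rep_def by blast

lemma rep_dim_eq: "matrix_rep G d \<rho> \<Longrightarrow> rep_dim G \<rho> = d"
  by (simp add: rep_dim_def matrix_rep_one)

lemma irrep_matrix_rep: "irreducible_rep G d \<rho> \<Longrightarrow> matrix_rep G d \<rho>"
  by (simp add: irreducible_rep_def)

lemma irreducible_rep_dichotomy:
  assumes "irreducible_rep G d \<rho>" "vec_subspace d W" "\<And>x u. x \<in> carrier G \<Longrightarrow> u \<in> W \<Longrightarrow> \<rho> x *\<^sub>v u \<in> W"
  shows "W = {0\<^sub>v d} \<or> W = carrier_vec d"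
  using assms unfolding irreducible_rep_def by blast

lemma mult_mat_unit_vec:
  fixes P :: "complex mat"
  assumes "P \<in> carrier_mat e d" "j < d"
  shows "P *\<^sub>v unit_vec d j = col P j"
  using assms by (intro eq_vecI) (auto simp: scalar_prod_right_unit)

lemma mat_eq_zeroI:
  fixes P :: "complex mat"
  assumes P: "P \<in> carrier_mat e d" and v: "\<And>v. v \<in> carrier_vec d \<Longrightarrow> P *\<^sub>v v = 0\<^sub>v e"
  shows "P = 0\<^sub>m e d"
proof (rule eq_matI)
  fix i j assume "i < dim_row (0\<^sub>m e d)" "j < dim_col (0\<^sub>m e d)"
  then have ij: "i < e" "j < d" by auto
  have "P *\<^sub>v unit_vec d j = col P j" using P ij by (intro mult_mat_unit_vec) auto
  moreover have "vec_index (P *\<^sub>v unit_vec d j) i = 0" using v[of "unit_vec d j"] ij by simp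
  ultimately have "vec_index (col P j) i = 0" by simp
  then show "P $$ (i, j) = 0\<^sub>m e d $$ (i, j)" using P ij by simp
qed (use P in auto)

text \<open>
  Schur's lemma.  A right inverse \<open>Q\<close> of the surjective \<open>P\<close> is a left inverse as \<open>P\<close> is injective,
  and comparing the traces of \<open>P Q\<close> and \<open>Q P\<close> gives \<open>d = e\<close>.
\<close>

lemma Schur_intertwiner:
  assumes \<rho>: "irreducible_rep G d \<rho>" and \<sigma>: "irreducible_rep G e \<sigma>"
    and P: "P \<in> carrier_mat e d" and comm: "\<And>x. x \<in> carrier G \<Longrightarrow> P * \<rho> x = \<sigma> x * P"
    and nz: "P \<noteq> 0\<^sub>m e d"
  shows "d = e" "invertible_mat P"
proof -
  note R = matrix_repD[OF irrep_matrix_rep[OF \<rho>]]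
  note S = matrix_repD[OF irrep_matrix_rep[OF \<sigma>]]
  have commv: "P *\<^sub>v (\<rho> x *\<^sub>v v) = \<sigma> x *\<^sub>v (P *\<^sub>v v)" if "x \<in> carrier G" "v \<in> carrier_vec d" for x v
    using assoc_mult_mat_vec[OF P R(1)[OF that(1)] that(2)] assoc_mult_mat_vec[OF S(1)[OF that(1)] P that(2)]
      comm[OF that(1)] by simp
  define K where "K = {v \<in> carrier_vec d. P *\<^sub>v v = 0\<^sub>v e}"
  have "vec_subspace d K"
    unfolding vec_subspace_def K_def using P
    by (auto simp: mult_add_distrib_mat_vec[OF P] mult_mat_vec[OF P])
  moreover have "\<rho> x *\<^sub>v u \<in> K" if "x \<in> carrier G" "u \<in> K" for x u
    using commv[OF that(1), of u] that R(1)[OF that(1)] S(1)[OF that(1)] by (auto simp: K_def)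
  ultimately have "K = {0\<^sub>v d} \<or> K = carrier_vec d" by (rule irreducible_rep_dichotomy[OF \<rho>])
  moreover have "K \<noteq> carrier_vec d" using mat_eq_zeroI[OF P] nz unfolding K_def by blast
  ultimately have K: "K = {0\<^sub>v d}" by blast
  define I where "I = (\<lambda>v. P *\<^sub>v v) ` carrier_vec d"
  have "vec_subspace e I"
    unfolding vec_subspace_def
  proof (intro conjI ballI allI)
    show "I \<subseteq> carrier_vec e" using P by (auto simp: I_def)
    show "0\<^sub>v e \<in> I" unfolding I_def using P by (intro image_eqI[of _ _ "0\<^sub>v d"]) auto
    show "u + v \<in> I" if uv: "u \<in> I" "v \<in> I" for u v
    proof -
      obtain u' v' where "u = P *\<^sub>v u'" "v = P *\<^sub>v v'" "u' \<in> carrier_vec d" "v' \<in> carrier_vec d"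
        using uv unfolding I_def by blast
      then show ?thesis unfolding I_def
        by (intro image_eqI[of _ _ "u' + v'"]) (auto simp: mult_add_distrib_mat_vec[OF P])
    qed
    show "a \<cdot>\<^sub>v u \<in> I" if u: "u \<in> I" for a u
    proof -
      obtain u' where "u = P *\<^sub>v u'" "u' \<in> carrier_vec d" using u unfolding I_def by blast
      then show ?thesis unfolding I_def
        by (intro image_eqI[of _ _ "a \<cdot>\<^sub>v u'"]) (auto simp: mult_mat_vec[OF P])
    qed
  qed
  moreover have "\<sigma> x *\<^sub>v u \<in> I" if x: "x \<in> carrier G" and u: "u \<in> I" for x u
  proof -
    obtain u' where u': "u = P *\<^sub>v u'" "u' \<in> carrier_vec d" using u unfolding I_def by blast
    then show ?thesis unfolding I_def u'(1) commv[OF x u'(2), symmetric]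
      using R(1)[OF x] by (intro imageI) auto
  qed
  ultimately have "I = {0\<^sub>v e} \<or> I = carrier_vec e" by (rule irreducible_rep_dichotomy[OF \<sigma>])
  moreover have "I \<noteq> {0\<^sub>v e}" using mat_eq_zeroI[OF P] nz unfolding I_def by blast
  ultimately have I: "I = carrier_vec e" by blast
  have "\<exists>v\<in>carrier_vec d. P *\<^sub>v v = unit_vec e i" for i
  proof -
    have "unit_vec e i \<in> I" unfolding I by simp
    then show ?thesis unfolding I_def by auto
  qed
  then obtain w where w: "\<And>i. w i \<in> carrier_vec d" "\<And>i. P *\<^sub>v w i = unit_vec e i" by metis
  \<comment> \<open>The columns are preimages of the unit vectors, so \<open>P * Q\<close> is the
    identity by construction.\<close>
  define Q where "Q = mat_of_cols d (map w [0..<e])"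
  have Q: "Q \<in> carrier_mat d e" unfolding Q_def by (rule carrier_matI) simp_all
  have colQ: "col Q j = w j" if "j < e" for j
    unfolding Q_def using that w(1) by (simp add: col_mat_of_cols)
  have PQ: "P * Q = 1\<^sub>m e"
  proof (rule eq_matI)
    fix i j assume "i < dim_row (1\<^sub>m e)" "j < dim_col (1\<^sub>m e)"
    then have ij: "i < e" "j < e" by auto
    have "(P * Q) $$ (i, j) = vec_index (col (P * Q) j) i" using P Q ij by simp
    also have "col (P * Q) j = P *\<^sub>v col Q j" using P Q ij by (intro col_mult2) auto
    also have "\<dots> = unit_vec e j" using colQ[OF ij(2)] w(2) by simp
    finally show "(P * Q) $$ (i, j) = 1\<^sub>m e $$ (i, j)" using ij by simp
  qed (use P Q in auto)
  have QP: "Q * P = 1\<^sub>m d"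
  proof (rule eq_matI)
    fix i j assume "i < dim_row (1\<^sub>m d)" "j < dim_col (1\<^sub>m d)"
    then have ij: "i < d" "j < d" by auto
    \<comment> \<open>\<open>P * (Q * P) = P\<close> puts \<open>v\<close> into the kernel of
      \<open>P\<close>, which is trivial.\<close>
    define v where "v = col (Q * P) j - unit_vec d j"
    have cQP: "col (Q * P) j \<in> carrier_vec d" by (rule carrier_vecI) (use Q in simp)
    have v: "v \<in> carrier_vec d" using cQP unfolding v_def by simp
    have "P *\<^sub>v v = P *\<^sub>v col (Q * P) j - P *\<^sub>v unit_vec d j"
      unfolding v_def by (rule mult_minus_distrib_mat_vec[OF P cQP]) simp
    also have "P *\<^sub>v col (Q * P) j = col (P * (Q * P)) j"
      using P Q ij by (intro col_mult2[symmetric]) auto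
    also have "P * (Q * P) = P" using assoc_mult_mat[OF P Q P] PQ P by simp
    also have "P *\<^sub>v unit_vec d j = col P j" using P ij by (intro mult_mat_unit_vec) auto
    finally have "P *\<^sub>v v = 0\<^sub>v e" using P ij by simp
    then have "v = 0\<^sub>v d" using K v unfolding K_def by blast
    then have "vec_index v i = 0" using ij by simp
    then show "(Q * P) $$ (i, j) = 1\<^sub>m d $$ (i, j)"
      using P Q ij unfolding v_def by simp
  qed (use P Q in auto)
  have "(\<Sum>i<e. (1\<^sub>m e :: complex mat) $$ (i, i)) = (\<Sum>i<d. (1\<^sub>m d :: complex mat) $$ (i, i))"
    using diag_sum_commute[OF P Q] unfolding PQ QP .
  then have "complex_of_nat e = complex_of_nat d" by simp
  then show de: "d = e" by simp
  show "invertible_mat P"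
    unfolding invertible_mat_def inverts_mat_def using P Q PQ QP de by (auto intro!: exI[of _ Q])
qed

text \<open>Over the complex numbers \<open>P\<close> has an eigenvalue \<open>c\<close>. The matrix
  \<open>P - c I\<close> still commutes with \<open>\<rho>\<close> but kills an eigenvector, so it
  is not invertible and must be zero.\<close>

lemma Schur_scalar:
  assumes \<rho>: "irreducible_rep G d \<rho>"
    and P: "P \<in> carrier_mat d d" and comm: "\<And>x. x \<in> carrier G \<Longrightarrow> P * \<rho> x = \<rho> x * P"
  obtains c where "P = c \<cdot>\<^sub>m 1\<^sub>m d"
proof -
  note R = matrix_repD[OF irrep_matrix_rep[OF \<rho>]]
  have d: "0 < d" using \<rho> by (simp add: irreducible_rep_def)
  obtain c where "eigenvalue P c" using spectrum_non_empty[OF P d] by (auto simp: spectrum_def)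
  then obtain v where v: "v \<in> carrier_vec d" "v \<noteq> 0\<^sub>v d" "P *\<^sub>v v = c \<cdot>\<^sub>v v"
    using P by (auto simp: eigenvalue_def eigenvector_def)
  define M where "M = P - c \<cdot>\<^sub>m 1\<^sub>m d"
  have M: "M \<in> carrier_mat d d" using P unfolding M_def by (intro minus_carrier_mat) auto
  have cI: "c \<cdot>\<^sub>m 1\<^sub>m d \<in> carrier_mat d d" by simp
  have "M = 0\<^sub>m d d"
  proof (rule ccontr)
    assume nz: "M \<noteq> 0\<^sub>m d d"
    have "M * \<rho> x = \<rho> x * M" if x: "x \<in> carrier G" for x
    proof -
      have "M * \<rho> x = P * \<rho> x - c \<cdot>\<^sub>m 1\<^sub>m d * \<rho> x"
        unfolding M_def by (rule minus_mult_distrib_mat[OF P cI R(1)[OF x]])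
      also have "\<dots> = \<rho> x * P - \<rho> x * (c \<cdot>\<^sub>m 1\<^sub>m d)"
        using R(1)[OF x] comm[OF x] mult_smult_distrib[OF R(1)[OF x], of "1\<^sub>m d" d c]
          mult_smult_assoc_mat[of "1\<^sub>m d" d d "\<rho> x" d c] by simp
      also have "\<dots> = \<rho> x * M"
        unfolding M_def by (rule mult_minus_distrib_mat[OF R(1)[OF x] P cI, symmetric])
      finally show ?thesis .
    qed
    then have "invertible_mat M" using Schur_intertwiner(2)[OF \<rho> \<rho> M _ nz] by blast
    then obtain B where "inverts_mat M B" "inverts_mat B M" unfolding invertible_mat_def by blast
    then have B: "M * B = 1\<^sub>m d" "B * M = 1\<^sub>m (dim_row B)" using M unfolding inverts_mat_def by auto
    have "dim_row B = d" using arg_cong[OF B(2), of dim_col] M by simp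
    moreover have "dim_col B = d" using arg_cong[OF B(1), of dim_col] by simp
    ultimately have Bc: "B \<in> carrier_mat d d" by auto
    have "M *\<^sub>v v = P *\<^sub>v v - (c \<cdot>\<^sub>m 1\<^sub>m d) *\<^sub>v v"
      unfolding M_def by (rule minus_mult_distrib_mat_vec[OF P cI v(1)])
    also have "(c \<cdot>\<^sub>m 1\<^sub>m d) *\<^sub>v v = c \<cdot>\<^sub>v v" using v(1) by (intro eq_vecI) auto
    finally have "M *\<^sub>v v = 0\<^sub>v d" using v by simp
    moreover have "B *\<^sub>v 0\<^sub>v d = 0\<^sub>v d" using Bc by (intro eq_vecI) auto
    ultimately have "(B * M) *\<^sub>v v = 0\<^sub>v d" using assoc_mult_mat_vec[OF Bc M v(1)] Bc by simp
    then show False using B(2) Bc v by simp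
  qed
  then have "P = c \<cdot>\<^sub>m 1\<^sub>m d"
    using P unfolding M_def by (auto simp: mat_eq_iff)
  then show thesis by (rule that)
qed

lemma rep_isomorphic_dims:
  assumes "matrix_rep G d \<rho>" "matrix_rep G e \<sigma>" "rep_isomorphic G \<rho> \<sigma>"
  obtains P Q where "d = e" "P \<in> carrier_mat d d" "Q \<in> carrier_mat d d" "P * Q = 1\<^sub>m d" "Q * P = 1\<^sub>m d"
    "\<And>x. x \<in> carrier G \<Longrightarrow> P * \<rho> x = \<sigma> x * P"
proof -
  obtain P where P: "P \<in> carrier_mat e d" "invertible_mat P" "\<And>x. x \<in> carrier G \<Longrightarrow> P * \<rho> x = \<sigma> x * P"
    using assms(3) unfolding rep_isomorphic_def rep_dim_eq[OF assms(1)] rep_dim_eq[OF assms(2)] by blast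
  have de: "d = e" using P(1,2) by (auto simp: invertible_mat_def)
  obtain Q where "inverts_mat P Q" "inverts_mat Q P" using P(2) unfolding invertible_mat_def by blast
  then have Q: "P * Q = 1\<^sub>m d" "Q * P = 1\<^sub>m (dim_row Q)" using P(1) de unfolding inverts_mat_def by auto
  \<comment> \<open>\<open>inverts_mat\<close> does not fix the shape of \<open>Q\<close>; it is
    read off from the two products.\<close>
  have "dim_row Q = d" using arg_cong[OF Q(2), of dim_col] P(1) by simp
  moreover have "dim_col Q = d" using arg_cong[OF Q(1), of dim_col] by simp
  ultimately have "Q \<in> carrier_mat d d" by auto
  with that[OF de _ _ Q(1) _ P(3)] P(1) Q(2) de show thesis by auto
qed

lemma character_isomorphic:
  assumes "matrix_rep G d \<rho>" "matrix_rep G e \<sigma>" "rep_isomorphic G \<rho> \<sigma>"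
  shows "d = e" "x \<in> carrier G \<Longrightarrow> character G \<rho> x = character G \<sigma> x"
proof -
  obtain P Q where de: "d = e" and P: "P \<in> carrier_mat d d" and Q: "Q \<in> carrier_mat d d"
    and PQ: "P * Q = 1\<^sub>m d" and QP: "Q * P = 1\<^sub>m d"
    and comm: "\<And>x. x \<in> carrier G \<Longrightarrow> P * \<rho> x = \<sigma> x * P"
    by (rule rep_isomorphic_dims[OF assms]) blast
  show "d = e" by (rule de)
  assume x: "x \<in> carrier G"
  have R: "\<rho> x \<in> carrier_mat d d" "\<sigma> x \<in> carrier_mat d d"
    using matrix_repD(1)[OF assms(1) x] matrix_repD(1)[OF assms(2) x] de by auto
  have "\<sigma> x = P * \<rho> x * Q"
    using comm[OF x] assoc_mult_mat[OF R(2) P Q] R PQ by simp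
  then have "character G \<sigma> x = (\<Sum>i<d. (P * (\<rho> x * Q)) $$ (i, i))"
    using assoc_mult_mat[OF P R(1) Q] by (simp add: character_def rep_dim_eq[OF assms(2)] de)
  also have "\<dots> = (\<Sum>i<d. ((\<rho> x * Q) * P) $$ (i, i))"
    by (rule diag_sum_commute[OF P]) (use R Q in simp)
  also have "(\<rho> x * Q) * P = \<rho> x" using assoc_mult_mat[OF R(1) Q P] QP R by simp
  finally show "character G \<rho> x = character G \<sigma> x" by (simp add: character_def rep_dim_eq[OF assms(1)])
qed

context haar_group
begin

section \<open>Averages over the group and orthogonality relations\<close>

lemma cts_matrix_rep: "matrix_rep G d \<rho> \<Longrightarrow> i < d \<Longrightarrow> j < d \<Longrightarrow> cts (\<lambda>x. \<rho> x $$ (i, j))"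
  by (simp add: matrix_rep_def)

lemma matrix_rep_index:
  assumes "matrix_rep G d \<rho>" "x \<in> carrier G" "y \<in> carrier G" "i < d" "j < d"
  shows "\<rho> (x \<otimes> y) $$ (i, j) = (\<Sum>l<d. \<rho> x $$ (i, l) * \<rho> y $$ (l, j))"
  unfolding matrix_rep_mult[OF assms(1-3)]
  by (rule index_mat_mult_sum[OF matrix_repD(1)[OF assms(1,2)] matrix_repD(1)[OF assms(1,3)] assms(4,5)])

text \<open>\<open>P\<close> is the integral of \<open>\<rho> x * E * \<sigma> (inv x)\<close> for
  the matrix unit \<open>E\<close> at position \<open>(j, k)\<close>. Left invariance of the measure
  makes this average an intertwiner from \<open>\<sigma>\<close> to \<open>\<rho>\<close>.\<close>

lemma Schur_average:
  assumes \<rho>: "matrix_rep G d \<rho>" and \<sigma>: "matrix_rep G e \<sigma>" and jk: "j < d" "k < e"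
  defines "P \<equiv> Matrix.mat d e (\<lambda>(i, l). \<integral>x. \<rho> x $$ (i, j) * \<sigma> (inv x) $$ (k, l) \<partial>\<mu>)"
  assumes y: "y \<in> carrier G"
  shows "P * \<sigma> y = \<rho> y * P"
proof (rule eq_matI)
  have P: "P \<in> carrier_mat d e" by (simp add: P_def)
  note R = matrix_repD[OF \<rho> y] and S = matrix_repD[OF \<sigma> y]
  fix i l assume "i < dim_row (\<rho> y * P)" "l < dim_col (\<rho> y * P)"
  then have il: "i < d" "l < e" using R P by auto
  have c\<sigma>: "cts (\<lambda>x. \<sigma> (inv x) $$ (k, m))" if "m < e" for m
    by (intro cts_inverse_arg[where u = "\<lambda>x. \<sigma> x $$ (k, m)"] cts_matrix_rep[OF \<sigma>] jk that)
  have c\<rho>: "cts (\<lambda>x. \<rho> x $$ (m, j))" if "m < d" for m by (intro cts_matrix_rep[OF \<rho>] jk that)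
  have cc: "cts (\<lambda>x. \<rho> x $$ (i, j) * \<sigma> (inv x \<otimes> y) $$ (k, l))"
  proof (intro continuous_intros c\<rho> il)
    show "cts (\<lambda>x. \<sigma> (inv x \<otimes> y) $$ (k, l))"
      using y by (intro cts_compose[OF cts_matrix_rep[OF \<sigma> jk(2) il(2)]]
          cts_mult cts_inv continuous_intros) auto
  qed
  have "(\<rho> y * P) $$ (i, l) = (\<Sum>m<d. \<rho> y $$ (i, m) * (\<integral>x. \<rho> x $$ (m, j) * \<sigma> (inv x) $$ (k, l) \<partial>\<mu>))"
    using index_mat_mult_sum[OF R(1) P il] il by (simp add: P_def)
  also have "\<dots> = (\<integral>x. (\<Sum>m<d. \<rho> y $$ (i, m) * (\<rho> x $$ (m, j) * \<sigma> (inv x) $$ (k, l))) \<partial>\<mu>)"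
    by (subst integral_sum')
       (auto intro!: integrable_cts continuous_intros c\<rho> c\<sigma> il)
  also have "\<dots> = (\<integral>x. \<rho> (y \<otimes> x) $$ (i, j) * \<sigma> (inv (y \<otimes> x) \<otimes> y) $$ (k, l) \<partial>\<mu>)"
  proof (rule integral_cong_carrier)
    fix x assume x: "x \<in> carrier G"
    have "inv (y \<otimes> x) \<otimes> y = inv x" using x y by (simp add: inv_mult_group m_assoc)
    then show "(\<Sum>m<d. \<rho> y $$ (i, m) * (\<rho> x $$ (m, j) * \<sigma> (inv x) $$ (k, l))) = \<rho> (y \<otimes> x) $$ (i, j) * \<sigma> (inv (y \<otimes> x) \<otimes> y) $$ (k, l)"
      using matrix_rep_index[OF \<rho> y x il(1) jk(1)] by (simp add: sum_distrib_right mult.assoc)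
  qed
  also have "\<dots> = (\<integral>x. \<rho> x $$ (i, j) * \<sigma> (inv x \<otimes> y) $$ (k, l) \<partial>\<mu>)"
    by (rule integral_left_translate[OF y cc])
  also have "\<dots> = (\<integral>x. (\<Sum>m<e. (\<rho> x $$ (i, j) * \<sigma> (inv x) $$ (k, m)) * \<sigma> y $$ (m, l)) \<partial>\<mu>)"
    by (rule integral_cong_carrier)
       (use matrix_rep_index[OF \<sigma> _ y jk(2) il(2)] in \<open>simp add: sum_distrib_left mult.assoc\<close>)
  also have "\<dots> = (\<Sum>m<e. (\<integral>x. \<rho> x $$ (i, j) * \<sigma> (inv x) $$ (k, m) \<partial>\<mu>) * \<sigma> y $$ (m, l))"
    by (subst integral_sum')
       (auto intro!: integrable_cts continuous_intros c\<rho> c\<sigma> il)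
  also have "\<dots> = (P * \<sigma> y) $$ (i, l)"
    using index_mat_mult_sum[OF P S(1) il] il by (simp add: P_def)
  finally show "(P * \<sigma> y) $$ (i, l) = (\<rho> y * P) $$ (i, l)" by simp
qed (use matrix_repD[OF \<rho> y] matrix_repD[OF \<sigma> y] in \<open>auto simp: P_def\<close>)

text \<open>The average of every matrix unit intertwines two nonisomorphic irreducibles and hence is
  zero. The argument \<open>inv x\<close> stands where a unitary representation would have a
  conjugate.\<close>

lemma Schur_orthogonality_nonisomorphic:
  assumes \<rho>: "irreducible_rep G d \<rho>" and \<sigma>: "irreducible_rep G e \<sigma>" and ni: "\<not> rep_isomorphic G \<sigma> \<rho>"
    and ij: "i < d" "j < d" and kl: "k < e" "l < e"
  shows "(\<integral>x. \<rho> x $$ (i, j) * \<sigma> (inv x) $$ (k, l) \<partial>\<mu>) = 0"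
proof -
  note r = irrep_matrix_rep[OF \<rho>] and s = irrep_matrix_rep[OF \<sigma>]
  define P where "P = Matrix.mat d e (\<lambda>(i, l). \<integral>x. \<rho> x $$ (i, j) * \<sigma> (inv x) $$ (k, l) \<partial>\<mu>)"
  have P: "P \<in> carrier_mat d e" by (simp add: P_def)
  have comm: "P * \<sigma> y = \<rho> y * P" if "y \<in> carrier G" for y
    unfolding P_def by (rule Schur_average[OF r s ij(2) kl(1) that])
  have "P = 0\<^sub>m d e"
  proof (rule ccontr)
    assume "P \<noteq> 0\<^sub>m d e"
    then have "invertible_mat P" using Schur_intertwiner(2)[OF \<sigma> \<rho> P comm] by blast
    then have "rep_isomorphic G \<sigma> \<rho>"
      unfolding rep_isomorphic_def rep_dim_eq[OF r] rep_dim_eq[OF s] using P comm by blast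
    then show False using ni by simp
  qed
  then have "P $$ (i, l) = 0" using ij kl by simp
  then show ?thesis using ij kl by (simp add: P_def)
qed

text \<open>The average is a scalar \<open>c\<close> times the identity, and its trace determines
  \<open>c\<close>: under the trace the two factors combine to the entry \<open>(k, j)\<close> of
  \<open>\<rho> (inv x \<otimes> x)\<close>, the identity matrix.\<close>

lemma Schur_orthogonality:
  assumes \<rho>: "irreducible_rep G d \<rho>" and ij: "i < d" "j < d" and kl: "k < d" "l < d"
  shows "(\<integral>x. \<rho> x $$ (i, j) * \<rho> (inv x) $$ (k, l) \<partial>\<mu>) = (if i = l \<and> j = k then of_real vol / of_nat d else 0)"
proof -
  interpret finite_measure \<mu> by (rule finite_\<mu>)
  note r = irrep_matrix_rep[OF \<rho>]
  define P where "P = Matrix.mat d d (\<lambda>(i, l). \<integral>x. \<rho> x $$ (i, j) * \<rho> (inv x) $$ (k, l) \<partial>\<mu>)"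
  have P: "P \<in> carrier_mat d d" by (simp add: P_def)
  have comm: "P * \<rho> y = \<rho> y * P" if "y \<in> carrier G" for y
    unfolding P_def by (rule Schur_average[OF r r ij(2) kl(1) that])
  obtain c where c: "P = c \<cdot>\<^sub>m 1\<^sub>m d" using Schur_scalar[OF \<rho> P comm] by blast
  have c\<rho>: "cts (\<lambda>x. \<rho> (inv x) $$ (k, m))" "cts (\<lambda>x. \<rho> x $$ (m, j))" if "m < d" for m
    by (intro cts_inverse_arg[where u = "\<lambda>x. \<rho> x $$ (k, m)"] cts_matrix_rep[OF r] kl that)
       (intro cts_matrix_rep[OF r] ij that)
  have "of_nat d * c = (\<Sum>i<d. P $$ (i, i))" by (simp add: c)
  also have "\<dots> = (\<integral>x. (\<Sum>i<d. \<rho> x $$ (i, j) * \<rho> (inv x) $$ (k, i)) \<partial>\<mu>)"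
    by (subst integral_sum')
       (auto simp: P_def intro!: integrable_cts continuous_intros c\<rho>)
  also have "\<dots> = (\<integral>x. (if j = k then 1 else 0) \<partial>\<mu>)"
  proof (rule integral_cong_carrier)
    fix x assume x: "x \<in> carrier G"
    have "(\<Sum>i<d. \<rho> (inv x) $$ (k, i) * \<rho> x $$ (i, j)) = \<rho> (inv x \<otimes> x) $$ (k, j)"
      using matrix_rep_index[OF r inv_closed[OF x] x kl(1) ij(2)] by simp
    also have "\<dots> = (if j = k then 1 else 0)" using x kl ij matrix_rep_one[OF r] by simp
    finally show "(\<Sum>i<d. \<rho> x $$ (i, j) * \<rho> (inv x) $$ (k, i)) = (if j = k then 1 else 0)"
      by (simp add: mult.commute)
  qed
  also have "\<dots> = (if j = k then of_real vol else 0)"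
    by (simp add: measure_space_\<mu> of_real_def)
  finally have "c = (if j = k then of_real vol / of_nat d else 0)"
    using ij by (auto simp: field_simps)
  moreover have "(\<integral>x. \<rho> x $$ (i, j) * \<rho> (inv x) $$ (k, l) \<partial>\<mu>) = P $$ (i, l)" using ij kl by (simp add: P_def)
  ultimately show ?thesis using ij kl by (simp add: c)
qed

lemma integral_character_matrix_rep:
  assumes \<rho>: "irreducible_rep G d \<rho>" and ij: "i < d" "j < d"
  shows "(\<integral>x. character G \<rho> (inv x) * \<rho> x $$ (i, j) \<partial>\<mu>) = (if i = j then of_real vol / of_nat d else 0)"
    and "irreducible_rep G e \<sigma> \<Longrightarrow> \<not> rep_isomorphic G \<sigma> \<rho> \<Longrightarrow> (\<integral>x. character G \<sigma> (inv x) * \<rho> x $$ (i, j) \<partial>\<mu>) = 0"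
proof -
  note r = irrep_matrix_rep[OF \<rho>]
  have expand: "(\<integral>x. character G \<tau> (inv x) * \<rho> x $$ (i, j) \<partial>\<mu>) = (\<Sum>k<f. (\<integral>x. \<rho> x $$ (i, j) * \<tau> (inv x) $$ (k, k) \<partial>\<mu>))"
    if t: "matrix_rep G f \<tau>" for \<tau> f
  proof -
    have "cts (\<lambda>x. \<tau> (inv x) $$ (k, k))" if "k < f" for k
      by (intro cts_inverse_arg[where u = "\<lambda>x. \<tau> x $$ (k, k)"] cts_matrix_rep[OF t] that)
    then show ?thesis
      unfolding character_def rep_dim_eq[OF t] sum_distrib_right
      by (subst integral_sum')
         (auto intro!: integrable_cts continuous_intros cts_matrix_rep[OF r] ij simp: mult.commute)
  qed
  have "(\<Sum>k<d. (\<integral>x. \<rho> x $$ (i, j) * \<rho> (inv x) $$ (k, k) \<partial>\<mu>)) = (\<Sum>k<d. if k = j then (if i = j then of_real vol / of_nat d else 0) else 0)"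
    using ij by (intro sum.cong refl) (simp add: Schur_orthogonality[OF \<rho>])
  then show "(\<integral>x. character G \<rho> (inv x) * \<rho> x $$ (i, j) \<partial>\<mu>) = (if i = j then of_real vol / of_nat d else 0)"
    unfolding expand[OF r] using ij by simp
  show "(\<integral>x. character G \<sigma> (inv x) * \<rho> x $$ (i, j) \<partial>\<mu>) = 0"
    if \<sigma>: "irreducible_rep G e \<sigma>" and ni: "\<not> rep_isomorphic G \<sigma> \<rho>"
    unfolding expand[OF irrep_matrix_rep[OF \<sigma>]]
    using Schur_orthogonality_nonisomorphic[OF \<rho> \<sigma> ni ij] by simp
qed

text \<open>Pairing with the entry \<open>(0, 0)\<close> of \<open>\<rho>\<close> separates
  nonisomorphic characters, with values \<open>0\<close> and \<open>vol / d\<close>. As equality of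
  functions is visibly an equivalence relation, so is isomorphism of irreducibles.\<close>

lemma rep_isomorphic_iff_character_eq:
  assumes \<sigma>: "irreducible_rep G e \<sigma>" and \<rho>: "irreducible_rep G d \<rho>"
  shows "rep_isomorphic G \<sigma> \<rho> \<longleftrightarrow> (\<forall>x\<in>carrier G. character G \<sigma> x = character G \<rho> x)"
proof
  show "\<forall>x\<in>carrier G. character G \<sigma> x = character G \<rho> x" if "rep_isomorphic G \<sigma> \<rho>"
    using character_isomorphic(2)[OF irrep_matrix_rep[OF \<sigma>] irrep_matrix_rep[OF \<rho>] that] by blast
  assume eq: "\<forall>x\<in>carrier G. character G \<sigma> x = character G \<rho> x"
  show "rep_isomorphic G \<sigma> \<rho>"
  proof (rule ccontr)
    assume ni: "\<not> rep_isomorphic G \<sigma> \<rho>"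
    have d: "0 < d" using \<rho> by (simp add: irreducible_rep_def)
    have "(\<integral>x. character G \<sigma> (inv x) * \<rho> x $$ (0, 0) \<partial>\<mu>) = (\<integral>x. character G \<rho> (inv x) * \<rho> x $$ (0, 0) \<partial>\<mu>)"
      using eq by (intro integral_cong_carrier) simp
    then show False
      using integral_character_matrix_rep(1)[OF \<rho> d d] integral_character_matrix_rep(2)[OF \<rho> d d \<sigma> ni] d vol_pos by simp
  qed
qed

text \<open>The powers of \<open>x\<close> stay in the compact group, so the entries of their
  matrices are bounded. On an eigenvector these matrices act by \<open>a ^ k\<close>, which must
  then stay bounded too.\<close>

lemma eigenvalue_matrix_rep_norm_le_1:
  assumes \<rho>: "matrix_rep G d \<rho>" and x: "x \<in> carrier G" and a: "eigenvalue (\<rho> x) a"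
  shows "cmod a \<le> 1"
proof -
  obtain v where v: "v \<in> carrier_vec d" "v \<noteq> 0\<^sub>v d" "\<rho> x *\<^sub>v v = a \<cdot>\<^sub>v v"
    using a matrix_repD[OF \<rho> x] by (auto simp: eigenvalue_def eigenvector_def)
  have "\<exists>i<d. vec_index v i \<noteq> 0"
  proof (rule ccontr)
    assume "\<not> (\<exists>i<d. vec_index v i \<noteq> 0)"
    then have "v = 0\<^sub>v d" using v(1) by (intro eq_vecI) auto
    then show False using v(2) by simp
  qed
  then obtain i where i: "i < d" "vec_index v i \<noteq> 0" by blast
  have pow: "\<rho> (x [^] k) *\<^sub>v v = (a ^ k) \<cdot>\<^sub>v v" for k :: nat
  proof (induction k)
    case 0
    then show ?case using v(1) matrix_rep_one[OF \<rho>] by simp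
  next
    case (Suc k)
    have xk: "x [^] k \<in> carrier G" using x by simp
    have "\<rho> (x [^] Suc k) *\<^sub>v v = \<rho> (x [^] k) *\<^sub>v (\<rho> x *\<^sub>v v)"
      using matrix_rep_mult[OF \<rho> xk x]
        assoc_mult_mat_vec[OF matrix_repD(1)[OF \<rho> xk] matrix_repD(1)[OF \<rho> x] v(1)] by simp
    also have "\<dots> = a \<cdot>\<^sub>v (\<rho> (x [^] k) *\<^sub>v v)"
      unfolding v(3) using matrix_repD(1)[OF \<rho> xk] v(1) by (intro mult_mat_vec)
    finally show ?case by (simp add: Suc smult_smult_assoc)
  qed
  have "\<forall>j<d. \<exists>B. \<forall>y\<in>carrier G. cmod (\<rho> y $$ (i, j)) \<le> B"
    using cts_bounded[OF cts_matrix_rep[OF \<rho> i(1)]] by metis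
  then obtain B where B: "\<And>j y. j < d \<Longrightarrow> y \<in> carrier G \<Longrightarrow> cmod (\<rho> y $$ (i, j)) \<le> B j" by metis
  \<comment> \<open>The relation is read in one coordinate \<open>i\<close> where \<open>v\<close>
    is nonzero; dividing by that entry bounds all powers of \<open>cmod a\<close> by the same
    \<open>M\<close>.\<close>
  define M where "M = (\<Sum>j<d. B j * cmod (vec_index v j)) / cmod (vec_index v i)"
  have bound: "cmod a ^ k \<le> M" for k
  proof -
    have xk: "x [^] k \<in> carrier G" using x by simp
    have "a ^ k * vec_index v i = (\<Sum>j<d. \<rho> (x [^] k) $$ (i, j) * vec_index v j)"
      using arg_cong[OF pow[of k], of "\<lambda>w. vec_index w i"] i v(1)
        index_mult_mat_vec_sum[OF matrix_repD(1)[OF \<rho> xk] v(1) i(1)] by simp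
    then have "cmod a ^ k * cmod (vec_index v i) = cmod (\<Sum>j<d. \<rho> (x [^] k) $$ (i, j) * vec_index v j)"
      by (metis norm_mult norm_power)
    also have "\<dots> \<le> (\<Sum>j<d. B j * cmod (vec_index v j))"
      using B xk by (intro sum_norm_le) (auto simp: norm_mult intro!: mult_right_mono)
    finally show ?thesis using i(2) by (simp add: M_def field_simps)
  qed
  show ?thesis
  proof (rule ccontr)
    assume "\<not> cmod a \<le> 1"
    then obtain k where "M < cmod a ^ k" using real_arch_pow[of "cmod a" M] by auto
    then show False using bound[of k] by simp
  qed
qed

text \<open>After triangularisation the trace is a sum of \<open>d\<close> eigenvalues of
  \<open>\<rho> x\<close>, each in the closed unit disc.\<close>

lemma character_norm_le:
  assumes \<rho>: "matrix_rep G d \<rho>" and x: "x \<in> carrier G"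
  shows "cmod (character G \<rho> x) \<le> d"
proof -
  have A: "\<rho> x \<in> carrier_mat d d" by (rule matrix_repD(1)[OF \<rho> x])
  obtain es where "char_poly (\<rho> x) = (\<Prod>a\<leftarrow>es. [:- a, 1:])"
    using char_poly_factorized[OF A] by blast
  then obtain B where B: "B \<in> carrier_mat d d" "upper_triangular B" "similar_mat (\<rho> x) B"
    using schur_decomposition_exists[OF A] by blast
  obtain P Q where PQ: "similar_mat_wit (\<rho> x) B P Q" using B(3) unfolding similar_mat_def by blast
  have eig: "eigenvalue (\<rho> x) (B $$ (i, i))" if i: "i < d" for i
  proof -
    have "char_poly (\<rho> x) = (\<Prod>a\<leftarrow>diag_mat B. [:- a, 1:])"
      using char_poly_similar[OF B(3)] char_poly_upper_triangular[OF B(1,2)] by simp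
    moreover have "B $$ (i, i) \<in> set (diag_mat B)" using B(1) i by (auto simp: diag_mat_def)
    ultimately have "poly (char_poly (\<rho> x)) (B $$ (i, i)) = 0"
      by (auto simp: poly_prod_list prod_list_zero_iff)
    then show ?thesis using eigenvalue_root_char_poly[OF A] by simp
  qed
  have w: "P \<in> carrier_mat d d" "Q \<in> carrier_mat d d" "Q * P = 1\<^sub>m d" "\<rho> x = P * B * Q"
    using PQ A unfolding similar_mat_wit_def Let_def by auto
  have "character G \<rho> x = (\<Sum>i<d. (P * (B * Q)) $$ (i, i))"
    using w(4) assoc_mult_mat[OF w(1) B(1) w(2)] by (simp add: character_def rep_dim_eq[OF \<rho>])
  also have "\<dots> = (\<Sum>i<d. ((B * Q) * P) $$ (i, i))"
    by (rule diag_sum_commute[OF w(1)]) (use B(1) w in simp)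
  also have "(B * Q) * P = B" using assoc_mult_mat[OF B(1) w(2) w(1)] w(3) B(1) by simp
  finally have "character G \<rho> x = (\<Sum>i<d. B $$ (i, i))" .
  then have "cmod (character G \<rho> x) \<le> (\<Sum>i<d. 1)"
    using eigenvalue_matrix_rep_norm_le_1[OF \<rho> x eig] by (simp only:) (rule sum_norm_le, simp)
  then show ?thesis by simp
qed

end

section \<open>Integrals over the representation variety\<close>

context haar_group
begin

lemma measurable_mult_carrier:
  assumes "f \<in> N \<rightarrow>\<^sub>M \<mu>" "h \<in> N \<rightarrow>\<^sub>M \<mu>"
  shows "(\<lambda>z. f z \<otimes> h z) \<in> N \<rightarrow>\<^sub>M \<mu>"
proof -
  have "(\<lambda>p. fst p \<otimes> snd p) \<in> \<mu> \<Otimes>\<^sub>M \<mu> \<rightarrow>\<^sub>M \<mu>"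
    unfolding measurable_cong_sets[OF refl sets_\<mu>]
    using pair_cts_measurable[OF borel_\<mu> borel_\<mu> continuous_mult]
    by (intro measurable_restrict_space2) (auto simp: space_pair_measure space_\<mu>)
  from measurable_compose[OF measurable_Pair[OF assms] this] show ?thesis by simp
qed

lemma measurable_inv_carrier:
  assumes "f \<in> N \<rightarrow>\<^sub>M \<mu>"
  shows "(\<lambda>z. inv (f z)) \<in> N \<rightarrow>\<^sub>M \<mu>"
proof -
  have "(\<lambda>x. inv x) \<in> \<mu> \<rightarrow>\<^sub>M \<mu>"
    unfolding measurable_cong_sets[OF refl sets_\<mu>]
    using cts_measurable[OF borel_\<mu> continuous_inv]
    by (intro measurable_restrict_space2) (auto simp: space_\<mu>)
  from measurable_compose[OF assms this] show ?thesis .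
qed

text \<open>The index set is left arbitrary so that the induction can keep one product of
  coordinates fixed while \<open>g\<close> decreases.\<close>

lemma measurable_presentation_map:
  "{..<2 * g} \<subseteq> I \<Longrightarrow> presentation_map G g \<in> PiM I (\<lambda>_. \<mu>) \<rightarrow>\<^sub>M \<mu>"
proof (induction g)
  case 0
  then show ?case by (simp add: space_\<mu>)
next
  case (Suc g)
  have c: "(\<lambda>z. z i) \<in> PiM I (\<lambda>_. \<mu>) \<rightarrow>\<^sub>M \<mu>" if "i \<in> I" for i
    by (rule measurable_component_singleton[OF that])
  have i: "2 * g \<in> I" "2 * g + 1 \<in> I" using Suc.prems by auto
  have "{..<2 * g} \<subseteq> I" using Suc.prems by auto
  then have "presentation_map G g \<in> PiM I (\<lambda>_. \<mu>) \<rightarrow>\<^sub>M \<mu>" by (rule Suc.IH)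
  then show ?case
    unfolding presentation_map.simps group_commutator_def
    by (intro measurable_mult_carrier measurable_inv_carrier c i)
qed

lemma presentation_map_cong:
  "(\<And>i. i < 2 * g \<Longrightarrow> z i = z' i) \<Longrightarrow> presentation_map G g z = presentation_map G g z'"
  by (induction g) auto

lemma finite_measure_PiM:
  assumes "finite I" shows "finite_measure (PiM I (\<lambda>_. \<mu>))"
proof (rule finite_measureI)
  interpret finite_measure \<mu> by (rule finite_\<mu>)
  interpret product_sigma_finite "\<lambda>_::'i. \<mu>" by unfold_locales
  have "emeasure (PiM I (\<lambda>_. \<mu>)) (space (PiM I (\<lambda>_. \<mu>))) = (\<Prod>i\<in>I. emeasure \<mu> (space \<mu>))"
    unfolding space_PiM using assms by (intro emeasure_PiM) auto
  also have "\<dots> = ennreal (vol ^ card I)"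
    using sqnorm_nonneg vol_pos by (simp add: emeasure_eq_measure measure_space_\<mu> ennreal_power)
  finally show "emeasure (PiM I (\<lambda>_. \<mu>)) (space (PiM I (\<lambda>_. \<mu>))) \<noteq> \<infinity>" by simp
qed

text \<open>Integrates out the two coordinates of one handle. The bound gives integrability over the
  full product and again after the inner integration.\<close>

lemma integral_PiM_insert2:
  fixes f :: "('i \<Rightarrow> 'a) \<Rightarrow> complex"
  assumes I: "finite I" "i \<notin> I" "j \<notin> I" "i \<noteq> j"
    and f: "f \<in> borel_measurable (PiM (insert j (insert i I)) (\<lambda>_. \<mu>))"
    and bound: "\<And>z. z \<in> space (PiM (insert j (insert i I)) (\<lambda>_. \<mu>)) \<Longrightarrow> cmod (f z) \<le> B" and B: "B \<ge> 0"
  shows "(\<integral>z. f z \<partial>PiM (insert j (insert i I)) (\<lambda>_. \<mu>))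
    = (\<integral>z. (\<integral>x. (\<integral>y. f (z(i := x, j := y)) \<partial>\<mu>) \<partial>\<mu>) \<partial>PiM I (\<lambda>_. \<mu>))"
proof -
  interpret finite_measure \<mu> by (rule finite_\<mu>)
  interpret product_sigma_finite "\<lambda>_::'i. \<mu>" by unfold_locales
  let ?P = "\<lambda>I. PiM I (\<lambda>_::'i. \<mu>)"
  interpret P1: finite_measure "?P (insert j (insert i I))" by (rule finite_measure_PiM) (use I in simp)
  interpret P2: finite_measure "?P (insert i I)" by (rule finite_measure_PiM) (use I in simp)
  have "integrable (?P (insert j (insert i I))) f"
    by (rule P1.integrable_const_bound[OF AE_I2[OF bound] f])
  then have "(\<integral>z. f z \<partial>?P (insert j (insert i I))) = (\<integral>z. (\<integral>y. f (z(j := y)) \<partial>\<mu>) \<partial>?P (insert i I))"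
    using I by (intro product_integral_insert) auto
  also have "\<dots> = (\<integral>z. (\<integral>x. (\<integral>y. f ((z(i := x))(j := y)) \<partial>\<mu>) \<partial>\<mu>) \<partial>?P I)"
  proof (rule product_integral_insert[OF I(1,2)], rule P2.integrable_const_bound[OF AE_I2])
    have "(\<lambda>(z, y). z(j := y)) \<in> ?P (insert i I) \<Otimes>\<^sub>M \<mu> \<rightarrow>\<^sub>M ?P (insert j (insert i I))"
      by (rule measurable_add_dim)
    from measurable_compose[OF this f]
    show "(\<lambda>z. \<integral>y. f (z(j := y)) \<partial>\<mu>) \<in> borel_measurable (?P (insert i I))"
      by (intro borel_measurable_lebesgue_integral) (simp add: case_prod_unfold)
    fix z assume z: "z \<in> space (?P (insert i I))"
    show "cmod (\<integral>y. f (z(j := y)) \<partial>\<mu>) \<le> B * measure \<mu> (space \<mu>)"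
    proof (rule norm_integral_bound[OF borel_\<mu> bound B])
      fix y assume "y \<in> carrier G"
      then show "z(j := y) \<in> space (?P (insert j (insert i I)))"
        using z by (auto simp: space_PiM space_\<mu> PiE_def extensional_def)
    qed
  qed
  finally show ?thesis by simp
qed

text \<open>Write \<open>v = vol / d\<close>. Integration over \<open>y\<close> averages the
  conjugates of \<open>\<rho> (inv x)\<close> to \<open>v\<close> times its trace. What remains is
  \<open>v\<close> times the trace of \<open>\<rho> (inv x)\<close> times \<open>\<rho> x\<close>,
  whose integral over \<open>x\<close> brings a second factor \<open>v\<close>.\<close>

lemma integral_matrix_rep_commutator:
  assumes \<rho>: "irreducible_rep G d \<rho>" and ij: "i < d" "j < d"
  shows "(\<integral>x. (\<integral>y. \<rho> (group_commutator G x y) $$ (i, j) \<partial>\<mu>) \<partial>\<mu>) = (if i = j then (of_real vol / of_nat d)\<^sup>2 else 0)"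
proof -
  note r = irrep_matrix_rep[OF \<rho>]
  define v :: complex where "v = of_real vol / of_nat d"
  have c: "cts (\<lambda>y. \<rho> y $$ (a, b))" "cts (\<lambda>y. \<rho> (inv y) $$ (a, b))" if "a < d" "b < d" for a b
    by (intro cts_matrix_rep[OF r] that)
       (intro cts_inverse_arg[where u = "\<lambda>x. \<rho> x $$ (a, b)"] cts_matrix_rep[OF r] that)
  have inner: "(\<integral>y. \<rho> (group_commutator G x y) $$ (i, j) \<partial>\<mu>) = (\<Sum>b<d. v * (\<rho> x $$ (i, j) * \<rho> (inv x) $$ (b, b)))"
    if x: "x \<in> carrier G" for x
  proof -
    have "(\<integral>y. \<rho> (group_commutator G x y) $$ (i, j) \<partial>\<mu>)
      = (\<integral>y. (\<Sum>c<d. \<Sum>b<d. \<Sum>a<d. \<rho> x $$ (i, a) * \<rho> (inv x) $$ (b, c) * (\<rho> y $$ (a, b) * \<rho> (inv y) $$ (c, j))) \<partial>\<mu>)"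
      by (rule integral_cong_carrier)
         (use x ij in \<open>simp add: group_commutator_def matrix_rep_index[OF r] sum_distrib_right sum_distrib_left mult_ac\<close>)
    also have "\<dots> = (\<Sum>c<d. \<Sum>b<d. \<Sum>a<d. \<rho> x $$ (i, a) * \<rho> (inv x) $$ (b, c) * (\<integral>y. \<rho> y $$ (a, b) * \<rho> (inv y) $$ (c, j) \<partial>\<mu>))"
      by (rule trans[OF integral_sum' sum.cong[OF refl]],
          (intro integrable_cts continuous_intros c; use ij in simp))+ simp
    also have "\<dots> = (\<Sum>c<d. \<Sum>b<d. \<Sum>a<d. if a = j then (if b = c then v * (\<rho> x $$ (i, a) * \<rho> (inv x) $$ (b, c)) else 0) else 0)"
      using ij by (intro sum.cong refl) (simp add: Schur_orthogonality[OF \<rho>] v_def)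
    also have "\<dots> = (\<Sum>b<d. v * (\<rho> x $$ (i, j) * \<rho> (inv x) $$ (b, b)))"
      using ij by simp
    finally show ?thesis .
  qed
  have "(\<integral>x. (\<integral>y. \<rho> (group_commutator G x y) $$ (i, j) \<partial>\<mu>) \<partial>\<mu>) = (\<integral>x. (\<Sum>b<d. v * (\<rho> x $$ (i, j) * \<rho> (inv x) $$ (b, b))) \<partial>\<mu>)"
    by (rule integral_cong_carrier) (rule inner)
  also have "\<dots> = (\<Sum>b<d. v * (\<integral>x. \<rho> x $$ (i, j) * \<rho> (inv x) $$ (b, b) \<partial>\<mu>))"
    by (subst integral_sum') (auto intro!: integrable_cts continuous_intros c ij)
  also have "\<dots> = (\<Sum>b<d. if b = j then (if i = b then v\<^sup>2 else 0) else 0)"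
    using ij by (intro sum.cong refl) (simp add: Schur_orthogonality[OF \<rho>] v_def power2_eq_square)
  finally show ?thesis using ij by (simp add: v_def)
qed

text \<open>Induction on the handles: the last commutator averages to a scalar matrix, so it
  multiplies the integral over the remaining coordinates by \<open>(vol / d)^2\<close>.\<close>

lemma integral_matrix_rep_presentation_map:
  assumes \<rho>: "irreducible_rep G d \<rho>" and ij: "i < d" "j < d"
  shows "(\<integral>z. \<rho> (presentation_map G g z) $$ (i, j) \<partial>PiM {..<2 * g} (\<lambda>_. \<mu>)) = (if i = j then (of_real vol / of_nat d) ^ (2 * g) else 0)"
  using ij
proof (induction g arbitrary: i j)
  case 0
  interpret finite_measure \<mu> by (rule finite_\<mu>)
  interpret product_sigma_finite "\<lambda>_::nat. \<mu>" by unfold_locales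
  \<comment> \<open>The product over no coordinates is a single point of mass one, in agreement with
    the exponent zero.\<close>
  have "emeasure (PiM {} (\<lambda>_::nat. \<mu>)) (space (PiM {} (\<lambda>_. \<mu>))) = 1"
    unfolding space_PiM using emeasure_PiM[of "{}" "\<lambda>_. {}"] by simp
  then have "measure (PiM {} (\<lambda>_::nat. \<mu>)) (space (PiM {} (\<lambda>_. \<mu>))) = 1"
    by (simp add: measure_def)
  then show ?case
    using 0 matrix_rep_one[OF irrep_matrix_rep[OF \<rho>]] by (simp add: of_real_def)
next
  case (Suc g)
  note r = irrep_matrix_rep[OF \<rho>] and ij = Suc.prems
  interpret finite_measure \<mu> by (rule finite_\<mu>)
  interpret product_sigma_finite "\<lambda>_::nat. \<mu>" by unfold_locales
  define v :: complex where "v = of_real vol / of_nat d"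
  let ?I = "{..<2 * g}"
  let ?P = "\<lambda>I. PiM I (\<lambda>_::nat. \<mu>)"
  have I: "{..<2 * Suc g} = insert (2 * g + 1) (insert (2 * g) ?I)" by auto
  have m: "(\<lambda>z. \<rho> (presentation_map G (Suc g) z) $$ (i, j)) \<in> borel_measurable (?P {..<2 * Suc g})"
    by (rule measurable_compose[OF measurable_presentation_map[OF order_refl]
          cts_measurable[OF borel_\<mu> cts_matrix_rep[OF r ij]]])
  obtain B where B: "B > 0" "\<And>x. x \<in> carrier G \<Longrightarrow> cmod (\<rho> x $$ (i, j)) \<le> B"
    using cts_bounded[OF cts_matrix_rep[OF r ij]] by metis
  have bd: "cmod (\<rho> (presentation_map G (Suc g) z) $$ (i, j)) \<le> B" if "z \<in> space (?P {..<2 * Suc g})" for z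
    using measurable_space[OF measurable_presentation_map[OF order_refl] that] B(2) by (simp add: space_\<mu>)
  let ?f = "\<lambda>z. \<rho> (presentation_map G (Suc g) z) $$ (i, j)"
  have inner: "(\<integral>x. (\<integral>y. ?f (z(2 * g := x, 2 * g + 1 := y)) \<partial>\<mu>) \<partial>\<mu>) = \<rho> (presentation_map G g z) $$ (i, j) * v\<^sup>2"
    if z: "z \<in> space (?P ?I)" for z
  proof -
    define p where "p = presentation_map G g z"
    have p: "p \<in> carrier G"
      using measurable_space[OF measurable_presentation_map[OF order_refl] z] by (simp add: p_def space_\<mu>)
    have cc: "cts2 (\<lambda>w. \<rho> (group_commutator G (fst w) (snd w)) $$ (l, j))" if "l < d" for l
      unfolding group_commutator_def
      by (rule cts_compose[OF cts_matrix_rep[OF r that ij(2)]])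
         (auto intro!: cts_mult cts_inv continuous_intros)
    have cx: "cts (\<lambda>y. \<rho> (group_commutator G x y) $$ (l, j))" if "l < d" "x \<in> carrier G" for l x
      unfolding group_commutator_def
      by (rule cts_compose[OF cts_matrix_rep[OF r that(1) ij(2)]])
         (use that(2) in \<open>auto intro!: cts_mult cts_inv continuous_intros\<close>)
    have "(\<integral>x. (\<integral>y. ?f (z(2 * g := x, 2 * g + 1 := y)) \<partial>\<mu>) \<partial>\<mu>) = (\<integral>x. (\<Sum>l<d. \<rho> p $$ (i, l) * (\<integral>y. \<rho> (group_commutator G x y) $$ (l, j) \<partial>\<mu>)) \<partial>\<mu>)"
    proof (rule integral_cong_carrier)
      fix x assume x: "x \<in> carrier G"
      have "(\<integral>y. ?f (z(2 * g := x, 2 * g + 1 := y)) \<partial>\<mu>) = (\<integral>y. (\<Sum>l<d. \<rho> p $$ (i, l) * \<rho> (group_commutator G x y) $$ (l, j)) \<partial>\<mu>)"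
      proof (rule integral_cong_carrier)
        fix y assume y: "y \<in> carrier G"
        have "presentation_map G g (z(2 * g := x, 2 * g + 1 := y)) = p"
          unfolding p_def by (rule presentation_map_cong) auto
        then have "?f (z(2 * g := x, 2 * g + 1 := y)) = \<rho> (p \<otimes> group_commutator G x y) $$ (i, j)" by simp
        then show "?f (z(2 * g := x, 2 * g + 1 := y)) = (\<Sum>l<d. \<rho> p $$ (i, l) * \<rho> (group_commutator G x y) $$ (l, j))"
          using matrix_rep_index[OF r p _ ij] x y by (simp add: group_commutator_def)
      qed
      also have "\<dots> = (\<Sum>l<d. \<rho> p $$ (i, l) * (\<integral>y. \<rho> (group_commutator G x y) $$ (l, j) \<partial>\<mu>))"
        using x by (subst integral_sum') (auto intro!: integrable_cts continuous_intros cx)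
      finally show "(\<integral>y. ?f (z(2 * g := x, 2 * g + 1 := y)) \<partial>\<mu>) = (\<Sum>l<d. \<rho> p $$ (i, l) * (\<integral>y. \<rho> (group_commutator G x y) $$ (l, j) \<partial>\<mu>))" .
    qed
    also have "\<dots> = (\<Sum>l<d. \<rho> p $$ (i, l) * (\<integral>x. (\<integral>y. \<rho> (group_commutator G x y) $$ (l, j) \<partial>\<mu>) \<partial>\<mu>))"
      by (subst integral_sum')
         (auto intro!: integrable_cts continuous_intros cts_parametric_integral[OF borel_\<mu>] cc)
    also have "\<dots> = (\<Sum>l<d. if l = j then \<rho> p $$ (i, l) * v\<^sup>2 else 0)"
      using ij by (intro sum.cong refl) (simp add: integral_matrix_rep_commutator[OF \<rho>] v_def)
    also have "\<dots> = \<rho> p $$ (i, j) * v\<^sup>2" using ij by simp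
    finally show ?thesis by (simp add: p_def)
  qed
  have "(\<integral>z. ?f z \<partial>?P {..<2 * Suc g}) = (\<integral>z. (\<integral>x. (\<integral>y. ?f (z(2 * g := x, 2 * g + 1 := y)) \<partial>\<mu>) \<partial>\<mu>) \<partial>?P ?I)"
    using m bd B(1) unfolding I by (intro integral_PiM_insert2[where B = B]) auto
  also have "\<dots> = (\<integral>z. \<rho> (presentation_map G g z) $$ (i, j) * v\<^sup>2 \<partial>?P ?I)"
    by (rule integral_cong') (use inner in auto)
  also have "\<dots> = (if i = j then v ^ (2 * Suc g) else 0)"
    using Suc.IH[OF ij] by (simp add: v_def power2_eq_square)
  finally show ?case by (simp add: v_def)
qed

end

section \<open>The density of the volume distribution\<close>

context haar_group
begin

section \<open>Representatives of the isomorphism classes\<close>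

definition class_rep :: "('a \<Rightarrow> complex mat) set \<Rightarrow> 'a \<Rightarrow> complex mat" where
  "class_rep l = (SOME \<rho>. \<rho> \<in> l)"

abbreviation irrep_equiv :: "(('a \<Rightarrow> complex mat) \<times> ('a \<Rightarrow> complex mat)) set" where
  "irrep_equiv \<equiv> {(\<rho>, \<sigma>). \<rho> \<in> irreducible_reps G \<and> \<sigma> \<in> irreducible_reps G \<and> rep_isomorphic G \<rho> \<sigma>}"

lemma irreducible_repsD:
  assumes "\<rho> \<in> irreducible_reps G"
  shows "irreducible_rep G (rep_dim G \<rho>) \<rho>" "matrix_rep G (rep_dim G \<rho>) \<rho>"
  using assms rep_dim_eq[OF irrep_matrix_rep] irrep_matrix_rep
  unfolding irreducible_reps_def by fastforce+

lemma equiv_irrep_equiv: "equiv (irreducible_reps G) irrep_equiv"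
proof (rule equivI)
  note iso = rep_isomorphic_iff_character_eq[OF irreducible_repsD(1) irreducible_repsD(1)]
  show "irrep_equiv \<subseteq> irreducible_reps G \<times> irreducible_reps G" by auto
  show "refl_on (irreducible_reps G) irrep_equiv"
    by (auto simp: refl_on_def iso)
  show "sym irrep_equiv"
    by (auto simp: sym_def iso)
  show "trans irrep_equiv"
    by (auto simp: trans_def iso)
qed

lemma class_rep:
  assumes l: "l \<in> irrep_classes G"
  shows "class_rep l \<in> l" "irreducible_rep G (class_dim G l) (class_rep l)"
proof -
  have "l \<noteq> {}"
    using l in_quotient_imp_non_empty[OF equiv_irrep_equiv] by (simp add: irrep_classes_def)
  then show mem: "class_rep l \<in> l" unfolding class_rep_def by (simp add: some_in_eq)
  have sub: "l \<subseteq> irreducible_reps G"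
    using l in_quotient_imp_subset[OF equiv_irrep_equiv] by (simp add: irrep_classes_def)
  have dims: "rep_dim G \<sigma> = rep_dim G (class_rep l)" if "\<sigma> \<in> l" for \<sigma>
  proof -
    have "(\<sigma>, class_rep l) \<in> irrep_equiv"
      using in_quotient_imp_in_rel[OF equiv_irrep_equiv, of l \<sigma> "class_rep l"] l that mem
      by (simp add: irrep_classes_def)
    then have iso: "rep_isomorphic G \<sigma> (class_rep l)" by auto
    have "\<sigma> \<in> irreducible_reps G" "class_rep l \<in> irreducible_reps G" using sub that mem by auto
    then show ?thesis
      by (rule character_isomorphic(1)[OF irreducible_repsD(2) irreducible_repsD(2) iso])
  qed
  have "rep_dim G ` l = (\<lambda>_. rep_dim G (class_rep l)) ` l" by (rule image_cong[OF refl dims])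
  also have "\<dots> = {rep_dim G (class_rep l)}" using mem by auto
  finally have "rep_dim G ` l = {rep_dim G (class_rep l)}" .
  then have "class_dim G l = rep_dim G (class_rep l)" by (simp add: class_dim_def)
  moreover have "class_rep l \<in> irreducible_reps G" using mem sub by blast
  ultimately show "irreducible_rep G (class_dim G l) (class_rep l)"
    using irreducible_repsD(1)[of "class_rep l"] by simp
qed

text \<open>The class of \<open>\<rho>\<close> is the only one whose character can pair nontrivially
  with entries of \<open>\<rho>\<close>. Its chosen representative may differ from
  \<open>\<rho>\<close>, so only dimension and character are carried over.\<close>

lemma class_of_irreducible_rep:
  assumes \<rho>: "irreducible_rep G d \<rho>"
  obtains l where "l \<in> irrep_classes G" "class_dim G l = d"
    "\<And>x. x \<in> carrier G \<Longrightarrow> character G (class_rep l) x = character G \<rho> x"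
    "\<And>l'. l' \<in> irrep_classes G \<Longrightarrow> l' \<noteq> l \<Longrightarrow> \<not> rep_isomorphic G (class_rep l') \<rho>"
proof -
  have mem: "\<rho> \<in> irreducible_reps G" using \<rho> by (auto simp: irreducible_reps_def)
  define l where "l = irrep_equiv `` {\<rho>}"
  have l: "l \<in> irrep_classes G"
    unfolding l_def irrep_classes_def by (rule quotientI[OF mem])
  have iso: "rep_isomorphic G \<rho> (class_rep l)"
    using class_rep(1)[OF l] by (auto simp: l_def)
  note m = irrep_matrix_rep[OF \<rho>] irrep_matrix_rep[OF class_rep(2)[OF l]]
  have uniq: "l' = l" if l': "l' \<in> irrep_classes G" "rep_isomorphic G (class_rep l') \<rho>" for l'
  proof -
    have "class_rep l' \<in> irreducible_reps G"
      using class_rep(2)[OF l'(1)] by (auto simp: irreducible_reps_def)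
    then have "(class_rep l', \<rho>) \<in> irrep_equiv" using l'(2) mem by simp
    moreover have "\<rho> \<in> l" unfolding l_def using equiv_class_self[OF equiv_irrep_equiv mem] .
    ultimately show ?thesis
      using quotient_eqI[OF equiv_irrep_equiv, of l' l "class_rep l'" \<rho>] l l'(1) class_rep(1)[OF l'(1)]
      by (simp add: irrep_classes_def)
  qed
  show thesis
  proof (rule that[OF l])
    show "class_dim G l = d" using character_isomorphic(1)[OF m iso] by simp
    show "character G (class_rep l) x = character G \<rho> x" if "x \<in> carrier G" for x
      using character_isomorphic(2)[OF m iso that] by simp
    show "\<not> rep_isomorphic G (class_rep l') \<rho>" if "l' \<in> irrep_classes G" "l' \<noteq> l" for l'
      using uniq that by blast
  qed
qed

lemma cts_character:
  assumes "matrix_rep G d \<rho>" shows "cts (\<lambda>x. character G \<rho> (inv x))"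
proof (rule cts_inverse_arg)
  show "cts (character G \<rho>)"
    unfolding character_def[abs_def] rep_dim_eq[OF assms]
    by (intro continuous_intros cts_matrix_rep[OF assms]) auto
qed

text \<open>A convolution theorem: the coefficient matrix of the measure \<open>w M\<close>
  convolved with \<open>h\<close> is the product of the coefficient matrices of \<open>w M\<close>
  and of \<open>h\<close>. The weight \<open>w\<close> lets it serve both the push-forward, with
  weight \<open>1\<close>, and the density times Haar measure.\<close>

lemma convolution_matrix_rep:
  assumes M: "borel_finite M" and h: "cts h" and w: "cts w" and r: "matrix_rep G d \<rho>" and ij: "i < d" "j < d"
  shows "(\<integral>x. (\<integral>y. h (inv y \<otimes> x) * w y \<partial>M) * \<rho> x $$ (i, j) \<partial>\<mu>)
    = (\<Sum>l<d. (\<integral>y. w y * \<rho> y $$ (i, l) \<partial>M) * (\<integral>x. h x * \<rho> x $$ (l, j) \<partial>\<mu>))"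
proof -
  have ch: "cts2 (\<lambda>z. h (inv (snd z) \<otimes> fst z))"
    by (rule cts_compose[OF h])
       (auto intro!: cts_mult cts_inv continuous_intros)
  have c\<rho>: "cts (\<lambda>x. \<rho> x $$ (a, b))" if "a < d" "b < d" for a b by (rule cts_matrix_rep[OF r that])
  have "(\<integral>x. (\<integral>y. h (inv y \<otimes> x) * w y \<partial>M) * \<rho> x $$ (i, j) \<partial>\<mu>) = (\<integral>x. (\<integral>y. h (inv y \<otimes> x) * w y * \<rho> x $$ (i, j) \<partial>M) \<partial>\<mu>)"
    by simp
  also have "\<dots> = (\<integral>y. (\<integral>x. h (inv y \<otimes> x) * w y * \<rho> x $$ (i, j) \<partial>\<mu>) \<partial>M)"
    by (rule Fubini_cts[OF borel_\<mu> M])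
       (intro continuous_intros ch cts_fst cts_snd w c\<rho> ij)
  also have "\<dots> = (\<integral>y. (\<Sum>l<d. (w y * \<rho> y $$ (i, l)) * (\<integral>x. h x * \<rho> x $$ (l, j) \<partial>\<mu>)) \<partial>M)"
  proof (rule integral_cong'[OF refl])
    fix y assume "y \<in> space M"
    then have y: "y \<in> carrier G" using borel_finiteD(3)[OF M] by simp
    have c: "cts (\<lambda>x. h (inv y \<otimes> x) * w y * \<rho> x $$ (i, j))"
      using y by (intro continuous_intros cts_translate(3) h c\<rho> ij) auto
    have "(\<integral>x. h (inv y \<otimes> x) * w y * \<rho> x $$ (i, j) \<partial>\<mu>) = (\<integral>x. h (inv y \<otimes> (y \<otimes> x)) * w y * \<rho> (y \<otimes> x) $$ (i, j) \<partial>\<mu>)"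
      by (rule integral_left_translate[OF y c, symmetric])
    also have "\<dots> = (\<integral>x. (\<Sum>l<d. (w y * \<rho> y $$ (i, l)) * (h x * \<rho> x $$ (l, j))) \<partial>\<mu>)"
      by (rule integral_cong_carrier)
         (use y ij in \<open>simp add: matrix_rep_index[OF r] m_assoc[symmetric] sum_distrib_left mult_ac\<close>)
    also have "\<dots> = (\<Sum>l<d. (w y * \<rho> y $$ (i, l)) * (\<integral>x. h x * \<rho> x $$ (l, j) \<partial>\<mu>))"
      by (subst integral_sum') (auto intro!: integrable_cts continuous_intros h c\<rho> ij)
    finally show "(\<integral>x. h (inv y \<otimes> x) * w y * \<rho> x $$ (i, j) \<partial>\<mu>) = (\<Sum>l<d. (w y * \<rho> y $$ (i, l)) * (\<integral>x. h x * \<rho> x $$ (l, j) \<partial>\<mu>))" .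
  qed
  also have "\<dots> = (\<Sum>l<d. (\<integral>y. w y * \<rho> y $$ (i, l) \<partial>M) * (\<integral>x. h x * \<rho> x $$ (l, j) \<partial>\<mu>))"
    by (subst integral_sum')
       (auto intro!: cts_integrable[OF M] continuous_intros w c\<rho> ij)
  finally show ?thesis .
qed

text \<open>
  Convolving \<open>h\<close> with the difference of the two measures gives a continuous function that is
  orthogonal to all matrix coefficients.
\<close>

lemma integral_eq_density_if_matrix_coefficients_eq:
  assumes M: "borel_finite M" and F: "cts F" and h: "cts h"
    and eq: "\<And>d \<rho> i j. irreducible_rep G d \<rho> \<Longrightarrow> i < d \<Longrightarrow> j < d \<Longrightarrow>
      (\<integral>x. \<rho> x $$ (i, j) \<partial>M) = (\<integral>x. F x * \<rho> x $$ (i, j) \<partial>\<mu>)"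
  shows "(\<integral>x. h x \<partial>M) = (\<integral>x. h x * F x \<partial>\<mu>)"
proof -
  \<comment> \<open>Composing with the inverse makes the convolution at the identity integrate
    \<open>h (inv (inv y))\<close>, that is, \<open>h y\<close>.\<close>
  define k where "k = (\<lambda>x. h (inv x))"
  have k: "cts k" unfolding k_def by (rule cts_inverse_arg[OF h])
  have ck: "cts2 (\<lambda>z. k (inv (snd z) \<otimes> fst z))"
    by (rule cts_compose[OF k])
       (auto intro!: cts_mult cts_inv continuous_intros)
  \<comment> \<open>The factor \<open>1\<close> is the weight that fits \<open>M\<close> into
    \<open>convolution_matrix_rep\<close>.\<close>
  define u v where "u x = (\<integral>y. k (inv y \<otimes> x) * 1 \<partial>M)" and "v x = (\<integral>y. k (inv y \<otimes> x) * F y \<partial>\<mu>)" for x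
  have cu: "cts u" unfolding u_def
    by (intro cts_parametric_integral M continuous_intros ck)
  have cv: "cts v" unfolding v_def
    by (intro cts_parametric_integral borel_\<mu> continuous_intros ck cts_snd F)
  have "u \<one> - v \<one> = 0"
  proof (rule continuous_orthogonal_to_irreducibles_eq_0[OF continuous_on_diff[OF cu cv] _ one_closed])
    fix d \<rho> i j assume \<rho>: "irreducible_rep G d \<rho>" and ij: "i < d" "j < d"
    note r = irrep_matrix_rep[OF \<rho>]
    have "(\<integral>x. u x * \<rho> x $$ (i, j) \<partial>\<mu>) = (\<Sum>l<d. (\<integral>y. 1 * \<rho> y $$ (i, l) \<partial>M) * (\<integral>x. k x * \<rho> x $$ (l, j) \<partial>\<mu>))"
      unfolding u_def by (rule convolution_matrix_rep[OF M k continuous_on_const r ij])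
    also have "\<dots> = (\<Sum>l<d. (\<integral>y. F y * \<rho> y $$ (i, l) \<partial>\<mu>) * (\<integral>x. k x * \<rho> x $$ (l, j) \<partial>\<mu>))"
      using eq[OF \<rho> ij(1)] by (intro sum.cong) auto
    also have "\<dots> = (\<integral>x. v x * \<rho> x $$ (i, j) \<partial>\<mu>)"
      unfolding v_def by (rule convolution_matrix_rep[OF borel_\<mu> k F r ij, symmetric])
    finally have "(\<integral>x. u x * \<rho> x $$ (i, j) \<partial>\<mu>) = (\<integral>x. v x * \<rho> x $$ (i, j) \<partial>\<mu>)" .
    moreover have "integrable \<mu> (\<lambda>x. u x * \<rho> x $$ (i, j))" "integrable \<mu> (\<lambda>x. v x * \<rho> x $$ (i, j))"
      by (intro integrable_cts continuous_intros cu cv cts_matrix_rep[OF r] ij)+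
    ultimately show "(\<integral>x. (u x - v x) * \<rho> x $$ (i, j) \<partial>\<mu>) = 0"
      by (simp add: left_diff_distrib)
  qed
  moreover have "u \<one> = (\<integral>x. h x \<partial>M)"
    unfolding u_def k_def by (rule integral_cong') (auto simp: borel_finiteD(3)[OF M])
  moreover have "v \<one> = (\<integral>x. h x * F x \<partial>\<mu>)"
    unfolding v_def k_def by (rule integral_cong_carrier) simp
  ultimately show ?thesis by simp
qed

text \<open>Pairing the character at \<open>inv x\<close> with a diagonal entry of its own class
  yields \<open>vol / dim\<close>. Together with the coefficient this is the power
  \<open>2 * g\<close> found for the push-forward.\<close>

definition density_summand :: "nat \<Rightarrow> ('a \<Rightarrow> complex mat) set \<Rightarrow> 'a \<Rightarrow> complex" where
  "density_summand g l x = (of_real vol / of_nat (class_dim G l)) ^ (2 * g - 1) * character G (class_rep l) (inv x)"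

definition volume_density :: "nat \<Rightarrow> 'a \<Rightarrow> complex" where
  "volume_density g x = (\<Sum>\<^sub>\<infinity>l\<in>irrep_classes G. density_summand g l x)"

context
  fixes g :: nat
  assumes g: "g \<ge> 2"
    and summable: "(\<lambda>l. real (class_dim G l) powi euler_char g) summable_on irrep_classes G"
begin

text \<open>The left-hand side bounds the modulus of the summand of \<open>l\<close> and is its
  value at the identity, so one identity serves both the convergence and the evaluation of the
  series.\<close>

lemma class_dim_power:
  assumes "l \<in> irrep_classes G"
  shows "(vol / real (class_dim G l)) ^ (2 * g - 1) * real (class_dim G l) = vol ^ (2 * g - 1) * real (class_dim G l) powi euler_char g"
proof -
  have d: "class_dim G l > 0" using class_rep(2)[OF assms] by (simp add: irreducible_rep_def)
  have e: "euler_char g = - int (2 * g - 2)" "2 * g - 1 = Suc (2 * g - 2)" using g by (auto simp: euler_char_def)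
  show ?thesis unfolding e power_int_minus power_int_of_nat
    using d by (simp add: field_simps)
qed

text \<open>A character is largest in modulus at the identity, so the terms of the series at
  \<open>\<one>\<close> form the majorant of the Weierstrass test. The limit runs along the finite
  sets of classes.\<close>

lemma volume_density_uniform_limit:
  "uniform_limit (carrier G) (\<lambda>L x. \<Sum>l\<in>L. density_summand g l x)
     (volume_density g) (finite_subsets_at_top (irrep_classes G))"
  unfolding volume_density_def[abs_def]
proof (rule Weierstrass_m_test_general)
  show "(\<lambda>l. vol ^ (2 * g - 1) * real (class_dim G l) powi euler_char g) summable_on irrep_classes G"
    by (rule summable_on_cmult_right[OF summable])
  fix l x assume l: "l \<in> irrep_classes G" and x: "x \<in> carrier G"
  have "norm (density_summand g l x)
      = (vol / real (class_dim G l)) ^ (2 * g - 1) * cmod (character G (class_rep l) (inv x))"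
    using vol_pos by (simp add: density_summand_def norm_mult norm_power norm_divide)
  also have "\<dots> \<le> (vol / real (class_dim G l)) ^ (2 * g - 1) * real (class_dim G l)"
    using character_norm_le[OF irrep_matrix_rep[OF class_rep(2)[OF l]] inv_closed[OF x]] vol_pos
    by (intro mult_left_mono) auto
  finally show "norm (density_summand g l x)
      \<le> vol ^ (2 * g - 1) * real (class_dim G l) powi euler_char g"
    by (simp only: class_dim_power[OF l])
qed

lemma volume_density_partial_sum_cts:
  "L \<subseteq> irrep_classes G \<Longrightarrow> cts (\<lambda>x. \<Sum>l\<in>L. density_summand g l x)"
  using cts_character[OF irrep_matrix_rep[OF class_rep(2)]]
  unfolding density_summand_def by (intro continuous_intros) auto

lemma cts_volume_density: "cts (volume_density g)"
  by (rule uniform_limit_theorem[OF _ volume_density_uniform_limit])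
     (auto simp del: One_nat_def intro!: eventually_finite_subsets_at_top_weakI volume_density_partial_sum_cts)

lemma integral_volume_density_matrix_rep:
  assumes \<rho>: "irreducible_rep G d \<rho>" and ij: "i < d" "j < d"
  shows "(\<integral>x. volume_density g x * \<rho> x $$ (i, j) \<partial>\<mu>) = (if i = j then (of_real vol / of_nat d) ^ (2 * g) else 0)"
proof -
  note r = irrep_matrix_rep[OF \<rho>]
  have c\<rho>: "cts (\<lambda>x. \<rho> x $$ (i, j))" by (rule cts_matrix_rep[OF r ij])
  obtain l0 where l0: "l0 \<in> irrep_classes G" "class_dim G l0 = d"
    "\<And>x. x \<in> carrier G \<Longrightarrow> character G (class_rep l0) x = character G \<rho> x"
    "\<And>l'. l' \<in> irrep_classes G \<Longrightarrow> l' \<noteq> l0 \<Longrightarrow> \<not> rep_isomorphic G (class_rep l') \<rho>"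
    by (rule class_of_irreducible_rep[OF \<rho>]) blast
  \<comment> \<open>The exchange of limit and integral asks for continuity at every index
    \<open>L\<close>, also when \<open>L\<close> contains sets that are not classes; those partial
    sums are replaced by zero.\<close>
  define S where "S L x = (if L \<subseteq> irrep_classes G then \<Sum>l\<in>L. density_summand g l x else 0)" for L x
  have cS: "cts (S L)" for L
    unfolding S_def using volume_density_partial_sum_cts[of L] by (cases "L \<subseteq> irrep_classes G") auto
  have lim: "uniform_limit (carrier G) S (volume_density g) (finite_subsets_at_top (irrep_classes G))"
  proof (rule uniform_limit_cong[THEN iffD1, OF _ _ volume_density_uniform_limit])
    show "\<forall>\<^sub>F L in finite_subsets_at_top (irrep_classes G). \<forall>x\<in>carrier G.
       (\<Sum>l\<in>L. density_summand g l x) = S L x"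
      by (rule eventually_finite_subsets_at_top_weakI) (simp add: S_def)
  qed simp
  have "((\<lambda>L. \<integral>x. S L x * \<rho> x $$ (i, j) \<partial>\<mu>) \<longlongrightarrow> (\<integral>x. volume_density g x * \<rho> x $$ (i, j) \<partial>\<mu>)) (finite_subsets_at_top (irrep_classes G))"
    by (rule tendsto_integral_uniform_limit[OF lim _ cS c\<rho>]) simp
  \<comment> \<open>Every finite set of classes that contains \<open>l0\<close> already gives the
    exact value, since the other characters are orthogonal to \<open>\<rho>\<close>.\<close>
  moreover have "\<forall>\<^sub>F L in finite_subsets_at_top (irrep_classes G).
      (\<integral>x. S L x * \<rho> x $$ (i, j) \<partial>\<mu>) = (if i = j then (of_real vol / of_nat d) ^ (2 * g) else 0)"
    unfolding eventually_finite_subsets_at_top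
  proof (intro exI[of _ "{l0}"] conjI allI impI)
    fix L assume L: "finite L \<and> {l0} \<subseteq> L \<and> L \<subseteq> irrep_classes G"
    have ct: "cts (density_summand g l)" if "l \<in> L" for l
      unfolding density_summand_def[abs_def] using cts_character[OF irrep_matrix_rep[OF class_rep(2)], of l] that L
      by (intro continuous_intros) auto
    have "(\<integral>x. S L x * \<rho> x $$ (i, j) \<partial>\<mu>) = (\<Sum>l\<in>L. (\<integral>x. density_summand g l x * \<rho> x $$ (i, j) \<partial>\<mu>))"
      using L by (simp add: S_def sum_distrib_right, subst integral_sum')
        (auto intro!: integrable_cts continuous_intros ct c\<rho>)
    also have "\<dots> = (\<Sum>l\<in>L. if l = l0 then (of_real vol / of_nat d) ^ (2 * g - 1) * (if i = j then of_real vol / of_nat d else 0) else 0)"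
    proof (rule sum.cong[OF refl])
      fix l assume "l \<in> L"
      then have l: "l \<in> irrep_classes G" using L by auto
      have "(\<integral>x. density_summand g l x * \<rho> x $$ (i, j) \<partial>\<mu>) = (of_real vol / of_nat (class_dim G l)) ^ (2 * g - 1) * (\<integral>x. character G (class_rep l) (inv x) * \<rho> x $$ (i, j) \<partial>\<mu>)"
        by (simp add: density_summand_def mult.assoc)
      also have "\<dots> = (if l = l0 then (of_real vol / of_nat d) ^ (2 * g - 1) * (if i = j then of_real vol / of_nat d else 0) else 0)"
      proof (cases "l = l0")
        case True
        have "(\<integral>x. character G (class_rep l0) (inv x) * \<rho> x $$ (i, j) \<partial>\<mu>) = (\<integral>x. character G \<rho> (inv x) * \<rho> x $$ (i, j) \<partial>\<mu>)"
          by (rule integral_cong_carrier) (simp add: l0(3))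
        then show ?thesis using True l0(2) integral_character_matrix_rep(1)[OF \<rho> ij] by simp
      next
        case False
        then show ?thesis using integral_character_matrix_rep(2)[OF \<rho> ij class_rep(2)[OF l] l0(4)[OF l]] by simp
      qed
      finally show "(\<integral>x. density_summand g l x * \<rho> x $$ (i, j) \<partial>\<mu>) = (if l = l0 then (of_real vol / of_nat d) ^ (2 * g - 1) * (if i = j then of_real vol / of_nat d else 0) else 0)" .
    qed
    also have "\<dots> = (of_real vol / of_nat d) ^ (2 * g - 1) * (if i = j then of_real vol / of_nat d else 0)"
      using L by simp
    also have "\<dots> = (if i = j then (of_real vol / of_nat d) ^ (2 * g) else 0)"
      using g power_Suc2[of "of_real vol / of_nat d :: complex" "2 * g - 1"] by simp
    finally show "(\<integral>x. S L x * \<rho> x $$ (i, j) \<partial>\<mu>) = (if i = j then (of_real vol / of_nat d) ^ (2 * g) else 0)" .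
  qed (use l0(1) in auto)
  ultimately show ?thesis
    using tendsto_unique[OF finite_subsets_at_top_neq_bot _ tendsto_eventually] by blast
qed

lemma volume_density_one:
  "volume_density g \<one> = of_real (vol ^ (2 * g - 1) * (\<Sum>\<^sub>\<infinity>l\<in>irrep_classes G. real (class_dim G l) powi euler_char g))"
proof -
  have "volume_density g \<one> = (\<Sum>\<^sub>\<infinity>l\<in>irrep_classes G. of_real (vol ^ (2 * g - 1) * real (class_dim G l) powi euler_char g))"
    unfolding volume_density_def density_summand_def
  proof (rule infsum_cong)
    fix l assume l: "l \<in> irrep_classes G"
    note r = irrep_matrix_rep[OF class_rep(2)[OF l]]
    have "character G (class_rep l) (inv \<one>) = of_real (real (class_dim G l))"
      using matrix_rep_one[OF r] by (simp add: character_def rep_dim_eq[OF r])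
    then have "(of_real vol / of_nat (class_dim G l)) ^ (2 * g - 1) * character G (class_rep l) (inv \<one>)
      = complex_of_real ((vol / real (class_dim G l)) ^ (2 * g - 1) * real (class_dim G l))" by simp
    then show "(of_real vol / of_nat (class_dim G l)) ^ (2 * g - 1) * character G (class_rep l) (inv \<one>)
      = complex_of_real (vol ^ (2 * g - 1) * real (class_dim G l) powi euler_char g)"
      by (simp only: class_dim_power[OF l])
  qed
  also have "\<dots> = of_real (vol ^ (2 * g - 1) * (\<Sum>\<^sub>\<infinity>l\<in>irrep_classes G. real (class_dim G l) powi euler_char g))"
    by (intro infsumI has_sum_of_real has_sum_cmult_right has_sum_infsum summable)
  finally show ?thesis .
qed

lemma volume_distribution_eq:
  fixes h :: "'a \<Rightarrow> real"
  assumes h: "cts h"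
  shows "volume_distribution G \<mu> g h = (\<integral>x. Re (volume_density g x) * h x \<partial>\<mu>)"
proof -
  let ?P = "PiM {..<2 * g} (\<lambda>_. \<mu>)"
  note pm = measurable_presentation_map[OF order_refl, of g]
  define M where "M = distr ?P \<mu> (presentation_map G g)"
  interpret P: finite_measure ?P by (rule finite_measure_PiM) simp
  have M: "borel_finite M"
    unfolding borel_finite_def M_def using P.finite_measure_distr[OF pm] sets_\<mu> by simp
  have push: "(\<integral>z. f (presentation_map G g z) \<partial>?P) = (\<integral>x. f x \<partial>M)" if "cts f" for f :: "'a \<Rightarrow> complex"
    unfolding M_def by (rule integral_distr[OF pm cts_measurable[OF borel_\<mu> that], symmetric])
  have ch: "cts (\<lambda>x. complex_of_real (h x))" by (intro continuous_intros h)
  have "complex_of_real (volume_distribution G \<mu> g h) = (\<integral>z. complex_of_real (h (presentation_map G g z)) \<partial>?P)"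
    unfolding volume_distribution_def by (rule integral_complex_of_real[symmetric])
  also have "\<dots> = (\<integral>x. complex_of_real (h x) \<partial>M)" by (rule push[OF ch])
  also have "\<dots> = (\<integral>x. complex_of_real (h x) * volume_density g x \<partial>\<mu>)"
  proof (rule integral_eq_density_if_matrix_coefficients_eq[OF M cts_volume_density ch])
    fix d \<rho> i j assume \<rho>: "irreducible_rep G d \<rho>" and ij: "i < d" "j < d"
    show "(\<integral>x. \<rho> x $$ (i, j) \<partial>M) = (\<integral>x. volume_density g x * \<rho> x $$ (i, j) \<partial>\<mu>)"
      using push[OF cts_matrix_rep[OF irrep_matrix_rep[OF \<rho>] ij]]
        integral_volume_density_matrix_rep[OF \<rho> ij] integral_matrix_rep_presentation_map[OF \<rho> ij, of g] by simp
  qed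
  finally have "volume_distribution G \<mu> g h = Re (\<integral>x. complex_of_real (h x) * volume_density g x \<partial>\<mu>)"
    by (metis Re_complex_of_real)
  also have "\<dots> = (\<integral>x. Re (complex_of_real (h x) * volume_density g x) \<partial>\<mu>)"
    by (intro integral_Re[symmetric] integrable_cts continuous_intros h cts_volume_density)
  finally show ?thesis by (simp add: mult.commute)
qed

end

end

section \<open>Smooth bump functions on manifolds\<close>

lemma openin_Euclidean_space_eventually:
  assumes V: "openin (Euclidean_space n) V" and x: "x \<in> V" and i: "i < n"
  shows "\<forall>\<^sub>F t in nhds (x i). x(i := t) \<in> V"
proof -
  have x0: "x \<in> topspace (Euclidean_space n)" using openin_subset[OF V] x by blast
  have "continuous_map euclideanreal (Euclidean_space n) (\<lambda>t. x(i := t))"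
    unfolding Euclidean_space_def continuous_map_in_subtopology
  proof
    show "continuous_map euclideanreal (powertop_real UNIV) (\<lambda>t. x(i := t))"
      unfolding continuous_map_componentwise_UNIV by (intro allI) (simp add: fun_upd_def)
  qed (use x0 i in \<open>auto simp: topspace_Euclidean_space\<close>)
  from openin_continuous_map_preimage[OF this V] have "open {t. x(i := t) \<in> V}" by simp
  then show ?thesis
    using x by (auto simp: eventually_nhds intro!: exI[of _ "{t. x(i := t) \<in> V}"])
qed

lemma continuous_map_open_subtopology_iff:
  assumes "openin X V"
  shows "continuous_map (subtopology X V) euclideanreal f \<longleftrightarrow> (\<forall>S. open S \<longrightarrow> openin X {x \<in> V. f x \<in> S})"
  using assms openin_subset[OF assms]
  by (auto simp: continuous_map_def openin_open_subtopology Int_absorb1)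

lemma Ck_on_continuous: "Ck_on k n V f \<Longrightarrow> continuous_map (subtopology (Euclidean_space n) V) euclideanreal f"
  by (cases k) auto

text \<open>\<open>D\<close> gathers one partial derivative for each coordinate, in place of the
  separate existential statements inside \<open>Ck_on\<close>.\<close>

definition partials :: "nat \<Rightarrow> (nat \<Rightarrow> real) set \<Rightarrow> ((nat \<Rightarrow> real) \<Rightarrow> real) \<Rightarrow> (nat \<Rightarrow> (nat \<Rightarrow> real) \<Rightarrow> real) \<Rightarrow> bool" where
  "partials n V f D \<longleftrightarrow>
     (\<forall>i<n. \<forall>x\<in>V. ((\<lambda>t. f (x(i := t))) has_real_derivative D i x) (at (x i)))"

lemma partialsD:
  "partials n V f D \<Longrightarrow> i < n \<Longrightarrow> x \<in> V \<Longrightarrow> ((\<lambda>t. f (x(i := t))) has_real_derivative D i x) (at (x i))"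
  by (simp add: partials_def)

lemma Ck_on_SucI:
  assumes "continuous_map (subtopology (Euclidean_space n) V) euclideanreal f"
    and "\<And>i. i < n \<Longrightarrow> Ck_on k n V (D i)" and "partials n V f D"
  shows "Ck_on (Suc k) n V f"
  unfolding Ck_on.simps
proof (intro conjI allI impI assms(1))
  fix i assume "i < n"
  then show "\<exists>f'. (\<forall>x\<in>V. ((\<lambda>t. f (x(i := t))) has_real_derivative f' x) (at (x i))) \<and> Ck_on k n V f'"
    by (intro exI[of _ "D i"] conjI ballI assms(2) partialsD[OF assms(3)])
qed

lemma Ck_on_SucE:
  assumes "Ck_on (Suc k) n V f"
  obtains D where "\<And>i. i < n \<Longrightarrow> Ck_on k n V (D i)" "partials n V f D"
proof -
  have "\<forall>i\<in>{..<n}. \<exists>f'. (\<forall>x\<in>V. ((\<lambda>t. f (x(i := t))) has_real_derivative f' x) (at (x i))) \<and> Ck_on k n V f'"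
    using assms by simp
  from bchoice[OF this] show thesis using that by (auto simp: partials_def)
qed

lemma Ck_on_SucD: "Ck_on (Suc k) n V f \<Longrightarrow> Ck_on k n V f"
proof (induction k arbitrary: f)
  case (Suc k)
  obtain D where D: "\<And>i. i < n \<Longrightarrow> Ck_on (Suc k) n V (D i)" "partials n V f D"
    by (rule Ck_on_SucE[OF Suc.prems]) blast
  show ?case by (rule Ck_on_SucI[OF Ck_on_continuous[OF Suc.prems] Suc.IH[OF D(1)] D(2)])
qed simp

text \<open>\<open>f\<close> and \<open>g\<close> may differ off \<open>V\<close>, but a derivative
  at \<open>x\<close> sees only nearby points of the coordinate line, and these lie in the open set
  \<open>V\<close>.\<close>

lemma Ck_on_cong:
  assumes V: "openin (Euclidean_space n) V" and eq: "\<And>x. x \<in> V \<Longrightarrow> f x = g x" and f: "Ck_on k n V f"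
  shows "Ck_on k n V g"
proof -
  have c: "continuous_map (subtopology (Euclidean_space n) V) euclideanreal g"
    by (rule continuous_map_eq[OF Ck_on_continuous[OF f]]) (use eq in auto)
  show ?thesis
  proof (cases k)
    case (Suc m)
    obtain D where D: "\<And>i. i < n \<Longrightarrow> Ck_on m n V (D i)" "partials n V f D"
      by (rule Ck_on_SucE[OF f[unfolded Suc]]) blast
    have "DERIV (\<lambda>t. g (x(i := t))) (x i) :> D i x" if i: "i < n" and x: "x \<in> V" for i x
    proof (subst DERIV_cong_ev[OF refl _ refl])
      show "\<forall>\<^sub>F t in nhds (x i). g (x(i := t)) = f (x(i := t))"
        using openin_Euclidean_space_eventually[OF V x i] by eventually_elim (simp add: eq)
    qed (rule partialsD[OF D(2) i x])
    then have g': "partials n V g D" by (simp add: partials_def)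
    show ?thesis unfolding Suc by (rule Ck_on_SucI[OF c D(1) g'])
  qed (use c in simp)
qed

text \<open>On the overlap the partial derivatives from both sides agree by uniqueness, so they can
  be glued by cases. This will join a bump inside a chart to its extension by zero.\<close>

lemma Ck_on_Un:
  assumes V: "openin (Euclidean_space n) V" and W: "openin (Euclidean_space n) W"
    and "Ck_on k n V f" "Ck_on k n W f"
  shows "Ck_on k n (V \<union> W) f"
  using assms(3,4)
proof (induction k arbitrary: f)
  case (0 f)
  have "{x \<in> V \<union> W. f x \<in> S} = {x \<in> V. f x \<in> S} \<union> {x \<in> W. f x \<in> S}" for S by blast
  then show ?case
    using 0 by (simp add: continuous_map_open_subtopology_iff V W openin_Un)
next
  case (Suc k)
  have "{x \<in> V \<union> W. f x \<in> S} = {x \<in> V. f x \<in> S} \<union> {x \<in> W. f x \<in> S}" for S by blast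
  then have c: "continuous_map (subtopology (Euclidean_space n) (V \<union> W)) euclideanreal f"
    using Ck_on_continuous[OF Suc.prems(1)] Ck_on_continuous[OF Suc.prems(2)]
    by (simp add: continuous_map_open_subtopology_iff V W openin_Un)
  obtain A where A: "\<And>i. i < n \<Longrightarrow> Ck_on k n V (A i)" "partials n V f A"
    by (rule Ck_on_SucE[OF Suc.prems(1)]) blast
  obtain B where B: "\<And>i. i < n \<Longrightarrow> Ck_on k n W (B i)" "partials n W f B"
    by (rule Ck_on_SucE[OF Suc.prems(2)]) blast
  define D where "D i x = (if x \<in> V then A i x else B i x)" for i x
  show ?case
  proof (rule Ck_on_SucI[OF c])
    fix i assume i: "i < n"
    have "Ck_on k n V (D i)" by (rule Ck_on_cong[OF V _ A(1)[OF i]]) (simp add: D_def)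
    moreover have "B i x = D i x" if "x \<in> W" for x
      using that DERIV_unique[OF partialsD[OF A(2) i] partialsD[OF B(2) i], of x] by (auto simp: D_def)
    then have "Ck_on k n W (D i)" by (rule Ck_on_cong[OF W _ B(1)[OF i]])
    ultimately show "Ck_on k n (V \<union> W) (D i)" by (rule Suc.IH)
  next
    show "partials n (V \<union> W) f D"
      using A(2) B(2) by (auto simp: partials_def D_def)
  qed
qed

lemma Ck_on_const: "Ck_on k n V (\<lambda>x. c)"
proof (induction k arbitrary: c)
  case (Suc k)
  show ?case by (rule Ck_on_SucI[where D = "\<lambda>i x. 0"]) (simp_all add: Suc partials_def)
qed simp

lemma Ck_on_add: "Ck_on k n V f \<Longrightarrow> Ck_on k n V g \<Longrightarrow> Ck_on k n V (\<lambda>x. f x + g x)"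
proof (induction k arbitrary: f g)
  case (Suc k)
  obtain A where A: "\<And>i. i < n \<Longrightarrow> Ck_on k n V (A i)" "partials n V f A"
    by (rule Ck_on_SucE[OF Suc.prems(1)]) blast
  obtain B where B: "\<And>i. i < n \<Longrightarrow> Ck_on k n V (B i)" "partials n V g B"
    by (rule Ck_on_SucE[OF Suc.prems(2)]) blast
  show ?case
    by (rule Ck_on_SucI[OF continuous_map_add[OF Ck_on_continuous[OF Suc.prems(1)] Ck_on_continuous[OF Suc.prems(2)]]
          Suc.IH[OF A(1) B(1)]])
       (auto simp: partials_def intro: DERIV_add partialsD[OF A(2)] partialsD[OF B(2)])
qed (simp add: continuous_map_add)

lemma Ck_on_mult: "Ck_on k n V f \<Longrightarrow> Ck_on k n V g \<Longrightarrow> Ck_on k n V (\<lambda>x. f x * g x)"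
proof (induction k arbitrary: f g)
  case (Suc k)
  obtain A where A: "\<And>i. i < n \<Longrightarrow> Ck_on k n V (A i)" "partials n V f A"
    by (rule Ck_on_SucE[OF Suc.prems(1)]) blast
  obtain B where B: "\<And>i. i < n \<Longrightarrow> Ck_on k n V (B i)" "partials n V g B"
    by (rule Ck_on_SucE[OF Suc.prems(2)]) blast
  show ?case
  proof (rule Ck_on_SucI)
    show "continuous_map (subtopology (Euclidean_space n) V) euclideanreal (\<lambda>x. f x * g x)"
      by (rule continuous_map_real_mult[OF Ck_on_continuous[OF Suc.prems(1)] Ck_on_continuous[OF Suc.prems(2)]])
    fix i assume i: "i < n"
    show "Ck_on k n V (\<lambda>x. A i x * g x + B i x * f x)"
      by (intro Ck_on_add Suc.IH A(1)[OF i] B(1)[OF i] Ck_on_SucD[OF Suc.prems(1)] Ck_on_SucD[OF Suc.prems(2)])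
  next
    show "partials n V (\<lambda>x. f x * g x) (\<lambda>i x. A i x * g x + B i x * f x)"
      unfolding partials_def
    proof (intro allI impI ballI)
      fix i x assume ix: "i < n" "x \<in> V"
      show "DERIV (\<lambda>t. f (x(i := t)) * g (x(i := t))) (x i) :> A i x * g x + B i x * f x"
        using DERIV_mult[OF partialsD[OF A(2) ix] partialsD[OF B(2) ix]] by simp
    qed
  qed
qed (simp add: continuous_map_real_mult)

definition smooth_real :: "(real \<Rightarrow> real) \<Rightarrow> bool" where
  "smooth_real f \<longleftrightarrow> (\<exists>D. D 0 = f \<and> (\<forall>m t. (D m has_real_derivative D (Suc m) t) (at t)))"

text \<open>The induction on \<open>k\<close> has to treat all \<open>D m\<close> at once, since the
  chain rule replaces \<open>D m\<close> by \<open>D (Suc m)\<close>.\<close>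

lemma Ck_on_compose_smooth_real:
  assumes D: "\<And>m t. (D m has_real_derivative D (Suc m) t) (at t)"
    and f: "Ck_on k n V f"
  shows "Ck_on k n V (\<lambda>x. D m (f x))"
proof -
  have cont: "continuous_map (subtopology (Euclidean_space n) V) euclideanreal (\<lambda>x. D m (f x))"
    if f: "continuous_map (subtopology (Euclidean_space n) V) euclideanreal f" for m
  proof -
    have "continuous_on UNIV (D m)" using D by (intro DERIV_continuous_on[of _ _ "D (Suc m)"]) auto
    then have "continuous_map euclideanreal euclideanreal (D m)" by simp
    from continuous_map_compose[OF f this] show ?thesis by (simp add: o_def)
  qed
  show ?thesis using f
  proof (induction k arbitrary: m)
  case (0 m)
  then show ?case using cont by simp
next
  case (Suc k m)
  obtain A where A: "\<And>i. i < n \<Longrightarrow> Ck_on k n V (A i)" "partials n V f A"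
    by (rule Ck_on_SucE[OF Suc.prems]) blast
  show ?case
  proof (rule Ck_on_SucI[OF cont[OF Ck_on_continuous[OF Suc.prems]]])
    fix i assume i: "i < n"
    show "Ck_on k n V (\<lambda>x. D (Suc m) (f x) * A i x)"
      by (intro Ck_on_mult Suc.IH Ck_on_SucD[OF Suc.prems] A(1)[OF i])
  next
    show "partials n V (\<lambda>x. D m (f x)) (\<lambda>i x. D (Suc m) (f x) * A i x)"
      unfolding partials_def using DERIV_chain2[OF D partialsD[OF A(2)], of _ _ m] by simp
  qed
qed
qed

lemma Cinf_on_compose_smooth_real: "smooth_real b \<Longrightarrow> Cinf_on n V f \<Longrightarrow> Cinf_on n V (\<lambda>x. b (f x))"
  unfolding smooth_real_def Cinf_on_def using Ck_on_compose_smooth_real[where m = 0] by metis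

lemma Cinf_on_prod:
  "(\<And>j. j < (m::nat) \<Longrightarrow> Cinf_on n V (f j)) \<Longrightarrow> Cinf_on n V (\<lambda>x. \<Prod>j<m. f j x)"
proof (induction m)
  case 0
  then show ?case by (simp add: Cinf_on_def Ck_on_const)
next
  case (Suc m)
  then show ?case by (simp add: Cinf_on_def Ck_on_mult)
qed

lemma Cinf_on_cong:
  "openin (Euclidean_space n) V \<Longrightarrow> (\<And>x. x \<in> V \<Longrightarrow> f x = g x) \<Longrightarrow> Cinf_on n V f \<Longrightarrow> Cinf_on n V g"
  unfolding Cinf_on_def using Ck_on_cong[of n V f g] by blast

lemma Cinf_on_Un:
  "openin (Euclidean_space n) V \<Longrightarrow> openin (Euclidean_space n) W \<Longrightarrow> Cinf_on n V f \<Longrightarrow> Cinf_on n W f \<Longrightarrow>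
   Cinf_on n (V \<union> W) f"
  unfolding Cinf_on_def using Ck_on_Un[of n V W _ f] by blast

section \<open>The flat function exp(-1/t) and bump functions on the line\<close>

lemma tendsto_power_poly_exp_0:
  fixes p :: "real poly"
  shows "((\<lambda>s. s ^ k * poly p s * exp (- s)) \<longlongrightarrow> 0) at_top"
proof (induction p arbitrary: k)
  case (pCons a p)
  have 1: "((\<lambda>s. a * (s ^ k / exp s)) \<longlongrightarrow> a * 0) at_top"
    by (intro tendsto_intros tendsto_power_div_exp_0)
  \<comment> \<open>The free exponent \<open>k\<close> absorbs the factor \<open>s\<close> that
    \<open>pCons\<close> puts before the remaining polynomial.\<close>
  from tendsto_add[OF 1 pCons.IH[of "Suc k"]]
  show ?case by (simp add: algebra_simps exp_minus divide_inverse)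
qed simp

text \<open>Derivatives of exp(-1/t) are polynomials in 1/t times the same exponential. Carrying the
  polynomial \<open>p\<close> along makes the family closed under differentiation.\<close>

definition flat :: "real poly \<Rightarrow> real \<Rightarrow> real" where
  "flat p t = (if t > 0 then poly p (1 / t) * exp (- (1 / t)) else 0)"

text \<open>With \<open>s = 1 / t\<close>, the derivative of \<open>p(s) exp(-s)\<close> in
  \<open>t\<close> is \<open>s^2 (p - p')(s) exp(-s)\<close>; the two \<open>pCons 0\<close>
  multiply by \<open>s^2\<close>.\<close>

lemma DERIV_flat: "DERIV (flat p) t :> flat (pCons 0 (pCons 0 (p - pderiv p))) t"
proof -
  consider "t > 0" | "t < 0" | "t = 0" by linarith
  then show ?thesis
  proof cases
    case 1
    have inv: "DERIV (\<lambda>t. 1 / t) t :> - (1 / t\<^sup>2)"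
      using 1 by (auto intro!: derivative_eq_intros simp: power2_eq_square)
    have "DERIV (\<lambda>t. poly p (1 / t)) t :> poly (pderiv p) (1 / t) * (- (1 / t\<^sup>2))"
      by (rule DERIV_chain2[OF poly_DERIV inv])
    moreover have "DERIV (\<lambda>t. exp (- (1 / t))) t :> exp (- (1 / t)) * (- (- (1 / t\<^sup>2)))"
      by (rule DERIV_chain2[OF DERIV_exp DERIV_minus[OF inv]])
    ultimately have "((\<lambda>t. poly p (1 / t) * exp (- (1 / t))) has_real_derivative
        poly (pderiv p) (1 / t) * (- (1 / t\<^sup>2)) * exp (- (1 / t)) + exp (- (1 / t)) * (- (- (1 / t\<^sup>2))) * poly p (1 / t)) (at t)"
      by (rule DERIV_mult)
    moreover have "poly (pderiv p) (1 / t) * (- (1 / t\<^sup>2)) * exp (- (1 / t)) + exp (- (1 / t)) * (- (- (1 / t\<^sup>2))) * poly p (1 / t)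
        = flat (pCons 0 (pCons 0 (p - pderiv p))) t"
      using 1 by (simp add: flat_def power2_eq_square algebra_simps)
    ultimately have "DERIV (\<lambda>t. poly p (1 / t) * exp (- (1 / t))) t :> flat (pCons 0 (pCons 0 (p - pderiv p))) t"
      by simp
    moreover have "\<forall>\<^sub>F s in nhds t. flat p s = poly p (1 / s) * exp (- (1 / s))"
      using eventually_nhds_in_open[of "{0<..}" t] 1 by (auto simp: flat_def elim: eventually_mono)
    ultimately show ?thesis by (subst DERIV_cong_ev[OF refl _ refl])
  next
    case 2
    have "\<forall>\<^sub>F s in nhds t. flat p s = 0"
      using eventually_nhds_in_open[of "{..<0}" t] 2 by (auto simp: flat_def elim: eventually_mono)
    then show ?thesis using 2 by (subst DERIV_cong_ev[OF refl _ refl]) (auto simp: flat_def)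
  next
    case 3
    \<comment> \<open>From the right, \<open>s = 1 / h\<close> turns the difference quotient into
      \<open>s p(s) exp(-s)\<close> with \<open>s\<close> tending to infinity.\<close>
    have "((\<lambda>h. flat p h / h) \<longlongrightarrow> 0) (at_right 0)"
    proof -
      have "((\<lambda>h. (inverse h) ^ 1 * poly p (inverse h) * exp (- inverse h)) \<longlongrightarrow> 0) (at_right 0)"
        by (rule filterlim_compose[OF tendsto_power_poly_exp_0 filterlim_inverse_at_top_right])
      then show ?thesis
        by (rule Lim_transform_eventually)
           (auto simp: flat_def eventually_at_filter field_simps)
    qed
    moreover have "((\<lambda>h. flat p h / h) \<longlongrightarrow> 0) (at_left 0)"
      by (rule Lim_transform_eventually[OF tendsto_const]) (auto simp: flat_def eventually_at_filter)
    ultimately have "((\<lambda>h. flat p h / h) \<longlongrightarrow> 0) (at 0)"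
      by (simp add: filterlim_split_at)
    then show ?thesis using 3 by (simp add: DERIV_def flat_def)
  qed
qed

text \<open>Positive exactly for \<open>t\<close> at distance less than \<open>e\<close> from
  \<open>a\<close>: each factor cuts off one side.\<close>

definition bump :: "real \<Rightarrow> real \<Rightarrow> real \<Rightarrow> real" where
  "bump a e t = flat 1 (e + (t - a)) * flat 1 (e - (t - a))"

lemma bump_nonneg: "bump a e t \<ge> 0"
  by (simp add: bump_def flat_def)

lemma bump_pos: "e > 0 \<Longrightarrow> bump a e a > 0"
  by (simp add: bump_def flat_def)

lemma bump_eq_0: "\<bar>t - a\<bar> \<ge> e \<Longrightarrow> bump a e t = 0"
  by (auto simp: bump_def flat_def)

lemma smooth_real_affine_flat:
  "smooth_real (\<lambda>t. flat p (b + c * t))"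
proof -
  define P where "P m = ((\<lambda>p. pCons 0 (pCons 0 (p - pderiv p))) ^^ m) p" for m
  define D where "D m t = c ^ m * flat (P m) (b + c * t)" for m t
  have "DERIV (D m) t :> D (Suc m) t" for m t
  proof -
    have "DERIV (flat (P m)) (b + c * t) :> flat (P (Suc m)) (b + c * t)"
      using DERIV_flat[of "P m"] by (simp add: P_def)
    moreover have "DERIV (\<lambda>t. b + c * t) t :> c"
      by (auto intro!: derivative_eq_intros)
    ultimately have "DERIV (\<lambda>t. flat (P m) (b + c * t)) t :> flat (P (Suc m)) (b + c * t) * c"
      by (rule DERIV_chain2)
    from DERIV_cmult[OF this, of "c ^ m"] show ?thesis by (simp add: D_def[abs_def] mult_ac)
  qed
  moreover have "D 0 = (\<lambda>t. flat p (b + c * t))" by (simp add: D_def[abs_def] P_def)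
  ultimately show ?thesis unfolding smooth_real_def by blast
qed

lemma Cinf_on_bump:
  assumes "Cinf_on n V f" shows "Cinf_on n V (\<lambda>x. bump a e (f x))"
proof -
  have sm: "smooth_real (\<lambda>t. flat 1 (e + (t - a)))" "smooth_real (\<lambda>t. flat 1 (e - (t - a)))"
    using smooth_real_affine_flat[of 1 "e - a" 1] smooth_real_affine_flat[of 1 "e + a" "- 1"]
    by (simp_all add: algebra_simps)
  have "Cinf_on n V (\<lambda>x. flat 1 (e + (f x - a)))" "Cinf_on n V (\<lambda>x. flat 1 (e - (f x - a)))"
    by (rule Cinf_on_compose_smooth_real[OF sm(1) assms], rule Cinf_on_compose_smooth_real[OF sm(2) assms])
  then show ?thesis unfolding bump_def Cinf_on_def by (intro allI Ck_on_mult) auto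
qed

section \<open>Compact coordinate boxes\<close>

definition coordinate_box :: "nat \<Rightarrow> (nat \<Rightarrow> real) \<Rightarrow> real \<Rightarrow> (nat \<Rightarrow> real) set" where
  "coordinate_box n a e = {u \<in> topspace (Euclidean_space n). \<forall>j<n. \<bar>u j - a j\<bar> \<le> e}"

lemma compactin_coordinate_box: "compactin (Euclidean_space n) (coordinate_box n a e)"
proof -
  \<comment> \<open>As a product of compact factors, with \<open>{0}\<close> in the coordinates from
    \<open>n\<close> on, the box is compact by Tychonoff's theorem.\<close>
  have eq: "coordinate_box n a e = (\<Pi>\<^sub>E j\<in>UNIV. if j < n then {a j - e..a j + e} else {0})"
    by (auto simp: coordinate_box_def topspace_Euclidean_space PiE_iff abs_le_iff split: if_splits)
       (smt (verit) linorder_not_less)+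
  have "compactin (powertop_real UNIV) (coordinate_box n a e)"
    unfolding eq compactin_PiE by auto
  moreover have "coordinate_box n a e \<subseteq> {x. \<forall>i\<ge>n. x i = 0}" by (auto simp: coordinate_box_def topspace_Euclidean_space)
  ultimately show ?thesis by (simp add: Euclidean_space_def compactin_subtopology)
qed

lemma coordinate_box_subset_openin:
  assumes V: "openin (Euclidean_space n) V" and a: "a \<in> V"
  obtains e where "e > 0" "coordinate_box n a e \<subseteq> V"
proof -
  obtain T where T: "openin (powertop_real UNIV) T" "V = T \<inter> {x. \<forall>i\<ge>n. x i = 0}"
    using V by (auto simp: Euclidean_space_def openin_subtopology)
  obtain U where U: "\<And>i. open (U i)" "a \<in> PiE UNIV U" "PiE UNIV U \<subseteq> T"
    using T a unfolding openin_product_topology_alt by fastforce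
  have "\<exists>d>0. cball (a i) d \<subseteq> U i" for i
    using U(2) by (intro open_contains_cball[THEN iffD1, rule_format] U(1)) auto
  then obtain d where d: "\<And>i. d i > 0" "\<And>i. cball (a i) (d i) \<subseteq> U i" by metis
  \<comment> \<open>The entry \<open>1\<close> keeps the minimum over a nonempty set in the case
    \<open>n = 0\<close>.\<close>
  define e where "e = Min (insert 1 (d ` {..<n}))"
  have "e > 0" using d(1) by (simp add: e_def)
  moreover have "e \<le> d i" if "i < n" for i using that by (simp add: e_def)
  then have "u i \<in> U i" if "u \<in> coordinate_box n a e" for u i
  proof (cases "i < n")
    case True
    then show ?thesis using that \<open>\<And>i. i < n \<Longrightarrow> e \<le> d i\<close>[OF True] d(2)[of i]
      by (force simp: coordinate_box_def dist_real_def)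
  next
    case False
    then have "u i = a i" using that a T(2) by (auto simp: coordinate_box_def topspace_Euclidean_space)
    then show ?thesis using U(2) by (auto simp: PiE_iff)
  qed
  then have "coordinate_box n a e \<subseteq> V"
    using U(3) T(2) by (fastforce simp: coordinate_box_def topspace_Euclidean_space PiE_iff)
  ultimately show thesis by (rule that)
qed

section \<open>Continuity and bump functions in charts\<close>

lemma is_chartD:
  assumes "is_chart n X c"
  shows "inj_on (snd c) (fst c)" "\<And>x. x \<in> fst c \<Longrightarrow> chart_inv c (snd c x) = x"
    "\<And>W. openin X W \<Longrightarrow> W \<subseteq> fst c \<Longrightarrow> openin (Euclidean_space n) (snd c ` W)"
    "continuous_map (subtopology X (fst c)) (Euclidean_space n) (snd c)"
    "continuous_map (subtopology (Euclidean_space n) (snd c ` fst c)) X (chart_inv c)"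
proof -
  have op: "openin X (fst c)" and opi: "openin (Euclidean_space n) (snd c ` fst c)"
    and hom: "homeomorphic_map (subtopology X (fst c)) (subtopology (Euclidean_space n) (snd c ` fst c)) (snd c)"
    using assms by (auto simp: is_chart_def)
  have ts: "topspace (subtopology X (fst c)) = fst c" using openin_subset[OF op] by auto
  show inj: "inj_on (snd c) (fst c)" using homeomorphic_imp_injective_map[OF hom] ts by simp
  show inv: "chart_inv c (snd c x) = x" if "x \<in> fst c" for x
    unfolding chart_inv_def by (rule inv_into_f_f[OF inj that])
  show "openin (Euclidean_space n) (snd c ` W)" if W: "openin X W" "W \<subseteq> fst c" for W
  proof -
    have "openin (subtopology X (fst c)) W" using W op by (simp add: openin_open_subtopology)
    then have "openin (subtopology (Euclidean_space n) (snd c ` fst c)) (snd c ` W)"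
      using homeomorphic_imp_open_map[OF hom] unfolding open_map_def by blast
    then show ?thesis using opi by (simp add: openin_open_subtopology)
  qed
  show "continuous_map (subtopology X (fst c)) (Euclidean_space n) (snd c)"
    using homeomorphic_imp_continuous_map[OF hom] continuous_map_in_subtopology by blast
  obtain g where g: "homeomorphic_maps (subtopology X (fst c)) (subtopology (Euclidean_space n) (snd c ` fst c)) (snd c) g"
    using hom unfolding homeomorphic_map_maps by blast
  have ts': "topspace (subtopology (Euclidean_space n) (snd c ` fst c)) = snd c ` fst c" using openin_subset[OF opi] by auto
  have "continuous_map (subtopology (Euclidean_space n) (snd c ` fst c)) X g"
    using g by (auto simp: homeomorphic_maps_def continuous_map_in_subtopology)
  then show "continuous_map (subtopology (Euclidean_space n) (snd c ` fst c)) X (chart_inv c)"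
  proof (rule continuous_map_eq)
    fix u assume "u \<in> topspace (subtopology (Euclidean_space n) (snd c ` fst c))"
    then obtain x where x: "x \<in> fst c" "u = snd c x" using ts' by auto
    then show "g u = chart_inv c u" using g inv[OF x(1)] ts by (auto simp: homeomorphic_maps_def)
  qed
qed

lemma smooth_fun_on_continuous_map:
  assumes A: "smooth_atlas n X A" and W: "openin X W" and f: "smooth_fun_on n A W f"
  shows "continuous_map (subtopology X W) euclideanreal f"
  unfolding continuous_map_open_subtopology_iff[OF W]
proof (intro allI impI)
  fix S :: "real set" assume S: "open S"
  have "openin X {x \<in> fst c \<inter> W. f x \<in> S}" if c: "c \<in> A" for c
  proof -
    have ch: "is_chart n X c" using A c by (simp add: smooth_atlas_def)
    then have op: "openin X (fst c)" by (simp add: is_chart_def)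
    note C = is_chartD[OF ch]
    have opW: "openin X (fst c \<inter> W)" using op W by (rule openin_Int)
    have opi: "openin (Euclidean_space n) (snd c ` (fst c \<inter> W))" by (rule C(3)[OF opW]) simp
    have "Ck_on 0 n (snd c ` (fst c \<inter> W)) (\<lambda>u. f (chart_inv c u))"
      using f c unfolding smooth_fun_on_def Cinf_on_def by blast
    define T where "T = {u \<in> snd c ` (fst c \<inter> W). f (chart_inv c u) \<in> S}"
    have "openin (Euclidean_space n) T"
      using S \<open>Ck_on 0 n (snd c ` (fst c \<inter> W)) (\<lambda>u. f (chart_inv c u))\<close>
      by (simp add: T_def continuous_map_open_subtopology_iff[OF opi])
    moreover have "continuous_map (subtopology X (fst c \<inter> W)) (Euclidean_space n) (snd c)"
      by (rule continuous_map_from_subtopology_mono[OF C(4)]) simp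
    ultimately have pre: "openin (subtopology X (fst c \<inter> W)) {x \<in> topspace (subtopology X (fst c \<inter> W)). snd c x \<in> T}"
      by (rule openin_continuous_map_preimage[rotated])
    have ts: "topspace (subtopology X (fst c \<inter> W)) = fst c \<inter> W"
      using openin_subset[OF opW] by auto
    have "snd c x \<in> T \<longleftrightarrow> f x \<in> S" if "x \<in> fst c \<inter> W" for x
      using imageI[OF that, of "snd c"] C(2)[of x] that by (simp add: T_def)
    then have eq: "{x \<in> fst c \<inter> W. snd c x \<in> T} = {x \<in> fst c \<inter> W. f x \<in> S}" by blast
    show ?thesis using pre[unfolded ts eq] opW by (simp only: openin_open_subtopology)
  qed
  then have "openin X (\<Union>c\<in>A. {x \<in> fst c \<inter> W. f x \<in> S})" by blast
  also have "(\<Union>c\<in>A. {x \<in> fst c \<inter> W. f x \<in> S}) = {x \<in> W. f x \<in> S}"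
    using A openin_subset[OF W] by (auto simp: smooth_atlas_def)
  finally show "openin X {x \<in> W. f x \<in> S}" .
qed

text \<open>A product of one-variable bumps in a chart \<open>c\<close>, extended by zero. Its
  support lies in the compact set \<open>K\<close>, which is closed because \<open>X\<close> is
  Hausdorff. So in every chart the function is smooth on two open sets that cover the chart: the
  overlap with \<open>c\<close> and the complement of \<open>K\<close>.\<close>

lemma smooth_bump_exists:
  assumes A: "smooth_atlas n X A" and X: "Hausdorff_space X" and U: "openin X U" and x0: "x0 \<in> U"
  obtains h where "smooth_fun_on n A (topspace X) h" "\<And>x. h x \<ge> 0" "h x0 > 0"
    "X closure_of {x \<in> topspace X. h x \<noteq> 0} \<subseteq> U"
proof -
  have cov: "(\<Union>c\<in>A. fst c) = topspace X" and charts: "\<And>c. c \<in> A \<Longrightarrow> is_chart n X c"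
    using A by (auto simp: smooth_atlas_def)
  obtain c where c: "c \<in> A" "x0 \<in> fst c" using cov x0 openin_subset[OF U] by blast
  note C = is_chartD[OF charts[OF c(1)]]
  have op: "openin X (fst c)" if "c \<in> A" for c using charts[OF that] by (simp add: is_chart_def)
  define a where "a = snd c x0"
  have "openin (Euclidean_space n) (snd c ` (fst c \<inter> U))"
    by (rule C(3)) (use openin_Int[OF op[OF c(1)] U] in auto)
  moreover have "a \<in> snd c ` (fst c \<inter> U)" using c(2) x0 by (simp add: a_def)
  ultimately obtain e where e: "e > 0" "coordinate_box n a e \<subseteq> snd c ` (fst c \<inter> U)" by (rule coordinate_box_subset_openin)
  define K where "K = chart_inv c ` coordinate_box n a e"
  have KU: "K \<subseteq> fst c \<inter> U"
  proof
    fix y assume "y \<in> K"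
    then obtain u where "u \<in> coordinate_box n a e" "y = chart_inv c u" by (auto simp: K_def)
    then obtain x where "x \<in> fst c \<inter> U" "u = snd c x" using e(2) by auto
    then show "y \<in> fst c \<inter> U" using C(2) \<open>y = chart_inv c u\<close> by simp
  qed
  have "compactin (subtopology (Euclidean_space n) (snd c ` fst c)) (coordinate_box n a e)"
    using compactin_coordinate_box e(2) by (auto simp: compactin_subtopology)
  then have "compactin X K" unfolding K_def by (rule image_compactin[OF _ C(5)])
  then have closedK: "closedin X K" by (rule compactin_imp_closedin[OF X])
  define h where "h x = (if x \<in> fst c then \<Prod>j<n. bump (a j) e (snd c x j) else 0)" for x
  have supp: "x \<in> K" if "h x \<noteq> 0" for x
  proof -
    have x: "x \<in> fst c" using that by (auto simp: h_def split: if_splits)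
    have "\<bar>snd c x j - a j\<bar> < e" if j: "j < n" for j
    proof (rule ccontr)
      assume "\<not> \<bar>snd c x j - a j\<bar> < e"
      then have "bump (a j) e (snd c x j) = 0" by (intro bump_eq_0) simp
      then have "h x = 0" using x j by (auto simp: h_def)
      then show False using \<open>h x \<noteq> 0\<close> by simp
    qed
    moreover have "snd c x \<in> topspace (Euclidean_space n)"
      using C(4) x openin_subset[OF op[OF c(1)]] by (auto simp: continuous_map_def)
    ultimately have "snd c x \<in> coordinate_box n a e" by (auto simp: coordinate_box_def intro: less_imp_le)
    then show ?thesis using C(2)[OF x] unfolding K_def by (metis imageI)
  qed
  then have supp': "h x = 0" if "x \<notin> K" for x using that by blast
  show thesis
  proof (rule that)
    show "h x \<ge> 0" for x by (simp add: h_def prod_nonneg bump_nonneg)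
    show "h x0 > 0" using c(2) e(1) by (auto simp: h_def a_def intro!: prod_pos bump_pos)
    show "X closure_of {x \<in> topspace X. h x \<noteq> 0} \<subseteq> U"
      using closure_of_minimal[OF _ closedK, of "{x \<in> topspace X. h x \<noteq> 0}"] supp KU by blast
    show "smooth_fun_on n A (topspace X) h"
      unfolding smooth_fun_on_def
    proof
      fix d assume d: "d \<in> A"
      note D = is_chartD[OF charts[OF d]]
      define V W where "V = snd d ` (fst d \<inter> fst c)" and "W = snd d ` (fst d - K)"
      have opV: "openin (Euclidean_space n) V"
        unfolding V_def by (rule D(3)) (use openin_Int[OF op[OF d] op[OF c(1)]] in auto)
      have opW: "openin (Euclidean_space n) W"
        unfolding W_def by (rule D(3)) (use openin_diff[OF op[OF d] closedK] in auto)
      have "Cinf_on n V (\<lambda>u. snd c (chart_inv d u) j)" if "j < n" for j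
        using A c(1) d that by (simp add: smooth_atlas_def V_def)
      then have "Cinf_on n V (\<lambda>u. \<Prod>j<n. bump (a j) e (snd c (chart_inv d u) j))"
        by (intro Cinf_on_prod Cinf_on_bump)
      then have "Cinf_on n V (\<lambda>u. h (chart_inv d u))"
        by (rule Cinf_on_cong[OF opV, rotated]) (auto simp: V_def D(2) h_def)
      moreover have "Cinf_on n W (\<lambda>u. 0)" by (simp add: Cinf_on_def Ck_on_const)
      then have "Cinf_on n W (\<lambda>u. h (chart_inv d u))"
        by (rule Cinf_on_cong[OF opW, rotated]) (use supp' in \<open>auto simp: W_def D(2)\<close>)
      ultimately have "Cinf_on n (V \<union> W) (\<lambda>u. h (chart_inv d u))"
        by (rule Cinf_on_Un[OF opV opW])
      moreover have "V \<union> W = snd d ` (fst d \<inter> topspace X)"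
        using KU openin_subset[OF op[OF d]] by (auto simp: V_def W_def)
      ultimately show "Cinf_on n (snd d ` (fst d \<inter> topspace X)) (\<lambda>u. h (chart_inv d u))" by simp
    qed
  qed
qed

section \<open>The value at the identity\<close>

context haar_group
begin

lemma Hausdorff_group_top: "Hausdorff_space (group_top G)"
proof (rule Hausdorff_space_subtopology)
  show "Hausdorff_space (euclidean :: 'a topology)"
    unfolding Hausdorff_space_def disjnt_def by simp (metis hausdorff)
qed

lemma smooth_fun_on_continuous_on:
  assumes "smooth_atlas n (group_top G) A" "openin (group_top G) W" "smooth_fun_on n A W f"
  shows "continuous_on W f"
proof -
  have "W \<subseteq> carrier G" using openin_imp_subset[OF assms(2)] .
  then have "subtopology (group_top G) W = top_of_set W"
    by (simp add: subtopology_subtopology Int_absorb1)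
  then show ?thesis using smooth_fun_on_continuous_map[OF assms] by simp
qed

text \<open>If the values differed, the smooth and the continuous representative would differ with a
  fixed sign on a neighbourhood of \<open>w\<close>. A bump supported there gives an integrand of
  one sign with integral zero, which must vanish at \<open>w\<close>, where the bump is
  positive.\<close>

lemma regular_value_unique:
  assumes A: "smooth_atlas n (group_top G) A" and w: "w \<in> carrier G"
    and \<phi>: "cts \<phi>"
    and D: "\<And>h. cts h \<Longrightarrow> D h = (\<integral>x. \<phi> x * h x \<partial>\<mu>)"
    and reg: "regular_with_value G n A \<mu> D w v"
  shows "v = \<phi> w"
proof (rule ccontr)
  assume neq: "v \<noteq> \<phi> w"
  obtain U \<psi> where U: "openin (group_top G) U" "w \<in> U" and \<psi>: "smooth_fun_on n A U \<psi>"
    and res: "restricts_to G n A \<mu> D U \<psi>" and v: "\<psi> w = v"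
    using reg unfolding regular_with_value_def by blast
  have UG: "U \<subseteq> carrier G" using openin_imp_subset[OF U(1)] .
  have c\<psi>: "continuous_on U \<psi>" by (rule smooth_fun_on_continuous_on[OF A U(1) \<psi>])
  have c\<phi>: "continuous_on U \<phi>" by (rule continuous_on_subset[OF \<phi> UG])
  define c where "c = v - \<phi> w"
  \<comment> \<open>Multiplying by \<open>c\<close> makes the difference positive at
    \<open>w\<close> whatever its sign.\<close>
  define k where "k x = (\<psi> x - \<phi> x) * c" for x
  have ck: "continuous_on U k" unfolding k_def by (intro continuous_intros c\<psi> c\<phi>)
  define W where "W = U \<inter> k -` {0<..}"
  have "openin (top_of_set U) W"
    unfolding W_def using ck by (rule continuous_openin_preimage_gen) simp
  then have opW: "openin (group_top G) W" by (rule openin_trans[OF _ U(1)])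
  have wW: "w \<in> W"
    using U(2) neq v by (simp add: W_def k_def c_def flip: power2_eq_square)
  obtain h where h: "smooth_fun_on n A (carrier G) h" "\<And>x. h x \<ge> 0" "h w > 0"
    "group_top G closure_of {x \<in> carrier G. h x \<noteq> 0} \<subseteq> W"
    using smooth_bump_exists[OF A Hausdorff_group_top opW wW] by auto
  define K where "K = group_top G closure_of {x \<in> carrier G. h x \<noteq> 0}"
  have KW: "K \<subseteq> W" using h(4) by (simp add: K_def)
  have hK: "h x = 0" if "x \<in> carrier G" "x \<notin> K" for x
    using closure_of_subset[of "{x \<in> carrier G. h x \<noteq> 0}" "group_top G"] that by (auto simp: K_def)
  have WU: "W \<subseteq> U" by (auto simp: W_def)
  have ch: "cts h"
    by (rule smooth_fun_on_continuous_on[OF A _ h(1)]) simp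
  \<comment> \<open>\<open>\<psi>\<close> is controlled on \<open>U\<close> only; off the support of
    \<open>h\<close> the product is zero, and the two open sets cover the carrier.\<close>
  have c\<psi>h: "cts (\<lambda>x. \<psi> x * h x)"
  proof -
    have eq: "carrier G = U \<union> (carrier G - K)" using UG KW WU by blast
    have "closedin (group_top G) K" by (simp add: K_def)
    then have "openin (group_top G) (carrier G - K)"
      using openin_diff[of "group_top G" "carrier G" K] by simp
    moreover have "continuous_on U (\<lambda>x. \<psi> x * h x)"
      by (intro continuous_intros c\<psi> continuous_on_subset[OF ch UG])
    moreover have "continuous_on (carrier G - K) (\<lambda>x. \<psi> x * h x)"
      by (rule continuous_on_eq[OF continuous_on_const[of _ 0]]) (simp add: hK)
    ultimately have "continuous_on (U \<union> (carrier G - K)) (\<lambda>x. \<psi> x * h x)"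
      using U(1) eq by (intro continuous_on_Un_local_open) auto
    then show ?thesis using eq by simp
  qed
  have c\<phi>h: "cts (\<lambda>x. \<phi> x * h x)" by (intro continuous_intros \<phi> ch)
  have "(\<integral>x. \<psi> x * h x \<partial>\<mu>) = (\<integral>x. \<phi> x * h x \<partial>\<mu>)"
    using res[unfolded restricts_to_def, THEN spec, of h] h(1) subset_trans[OF h(4) WU] D[OF ch] by simp
  then have "(\<integral>x. (\<psi> x * h x - \<phi> x * h x) * c \<partial>\<mu>) = 0"
    using integrable_cts[OF c\<psi>h] integrable_cts[OF c\<phi>h] by simp
  then have "(\<psi> w * h w - \<phi> w * h w) * c = 0"
  proof (rule cts_integral_eq_0D[rotated 2])
    show "cts (\<lambda>x. (\<psi> x * h x - \<phi> x * h x) * c)"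
      by (intro continuous_intros c\<psi>h c\<phi>h)
    show "0 \<le> (\<psi> x * h x - \<phi> x * h x) * c" if x: "x \<in> carrier G" for x
    proof (cases "x \<in> K")
      case True
      then have "k x > 0" using KW by (auto simp: W_def)
      then have "k x * h x \<ge> 0" using h(2)[of x] by simp
      then show ?thesis by (simp add: k_def algebra_simps)
    qed (simp add: hK[OF x])
  qed (rule w)
  then have "c * c * h w = 0" using v by (simp add: c_def algebra_simps)
  then show False using h(3) neq by (simp add: c_def)
qed

end

lemma compact_lie_group_haar_group:
  assumes "compact_lie_group G n A" "bi_invariant_haar G \<mu>"
  shows "haar_group G \<mu>"
proof -
  interpret compact_lie_group G n A by (rule assms(1))
  show ?thesis
  proof
    show "compact (carrier G)" by (rule compact_carrier)
    show "second_countable (group_top G)" by (rule second_countable_group)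
    show "bi_invariant_haar G \<mu>" by (rule assms(2))
    have "continuous_map (top_of_set (carrier G \<times> carrier G)) (group_top G) (\<lambda>(x, y). x \<otimes>\<^bsub>G\<^esub> y)"
      using smooth_mult by (simp add: smooth_map_def prod_topology_subtopology_eu)
    then show "continuous_on (carrier G \<times> carrier G) (\<lambda>z. fst z \<otimes>\<^bsub>G\<^esub> snd z)"
      by (simp add: continuous_map_in_subtopology case_prod_unfold)
    show "continuous_on (carrier G) (\<lambda>x. inv\<^bsub>G\<^esub> x)"
      using smooth_inv by (simp add: smooth_map_def continuous_map_in_subtopology)
  qed
qed

text \<open>Regularity asks for a smooth density near the identity, whereas convergence of the sum
  supplies a continuous one. Hence two conclusions: one for the volume as the value of a regular
  distribution, one for the value of the continuous density.\<close>

theorem theorem0p3: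
  fixes G :: "('a::t2_space, 'b) monoid_scheme" (structure)
    and n :: nat and A :: "'a chart set" and \<mu> :: "'a measure" and g :: nat
  assumes "compact_lie_group G n A"
    and "bi_invariant_haar G \<mu>"
    and "g \<ge> 2"
    and "(\<lambda>l. real (class_dim G l) powi euler_char g) summable_on irrep_classes G"
  shows "(regular_at G n A \<mu> (volume_distribution G \<mu> g) \<one> \<longrightarrow>
           (\<Sum>\<^sub>\<infinity>l\<in>irrep_classes G. real (class_dim G l) powi euler_char g)
             = haar_volume G \<mu> powi (euler_char g - 1) * rep_variety_volume G n A \<mu> g) \<and>
         (\<exists>U \<phi>. openin (group_top G) U \<and> \<one> \<in> U \<and> continuous_on U \<phi> \<and>
           restricts_to G n A \<mu> (volume_distribution G \<mu> g) U \<phi> \<and>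
           (\<Sum>\<^sub>\<infinity>l\<in>irrep_classes G. real (class_dim G l) powi euler_char g)
             = haar_volume G \<mu> powi (euler_char g - 1) * \<phi> \<one>)"
proof -
  interpret compact_lie_group G n A by (rule assms(1))
  interpret haar_group G \<mu> by (rule compact_lie_group_haar_group[OF assms(1,2)])
  define \<phi> where "\<phi> x = Re (volume_density g x)" for x
  let ?D = "volume_distribution G \<mu> g"
  let ?S = "\<Sum>\<^sub>\<infinity>l\<in>irrep_classes G. real (class_dim G l) powi euler_char g"
  have c\<phi>: "continuous_on (carrier G) \<phi>"
    unfolding \<phi>_def by (intro continuous_intros cts_volume_density assms(3,4))
  have D: "?D h = (\<integral>x. \<phi> x * h x \<partial>\<mu>)" if "continuous_on (carrier G) h" for h
    unfolding \<phi>_def by (rule volume_distribution_eq[OF assms(3,4) that])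
  have \<phi>1: "\<phi> \<one> = vol ^ (2 * g - 1) * ?S"
    unfolding \<phi>_def volume_density_one[OF assms(3,4)] by simp
  have "euler_char g - 1 = - int (2 * g - 1)" using assms(3) by (simp add: euler_char_def)
  then have sum_eq: "?S = vol powi (euler_char g - 1) * \<phi> \<one>"
    unfolding \<phi>1 using vol_pos by (simp add: power_int_minus power_int_of_nat del: One_nat_def)
  have "restricts_to G n A \<mu> ?D (carrier G) \<phi>"
    unfolding restricts_to_def
    using D smooth_fun_on_continuous_on[OF atlas openin_subtopology_self] by blast
  moreover have "?S = vol powi (euler_char g - 1) * rep_variety_volume G n A \<mu> g"
    if reg: "regular_at G n A \<mu> ?D \<one>"
  proof -
    have uniq: "v = \<phi> \<one>" if "regular_with_value G n A \<mu> ?D \<one> v" for v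
      by (rule regular_value_unique[OF atlas one_closed c\<phi> D that])
    obtain v where "regular_with_value G n A \<mu> ?D \<one> v" using reg by (auto simp: regular_at_def)
    then have "rep_variety_volume G n A \<mu> g = \<phi> \<one>"
      unfolding rep_variety_volume_def distribution_value_def using uniq by (intro the_equality) auto
    then show ?thesis using sum_eq by simp
  qed
  ultimately show ?thesis
    using sum_eq c\<phi> by (intro conjI impI exI[of _ "carrier G"] exI[of _ \<phi>]) auto
qed

end
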